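(* Let $K$ be a field, $S=K[x_1,\ldots,x_n]$ the polynomial ring with the standard grading, and let $A=\bigoplus_{i,j}A_{(i,j)}$ be a bigraded $K$-algebra with $A_{(0,0)}=K$ such that, setting $A_j=\bigoplus_i A_{(i,j)}$, one has $A_0=S$, the algebra $A=\bigoplus_j A_j$ is a finitely generated standard graded $S$-algebra, and $A_{(i,1)}=0$ for $i<0$. Let $f_1,\ldots,f_m$ be a fixed system of homogeneous generators of the $S$-module $A_1$, with $\deg f_j=d_j$ for $j=1,\ldots,m$. Let $T=K[x_1,\ldots,x_n,y_1,\ldots,y_m]$ be the polynomial ring bigraded by $\deg x_i=(1,0)$ and $\deg y_j=(d_j,1)$, and let $J\subset T$ be the defining ideal of $A$, that is, the kernel of the surjective $K$-algebra homomorphism $\varphi:T\to A$ with $\varphi(x_i)=x_i$ for $i=1,\ldots,n$ and $\varphi(y_j)=f_j$ for $j=1,\ldots,m$. Let $<$ be the monomial order on $T$ induced by a monomial order $<'$ on $K[y_1,\ldots,y_m]$ and a monomial order $<_x$ on $K[x_1,\ldots,x_n]$. If the initial ideal $\mathrm{in}_{<}(J)$ is generated by quadratic monomials, then for all $k\geq 1$ the $S$-module $A_k$ has linear quotients with respect to a minimal generating set, and hence it is componentwise linear.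
   Context: Each $A_j$ is a graded $S$-module with $(A_j)_i=A_{(i,j)}$. "Standard graded $S$-algebra" means that $A$ is generated over $A_0=S$ by $A_1$. The order $<$ on $T$ induced by $<'$ and $<_x$ is defined by: $\prod_{i=1}^n x_i^{a_i}\prod_{i=1}^m y_i^{b_i} < \prod_{i=1}^n x_i^{a'_i}\prod_{i=1}^m y_i^{b'_i}$ if either $\prod_{i=1}^m y_i^{b_i}<'\prod_{i=1}^m y_i^{b'_i}$, or $\prod_{i=1}^m y_i^{b_i}=\prod_{i=1}^m y_i^{b'_i}$ and $\prod_{i=1}^n x_i^{a_i}<_x\prod_{i=1}^n x_i^{a'_i}$. A quadratic monomial of $T$ is a monomial of total degree two when every variable $x_i$, $y_j$ is given degree one. A graded $S$-module $M$ has linear quotients (with respect to a system of homogeneous generators $g_1,\ldots,g_s$ of $M$, in this order) if each of the colon ideals $(g_1,\ldots,g_{j-1}):g_j\subset S$ is generated by linear forms (the zero ideal being allowed). A finitely generated graded $S$-module $M$ is componentwise linear if for each integer $j$ the submodule of $M$ generated by all homogeneous elements of degree $j$ of $M$ has a linear resolution.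
   Formalization: The generators f_1,…,f_m are assumed to be a minimal system (and n,m ≥ 1); for arbitrary generators the claim fails, e.g. A=K[x_1,x_2][t]/(x_1x_2t), f_1=t, f_2=x_1t, y_1>'y_2, where in(J)=(x_1y_1,x_2y_2) but A_1=S/(x_1x_2). *)

theory Defs
  imports Complex_Main "HOL-Library.Poly_Mapping" "HOL-Library.Function_Algebras"
begin

section \<open>Polynomial rings\<close>

text \<open>
  For a finite type of variables \<open>'v\<close>, the type \<open>('v, 'k) mpoly\<close> with its convolution product is
  the polynomial ring in \<open>CARD('v)\<close> variables over \<open>'k\<close>: exponent vectors are mapped to
  coefficients.
\<close>

type_synonym 'v monomial = "'v \<Rightarrow>\<^sub>0 nat"
type_synonym ('v, 'k) mpoly = "('v \<Rightarrow>\<^sub>0 nat) \<Rightarrow>\<^sub>0 'k"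

definition monom_poly :: "'v monomial \<Rightarrow> ('v, 'k::field) mpoly" where
  "monom_poly t = Poly_Mapping.single t 1"

definition const_poly :: "'k::field \<Rightarrow> ('v, 'k) mpoly" where
  "const_poly c = Poly_Mapping.single 0 c"

definition var_poly :: "'v \<Rightarrow> ('v, 'k::field) mpoly" where
  "var_poly v = monom_poly (Poly_Mapping.single v 1)"

definition total_deg :: "'v monomial \<Rightarrow> nat" where
  "total_deg t = (\<Sum>v\<in>Poly_Mapping.keys t. Poly_Mapping.lookup t v)"

text \<open>The component \<open>S\<^sub>i\<close> of the standard grading; it is \<open>{0}\<close> for \<open>i < 0\<close>.\<close>

definition forms :: "int \<Rightarrow> ('v, 'k::field) mpoly set" where
  "forms i = {p. \<forall>t\<in>Poly_Mapping.keys p. int (total_deg t) = i}"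

definition ideal_generated :: "'r::comm_ring_1 set \<Rightarrow> 'r set" where
  "ideal_generated B = module.span (*) B"

definition is_ring_hom :: "('r::comm_ring_1 \<Rightarrow> 's::comm_ring_1) \<Rightarrow> bool" where
  "is_ring_hom h \<longleftrightarrow>
     h 1 = 1 \<and> (\<forall>a b. h (a + b) = h a + h b) \<and> (\<forall>a b. h (a * b) = h a * h b)"


section \<open>Monomial orders and initial ideals\<close>

text \<open>
  Strict monomial orders. In finitely many variables they are automatically well-founded.
\<close>

definition monomial_order :: "('v monomial \<Rightarrow> 'v monomial \<Rightarrow> bool) \<Rightarrow> bool" where
  "monomial_order lt \<longleftrightarrow>
     (\<forall>s. \<not> lt s s) \<and>
     (\<forall>s t u. lt s t \<longrightarrow> lt t u \<longrightarrow> lt s u) \<and>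
     (\<forall>s t. s \<noteq> t \<longrightarrow> lt s t \<or> lt t s) \<and>
     (\<forall>t. t \<noteq> 0 \<longrightarrow> lt 0 t) \<and>
     (\<forall>s t u. lt s t \<longrightarrow> lt (s + u) (t + u))"

text \<open>
  In \<open>T = K[x\<^sub>1,\<dots>,x\<^sub>n,y\<^sub>1,\<dots>,y\<^sub>m]\<close> the variable \<open>x\<^sub>i\<close> is indexed by \<open>Inl i\<close> and \<open>y\<^sub>j\<close> by \<open>Inr j\<close>.
\<close>

definition x_part :: "('x + 'y) monomial \<Rightarrow> 'x monomial" where
  "x_part t = Poly_Mapping.map_key Inl t"

definition y_part :: "('x + 'y) monomial \<Rightarrow> 'y monomial" where
  "y_part t = Poly_Mapping.map_key Inr t"

definition induced_order ::
  "('y monomial \<Rightarrow> 'y monomial \<Rightarrow> bool) \<Rightarrow> ('x monomial \<Rightarrow> 'x monomial \<Rightarrow> bool)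
    \<Rightarrow> ('x + 'y) monomial \<Rightarrow> ('x + 'y) monomial \<Rightarrow> bool" where
  "induced_order lty ltx s t \<longleftrightarrow>
     lty (y_part s) (y_part t) \<or> (y_part s = y_part t \<and> ltx (x_part s) (x_part t))"

definition leading_monomial ::
  "('v monomial \<Rightarrow> 'v monomial \<Rightarrow> bool) \<Rightarrow> ('v, 'k::field) mpoly \<Rightarrow> 'v monomial" where
  "leading_monomial lt p =
     (THE t. t \<in> Poly_Mapping.keys p \<and> (\<forall>s\<in>Poly_Mapping.keys p. s \<noteq> t \<longrightarrow> lt s t))"

definition initial_ideal ::
  "('v monomial \<Rightarrow> 'v monomial \<Rightarrow> bool) \<Rightarrow> ('v, 'k::field) mpoly set \<Rightarrow> ('v, 'k) mpoly set" where
  "initial_ideal lt J = ideal_generated {monom_poly (leading_monomial lt p) | p. p \<in> J \<and> p \<noteq> 0}"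

definition generated_by_quadratic_monomials :: "('v, 'k::field) mpoly set \<Rightarrow> bool" where
  "generated_by_quadratic_monomials I \<longleftrightarrow>
     (\<exists>Q. (\<forall>t\<in>Q. total_deg t = 2) \<and> I = ideal_generated (monom_poly ` Q))"


section \<open>Bigraded algebras\<close>

text \<open>The sum of a family of subgroups: all finite sums of elements of the members.\<close>

definition family_sum :: "('i \<Rightarrow> 'a::comm_monoid_add set) \<Rightarrow> 'a set" where
  "family_sum M =
     {\<Sum>i\<in>Poly_Mapping.keys c. Poly_Mapping.lookup c i | c. \<forall>i. Poly_Mapping.lookup c i \<in> M i}"

text \<open>
  A bigraded \<open>K\<close>-algebra structure on the commutative ring \<open>'a\<close>, with structure map \<open>\<kappa>\<close> and
  homogeneous components \<open>G i j\<close>. The internal degree \<open>i\<close> is an integer. The degree \<open>j\<close>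
  is a natural number: a standard graded algebra has no component in negative degree.
\<close>

locale bigraded_algebra =
  fixes \<kappa> :: "'k::field \<Rightarrow> 'a::comm_ring_1"
    and G :: "int \<Rightarrow> nat \<Rightarrow> 'a set"
  assumes structure_hom: "is_ring_hom \<kappa>"
    and zero_mem: "0 \<in> G i j"
    and add_mem: "a \<in> G i j \<Longrightarrow> b \<in> G i j \<Longrightarrow> a + b \<in> G i j"
    and scalar_mem: "a \<in> G i j \<Longrightarrow> \<kappa> c * a \<in> G i j"
    and one_mem: "1 \<in> G 0 0"
    and mult_mem: "a \<in> G i j \<Longrightarrow> b \<in> G i' j' \<Longrightarrow> a * b \<in> G (i + i') (j + j')"
    and direct_sum:
      "\<exists>!c :: (int \<times> nat) \<Rightarrow>\<^sub>0 'a.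
         (\<forall>i j. Poly_Mapping.lookup c (i, j) \<in> G i j) \<and>
         a = (\<Sum>p\<in>Poly_Mapping.keys c. Poly_Mapping.lookup c p)"

definition component :: "(int \<Rightarrow> nat \<Rightarrow> 'a::comm_ring_1 set) \<Rightarrow> nat \<Rightarrow> 'a set" where
  "component G j = family_sum (\<lambda>i. G i j)"

inductive_set subring_generated :: "'a::comm_ring_1 set \<Rightarrow> 'a set" for B where
  one: "1 \<in> subring_generated B"
| base: "a \<in> B \<Longrightarrow> a \<in> subring_generated B"
| diff: "a \<in> subring_generated B \<Longrightarrow> b \<in> subring_generated B \<Longrightarrow> a - b \<in> subring_generated B"
| mult: "a \<in> subring_generated B \<Longrightarrow> b \<in> subring_generated B \<Longrightarrow> a * b \<in> subring_generated B"

text \<open>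
  The algebra is finitely generated over \<open>A\<^sub>0\<close>, and generated over \<open>A\<^sub>0\<close> by \<open>A\<^sub>1\<close>. The
  subalgebra over \<open>A\<^sub>0\<close> generated by \<open>B\<close> is the subring generated by \<open>A\<^sub>0 \<union> B\<close>.
\<close>

definition fg_standard_graded :: "(int \<Rightarrow> nat \<Rightarrow> 'a::comm_ring_1 set) \<Rightarrow> bool" where
  "fg_standard_graded G \<longleftrightarrow>
     subring_generated (component G 0 \<union> component G 1) = UNIV \<and>
     (\<exists>F. finite F \<and> subring_generated (component G 0 \<union> F) = UNIV)"


section \<open>Graded modules over the polynomial ring\<close>

text \<open>
  A graded \<open>S\<close>-module is given by its scalar multiplication \<open>scale\<close> and the family \<open>M\<close> of its
  homogeneous components inside some abelian group; its underlying set is \<open>family_sum M\<close>.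
\<close>

definition scale_via :: "('r::comm_ring_1 \<Rightarrow> 'a::comm_ring_1) \<Rightarrow> 'r \<Rightarrow> 'a \<Rightarrow> 'a" where
  "scale_via h s a = h s * a"

definition irredundant ::
  "('r::comm_ring_1 \<Rightarrow> 'a::ab_group_add \<Rightarrow> 'a) \<Rightarrow> ('i \<Rightarrow> 'a) \<Rightarrow> 'i set \<Rightarrow> bool" where
  "irredundant scale g I \<longleftrightarrow> (\<forall>i\<in>I. g i \<notin> module.span scale (g ` (I - {i})))"

definition homogeneous_minimal_generators ::
  "(('v, 'k::field) mpoly \<Rightarrow> 'a::ab_group_add \<Rightarrow> 'a) \<Rightarrow> (int \<Rightarrow> 'a set) \<Rightarrow> 'a list \<Rightarrow> bool" where
  "homogeneous_minimal_generators scale M gs \<longleftrightarrow>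
     (\<forall>g\<in>set gs. \<exists>e. g \<in> M e) \<and>
     module.span scale (set gs) = family_sum M \<and>
     irredundant scale (\<lambda>i. gs ! i) {..<length gs}"

definition generated_by_linear_forms :: "('v, 'k::field) mpoly set \<Rightarrow> bool" where
  "generated_by_linear_forms I \<longleftrightarrow> (\<exists>L \<subseteq> forms 1. I = ideal_generated L)"

definition colon_ideal ::
  "(('v, 'k::field) mpoly \<Rightarrow> 'a::ab_group_add \<Rightarrow> 'a) \<Rightarrow> 'a set \<Rightarrow> 'a \<Rightarrow> ('v, 'k) mpoly set" where
  "colon_ideal scale B g = {s. scale s g \<in> module.span scale B}"

definition linear_quotients ::
  "(('v, 'k::field) mpoly \<Rightarrow> 'a::ab_group_add \<Rightarrow> 'a) \<Rightarrow> 'a list \<Rightarrow> bool" where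
  "linear_quotients scale gs \<longleftrightarrow>
     (\<forall>j<length gs. generated_by_linear_forms (colon_ideal scale (set (take j gs)) (gs ! j)))"

text \<open>Homogeneous homomorphisms of degree zero; the values outside the domain are irrelevant.\<close>

definition graded_hom ::
  "(('v, 'k::field) mpoly \<Rightarrow> 'a::ab_group_add \<Rightarrow> 'a) \<Rightarrow> (int \<Rightarrow> 'a set)
    \<Rightarrow> (('v, 'k) mpoly \<Rightarrow> 'b::ab_group_add \<Rightarrow> 'b) \<Rightarrow> (int \<Rightarrow> 'b set) \<Rightarrow> ('a \<Rightarrow> 'b) \<Rightarrow> bool" where
  "graded_hom scaleM M scaleN N h \<longleftrightarrow>
     (\<forall>u\<in>family_sum M. \<forall>v\<in>family_sum M. h (u + v) = h u + h v) \<and>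
     (\<forall>s. \<forall>u\<in>family_sum M. h (scaleM s u) = scaleN s (h u)) \<and>
     (\<forall>e. h ` M e \<subseteq> N e)"

text \<open>
  The components of the graded free module \<open>S(-a)\<^bsup>b\<^esup>\<close>, whose elements are the functions
  \<open>nat \<Rightarrow> S\<close> vanishing from \<open>b\<close> on: \<open>(S(-a)\<^bsup>b\<^esup>)\<^sub>e = (S\<^bsub>e-a\<^esub>)\<^bsup>b\<^esup>\<close>.
\<close>

definition free_scale :: "('v, 'k::field) mpoly \<Rightarrow> (nat \<Rightarrow> ('v, 'k) mpoly) \<Rightarrow> nat \<Rightarrow> ('v, 'k) mpoly" where
  "free_scale s v = (\<lambda>i. s * v i)"

definition shifted_free :: "nat \<Rightarrow> int \<Rightarrow> int \<Rightarrow> (nat \<Rightarrow> ('v, 'k::field) mpoly) set" where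
  "shifted_free b a e = {v. (\<forall>i<b. v i \<in> forms (e - a)) \<and> (\<forall>i\<ge>b. v i = 0)}"

text \<open>
  A linear resolution of \<open>M\<close> is a graded free resolution
  \<open>\<dots> \<rightarrow> F 2 \<rightarrow> F 1 \<rightarrow> F 0 \<rightarrow> M \<rightarrow> 0\<close> with \<open>F i = S(-d-i)\<^bsup>b i\<^esup>\<close> for some \<open>d\<close>. For degree reasons it is
  automatically minimal. The zero module has one, with all \<open>b i = 0\<close>.
\<close>

definition has_linear_resolution ::
  "(('v, 'k::field) mpoly \<Rightarrow> 'a::ab_group_add \<Rightarrow> 'a) \<Rightarrow> (int \<Rightarrow> 'a set) \<Rightarrow> bool" where
  "has_linear_resolution scale M \<longleftrightarrow>
     (\<exists>(d::int) (b::nat \<Rightarrow> nat) (\<epsilon> :: (nat \<Rightarrow> ('v, 'k) mpoly) \<Rightarrow> 'a)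
        (\<phi> :: nat \<Rightarrow> (nat \<Rightarrow> ('v, 'k) mpoly) \<Rightarrow> (nat \<Rightarrow> ('v, 'k) mpoly)).
        let F = (\<lambda>i. shifted_free (b i) (d + int i)) in
        graded_hom free_scale (F 0) scale M \<epsilon> \<and>
        (\<forall>i. graded_hom free_scale (F (Suc i)) free_scale (F i) (\<phi> i)) \<and>
        \<epsilon> ` family_sum (F 0) = family_sum M \<and>
        \<phi> 0 ` family_sum (F 1) = {u \<in> family_sum (F 0). \<epsilon> u = 0} \<and>
        (\<forall>i. \<phi> (Suc i) ` family_sum (F (Suc (Suc i))) = {u \<in> family_sum (F (Suc i)). \<phi> i u = 0}))"

text \<open>
  The submodule generated by the component \<open>M j\<close> is homogeneous, so its component of degree \<open>e\<close>
  is its intersection with \<open>M e\<close>.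
\<close>

definition componentwise_linear ::
  "(('v, 'k::field) mpoly \<Rightarrow> 'a::ab_group_add \<Rightarrow> 'a) \<Rightarrow> (int \<Rightarrow> 'a set) \<Rightarrow> bool" where
  "componentwise_linear scale M \<longleftrightarrow>
     (\<exists>B. finite B \<and> module.span scale B = family_sum M) \<and>
     (\<forall>j. has_linear_resolution scale (\<lambda>e. module.span scale (M j) \<inter> M e))"

end

theory Submission
  imports Defs
begin

text \<open>
  The theorem is the conjunction of a statement about Groebner bases and a general fact on graded
  modules.

  Linear quotients. Call \<open>y\<^sup>b\<close> standard if it is not in the initial ideal of \<open>J\<close>. The images of the
  standard monomials of degree \<open>k\<close> generate \<open>A\<^sub>k\<close>: a relation whose leading monomial is a pure
  monomial \<open>y\<^sup>b\<close> has a constant as its leading coefficient, so it expresses the image of \<open>y\<^sup>b\<close> by those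
  of smaller monomials (\<open>straighten\<close>). List the standard monomials increasingly. If \<open>s\<close> times the
  image of \<open>y\<^sup>b\<close> is a combination of the earlier ones, then \<open>in(s) y\<^sup>b\<close> lies in the initial ideal,
  hence is divisible by one of its quadratic generators. That generator does not divide \<open>y\<^sup>b\<close>, and it
  is not a monomial in \<open>x\<close> alone because \<open>S\<close> embeds into \<open>A\<close>; so it is some \<open>x\<^sub>i y\<^sub>l\<close>. By
  bihomogeneity it comes from a linear syzygy: a linear form with leading monomial \<open>x\<^sub>i\<close> times
  \<open>f\<^sub>l\<close> is a combination of smaller generators. Multiplying with \<open>y\<^sup>b / y\<^sub>l\<close> and straightening shows
  that this linear form is in the same colon ideal, and its leading monomial divides \<open>in(s)\<close>
  (\<open>colon_leading_monomial\<close>). Division with remainder then shows that the colon ideal is generated by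
  linear forms (\<open>colon_standard\<close>). Since \<open>f\<close> is minimal, the other coefficients of the linear syzygy
  have no constant term; hence no syzygy of the standard monomials has a constant term, which
  is minimality (\<open>irredundantI\<close>).

  Componentwise linearity. An ideal generated by linear forms is prime, being the kernel of the
  ring endomorphism that eliminates variables. So \<open>(l\<^sub>1,\<dots>,l\<^sub>a) : l\<close> equals \<open>(l\<^sub>1,\<dots>,l\<^sub>a)\<close> for a linear
  form \<open>l\<close> outside this ideal. It follows, adding one generator at a time, that for a module \<open>N\<close>
  with linear quotients and generators of one degree both the syzygy module
  (\<open>linear_syzygies\<close>) and \<open>\<mm>N\<close>, where \<open>\<mm>\<close> is the ideal of the variables
  (\<open>linear_quotients_irrelevant_multiple\<close>) have linear quotients with
  generators of the next degree. Iterating the first yields a linear resolution of \<open>N\<close>, without mapping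
  cones. The second handles the components of a module \<open>M\<close> with minimal generators of several
  degrees: the submodule generated by \<open>M\<^bsub>j+1\<^esub>\<close> is \<open>\<mm>\<close> times the one generated by \<open>M\<^sub>j\<close>, plus the
  generators of degree \<open>j + 1\<close>, whose colon ideals do not change
  (\<open>linear_quotients_imp_componentwise_linear\<close>).
\<close>

abbreviation lookup :: "('a \<Rightarrow>\<^sub>0 'b::zero) \<Rightarrow> 'a \<Rightarrow> 'b" where
  "lookup \<equiv> Poly_Mapping.lookup"

abbreviation keys :: "('a \<Rightarrow>\<^sub>0 'b::zero) \<Rightarrow> 'a set" where
  "keys \<equiv> Poly_Mapping.keys"

abbreviation single :: "'a \<Rightarrow> 'b \<Rightarrow> 'a \<Rightarrow>\<^sub>0 'b::zero" where
  "single \<equiv> Poly_Mapping.single"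

section \<open>Polynomials as sums of terms\<close>

lemma sum_of_terms: "p = (\<Sum>t\<in>keys p. single t (lookup p t))"
proof (rule poly_mapping_eqI)
  fix s
  have "lookup (\<Sum>t\<in>keys p. single t (lookup p t)) s = (\<Sum>t\<in>keys p. if t = s then lookup p s else 0)"
    by (auto simp: lookup_sum lookup_single when_def intro!: sum.cong)
  also have "\<dots> = lookup p s"
    by (simp add: sum.delta' in_keys_iff)
  finally show "lookup p s = lookup (\<Sum>t\<in>keys p. single t (lookup p t)) s" by simp
qed

lemma sum_terms_induct [case_names zero single add]:
  fixes p :: "'a \<Rightarrow>\<^sub>0 'b::comm_monoid_add"
  assumes "P 0" and "\<And>t c. P (single t c)" and "\<And>p q. P p \<Longrightarrow> P q \<Longrightarrow> P (p + q)"
  shows "P p"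
proof -
  have "P (\<Sum>t\<in>A. single t (lookup p t))" if "finite A" for A
    using that by induction (auto intro: assms)
  then show ?thesis
    by (metis sum_of_terms finite_keys)
qed

lemma total_deg_eq: "total_deg (t :: 'v::finite monomial) = (\<Sum>v\<in>UNIV. lookup t v)"
  unfolding total_deg_def by (intro sum.mono_neutral_left) (auto simp: in_keys_iff)

lemma total_deg_add: "total_deg (s + t :: 'v::finite monomial) = total_deg s + total_deg t"
  by (simp add: total_deg_eq lookup_add sum.distrib)

lemma total_deg_single [simp]: "total_deg (single v n) = n"
  by (simp add: total_deg_def)

lemma total_deg_0 [simp]: "total_deg 0 = 0"
  by (simp add: total_deg_def)

lemma total_deg_eq_0_iff: "total_deg t = 0 \<longleftrightarrow> t = 0"
  by (auto simp: total_deg_def in_keys_iff intro: poly_mapping_eqI)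

lemma split_off_variable:
  assumes "lookup t v \<noteq> 0"
  shows "t = single v 1 + (t - single v (1::nat))"
  using assms by (intro poly_mapping_eqI) (auto simp: lookup_add lookup_minus lookup_single when_def)

lemma total_deg_1E:
  assumes "total_deg (t :: 'v::finite monomial) = 1"
  obtains v where "t = single v 1"
proof -
  have "t \<noteq> 0" using assms by auto
  then obtain v where v: "lookup t v \<noteq> 0"
    using poly_mapping_eqI[of t 0] by auto
  have "total_deg (t - single v 1) = 0"
    using split_off_variable[OF v] assms by (metis add_left_cancel total_deg_add total_deg_single add.right_neutral)
  then show ?thesis
    using split_off_variable[OF v] that by (simp add: total_deg_eq_0_iff)
qed

lemma monomial_induct [case_names zero var]:
  fixes t :: "'v::finite monomial"
  assumes "P 0" and "\<And>v t. P t \<Longrightarrow> P (single v 1 + t)"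
  shows "P t"
proof (induction "total_deg t" arbitrary: t rule: less_induct)
  case less
  show ?case
  proof (cases "t = 0")
    case False
    then obtain v where v: "lookup t v \<noteq> 0"
      using poly_mapping_eqI[of t 0] by auto
    note eq = split_off_variable[OF v]
    have "total_deg t = 1 + total_deg (t - single v 1)"
      by (subst eq) (simp only: total_deg_add total_deg_single)
    then have "P (t - single v 1)" by (intro less) simp
    then show ?thesis using assms(2) eq by metis
  qed (simp add: assms)
qed

lemma var_poly_eq: "var_poly v = single (single v 1) 1"
  by (simp add: var_poly_def monom_poly_def)

lemma polynomial_induct [case_names const var add mult]:
  fixes p :: "('v::finite, 'k::field) mpoly"
  assumes c: "\<And>c. P (const_poly c)" and v: "\<And>v. P (var_poly v)"
    and add: "\<And>p q. P p \<Longrightarrow> P q \<Longrightarrow> P (p + q)" and mult: "\<And>p q. P p \<Longrightarrow> P q \<Longrightarrow> P (p * q)"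
  shows "P p"
proof (induction p rule: sum_terms_induct)
  case zero
  show ?case using c[of 0] by (simp add: const_poly_def)
next
  case (single t c)
  have "P (monom_poly t)"
  proof (induction t rule: monomial_induct)
    case zero
    show ?case using assms(1)[of 1] by (simp add: const_poly_def monom_poly_def)
  next
    case (var w t)
    have "monom_poly (single w 1 + t) = var_poly w * (monom_poly t :: ('v, 'k) mpoly)"
      by (simp add: var_poly_eq monom_poly_def mult_single)
    then show ?case using mult[OF v var] by metis
  qed
  then have "P (const_poly c * monom_poly t)" by (intro mult c)
  then show ?case by (simp add: const_poly_def monom_poly_def mult_single)
qed (rule add)

lemma const_poly_0 [simp]: "const_poly 0 = 0"
  by (simp add: const_poly_def)

lemma const_poly_1 [simp]: "const_poly 1 = 1"
  by (simp add: const_poly_def)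

lemma const_poly_add: "const_poly (a + b) = const_poly a + const_poly b"
  by (simp add: const_poly_def single_add)

lemma const_poly_mult: "const_poly (a * b) = const_poly a * const_poly b"
  by (simp add: const_poly_def mult_single)

lemma single_eq_const_monom: "single t c = const_poly c * monom_poly t"
  by (simp add: const_poly_def monom_poly_def mult_single)

lemma lookup_single_times:
  fixes p :: "('v, 'k::field) mpoly"
  shows "lookup (single u c * p) (u + t) = c * lookup p t"
  by (induction p rule: sum_terms_induct)
     (auto simp: mult_single lookup_single when_def algebra_simps lookup_add)

lemma lookup_const_times:
  fixes p :: "('v, 'k::field) mpoly"
  shows "lookup (const_poly c * p) t = c * lookup p t"
  using lookup_single_times[of 0 c p t] by (simp add: const_poly_def)

lemma keys_single_times:
  fixes p :: "('v, 'k::field) mpoly"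
  assumes "c \<noteq> 0"
  shows "keys (single u c * p) = (+) u ` keys p"
proof
  show "keys (single u c * p) \<subseteq> (+) u ` keys p"
    using keys_mult[of "single u c" p] assms by (auto split: if_splits)
  show "(+) u ` keys p \<subseteq> keys (single u c * p)"
    using assms by (auto simp: in_keys_iff lookup_single_times)
qed

definition restrict_terms :: "('a \<Rightarrow> bool) \<Rightarrow> ('a \<Rightarrow>\<^sub>0 'b::zero) \<Rightarrow> ('a \<Rightarrow>\<^sub>0 'b)" where
  "restrict_terms P p = Poly_Mapping.mapp (\<lambda>t c. c when P t) p"

lemma lookup_restrict_terms: "lookup (restrict_terms P p) t = (lookup p t when P t)"
  by (auto simp: restrict_terms_def lookup_mapp when_def in_keys_iff)

lemma keys_restrict_terms: "keys (restrict_terms P p) = {t \<in> keys p. P t}"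
  by (auto simp: in_keys_iff lookup_restrict_terms)

lemma sum_restrict_terms:
  fixes p :: "'a \<Rightarrow>\<^sub>0 'b::comm_monoid_add"
  assumes "finite E" "\<And>t. t \<in> keys p \<Longrightarrow> deg t \<in> E"
  shows "p = (\<Sum>e\<in>E. restrict_terms (\<lambda>t. deg t = e) p)"
proof (rule poly_mapping_eqI)
  fix t
  have "lookup (\<Sum>e\<in>E. restrict_terms (\<lambda>t. deg t = e) p) t = (\<Sum>e\<in>E. if e = deg t then lookup p t else 0)"
    by (auto simp: lookup_sum lookup_restrict_terms when_def intro!: sum.cong)
  also have "\<dots> = lookup p t"
    using assms by (auto simp: sum.delta in_keys_iff)
  finally show "lookup p t = lookup (\<Sum>e\<in>E. restrict_terms (\<lambda>t. deg t = e) p) t" by simp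
qed

lemma forms_zero [simp]: "0 \<in> forms i"
  by (simp add: forms_def)

lemma forms_add: "p \<in> forms i \<Longrightarrow> q \<in> forms i \<Longrightarrow> p + q \<in> forms i"
  using keys_add[of p q] by (auto simp: forms_def)

lemma forms_diff: "p \<in> forms i \<Longrightarrow> q \<in> forms i \<Longrightarrow> p - q \<in> forms i"
  using keys_diff[of p q] by (auto simp: forms_def)

lemma forms_sum: "(\<And>a. a \<in> A \<Longrightarrow> p a \<in> forms i) \<Longrightarrow> sum p A \<in> forms i"
  by (induction A rule: infinite_finite_induct) (auto intro: forms_add)

lemma forms_mult:
  fixes p q :: "('v::finite, 'k::field) mpoly"
  shows "p \<in> forms i \<Longrightarrow> q \<in> forms j \<Longrightarrow> p * q \<in> forms (i + j)"
  using keys_mult[of p q] by (fastforce simp: forms_def total_deg_add)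

lemma forms_single: "int (total_deg t) = i \<Longrightarrow> single t c \<in> forms i"
  by (auto simp: forms_def)

lemma forms_const: "const_poly c \<in> forms 0"
  by (simp add: const_poly_def forms_single)

lemma forms_var: "var_poly v \<in> forms 1"
  by (simp add: var_poly_eq forms_single)

lemma forms_negative: "i < 0 \<Longrightarrow> p \<in> forms i \<Longrightarrow> p = 0"
  by (auto simp: forms_def simp flip: keys_eq_empty)

lemma forms_0_eq_const: "p \<in> forms 0 \<Longrightarrow> p = const_poly (lookup p 0)"
  by (rule poly_mapping_eqI)
     (auto simp: forms_def const_poly_def lookup_single when_def total_deg_eq_0_iff in_keys_iff)

lemma forms_no_constant: "p \<in> forms i \<Longrightarrow> i \<noteq> 0 \<Longrightarrow> lookup p 0 = 0"
  unfolding forms_def using in_keys_iff[of 0 p] by fastforce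

lemma no_constant_mult:
  fixes p q :: "('v::finite, 'k::field) mpoly"
  assumes "lookup q 0 = 0"
  shows "lookup (p * q) 0 = 0"
proof -
  have "0 \<notin> keys (p * q)"
  proof
    assume "0 \<in> keys (p * q)"
    then obtain a b where ab: "0 = a + b" "b \<in> keys q"
      using keys_mult[of p q] by auto
    then have "total_deg (a + b) = 0" by (metis total_deg_0)
    then have "b = 0" by (simp add: total_deg_add total_deg_eq_0_iff)
    with ab(2) assms show False by (simp add: in_keys_iff)
  qed
  then show ?thesis by (simp add: in_keys_iff)
qed

lemma linear_form_eq:
  assumes "q \<in> forms 1"
  shows "q = (\<Sum>v\<in>UNIV. const_poly (lookup q (single v 1)) * var_poly (v::'v::finite))"
proof (rule poly_mapping_eqI)
  fix t
  have eq: "lookup (\<Sum>v\<in>UNIV. const_poly (lookup q (single v 1)) * var_poly v) t =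
      (\<Sum>v\<in>UNIV. lookup q (single v 1) * (1 when single v 1 = t))"
    by (simp add: lookup_sum lookup_const_times var_poly_eq lookup_single)
  show "lookup q t = lookup (\<Sum>v\<in>UNIV. const_poly (lookup q (single v 1)) * var_poly v) t"
  proof (cases "\<exists>v. t = single v 1")
    case True
    then obtain v where v: "t = single v 1" by auto
    have "single w (1::nat) = single v 1 \<longleftrightarrow> w = v" for w :: 'v
      by (metis lookup_single_eq lookup_single_not_eq zero_neq_one)
    then have "(\<Sum>w\<in>UNIV. lookup q (single w 1) * (1 when single w 1 = t)) =
        (\<Sum>w\<in>UNIV. if w = v then lookup q t else 0)"
      unfolding v by (intro sum.cong) (auto simp: when_def)
    also have "\<dots> = lookup q t" by (simp add: sum.delta)
    finally show ?thesis by (simp only: eq)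
  next
    case False
    then have "lookup q t = 0"
      using assms total_deg_1E[of t] by (auto simp: forms_def simp flip: not_in_keys_iff_lookup_eq_zero)
    moreover have "(\<Sum>v\<in>UNIV. lookup q (single v 1) * (1 when single v 1 = t)) = 0"
      using False by (intro sum.neutral) (auto simp: when_def)
    ultimately show ?thesis by (simp only: eq)
  qed
qed

section \<open>Linear combinations of a list\<close>

locale module_lists = module scale
  for scale :: "'a::comm_ring_1 \<Rightarrow> 'b::ab_group_add \<Rightarrow> 'b" (infixr \<open>*s\<close> 75)
begin

text \<open>
  Combinations are indexed by positions, not by elements: a list of generators may contain the same
  element twice, and syzygies are vectors of coefficients.
\<close>
definition comb :: "'b list \<Rightarrow> (nat \<Rightarrow> 'a) \<Rightarrow> 'b" where
  "comb hs v = (\<Sum>i<length hs. v i *s hs ! i)"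

lemma comb_cong: "(\<And>i. i < length hs \<Longrightarrow> u i = v i) \<Longrightarrow> comb hs u = comb hs v"
  by (simp add: comb_def)

lemma comb_Nil [simp]: "comb [] v = 0"
  by (simp add: comb_def)

lemma comb_snoc:
  fixes v :: "nat \<Rightarrow> 'a"
  shows "comb (hs @ [h]) v = comb hs v + v (length hs) *s h"
  by (simp add: comb_def nth_append)

lemma comb_add: "comb hs (\<lambda>i. u i + v i) = comb hs u + comb hs v"
  by (simp add: comb_def scale_left_distrib sum.distrib)

lemma comb_scale: "comb hs (\<lambda>i. s * v i) = s *s comb hs v"
  by (simp add: comb_def scale_sum_right)

lemma comb_diff: "comb hs (\<lambda>i. u i - v i) = comb hs u - comb hs v"
  by (simp add: comb_def scale_left_diff_distrib sum_subtractf)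

lemma comb_zero [simp]: "comb hs (\<lambda>i. 0) = 0"
  by (simp add: comb_def)

lemma comb_delta: "i < length hs \<Longrightarrow> comb hs (\<lambda>j. if j = i then s else 0) = s *s hs ! i"
  unfolding comb_def by (simp add: if_distrib[of "\<lambda>s. s *s _"] sum.delta cong: if_cong)

lemma comb_in_span: "comb hs v \<in> span (set hs)"
  unfolding comb_def by (intro span_sum span_scale span_base) auto

lemma span_list: "span (set hs) = range (comb hs)"
proof
  show "span (set hs) \<subseteq> range (comb hs)"
  proof
    fix x
    assume "x \<in> span (set hs)"
    then show "x \<in> range (comb hs)"
    proof (induction rule: span_induct_alt)
      case base
      show ?case by (rule image_eqI[of _ _ "\<lambda>_. 0"]) auto
    next
      case (step c x y)
      then obtain i v where i: "i < length hs" "x = hs ! i" and y: "y = comb hs v"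
        by (auto simp: in_set_conv_nth)
      have "c *s x + y = comb hs (\<lambda>j. (if j = i then c else 0) + v j)"
        using comb_delta[OF i(1)] by (simp add: comb_add i y)
      then show ?case by blast
    qed
  qed
qed (auto intro: comb_in_span)

lemma span_subset_iff: "span A \<subseteq> span B \<longleftrightarrow> A \<subseteq> span B"
  using span_minimal[OF _ subspace_span] span_superset by blast

lemma comb_image: "comb hs ` {v. \<forall>i\<ge>length hs. v i = 0} = span (set hs)"
proof -
  have "comb hs v \<in> comb hs ` {v. \<forall>i\<ge>length hs. v i = 0}" for v
    by (rule image_eqI[of _ _ "\<lambda>i. if i < length hs then v i else 0"]) (auto intro: comb_cong)
  then show ?thesis unfolding span_list by auto
qed

lemma span_imageE:
  assumes "x \<in> span (g ` B)" "finite B"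
  obtains r where "x = (\<Sum>b\<in>B. r b *s g b)"
proof -
  have "\<exists>r. x = (\<Sum>b\<in>B. r b *s g b)"
    using assms(1)
  proof (induction rule: span_induct_alt)
    case base
    show ?case by (rule exI[of _ "\<lambda>_. 0"]) simp
  next
    case (step c x y)
    then obtain b r where b: "b \<in> B" "x = g b" and y: "y = (\<Sum>b\<in>B. r b *s g b)" by blast
    have "(\<Sum>b'\<in>B. ((if b' = b then c else 0) + r b') *s g b') = c *s x + y"
      using assms(2) b
      by (simp add: scale_left_distrib sum.distrib y if_distrib[of "\<lambda>s. s *s _"] sum.delta cong: if_cong)
    then show ?case by metis
  qed
  with that show ?thesis by auto
qed

end

section \<open>Ring homomorphisms and ideals\<close>

lemma ring_hom_add: "is_ring_hom h \<Longrightarrow> h (a + b) = h a + h b"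
  and ring_hom_mult: "is_ring_hom h \<Longrightarrow> h (a * b) = h a * h b"
  and ring_hom_1: "is_ring_hom h \<Longrightarrow> h 1 = 1"
  by (auto simp: is_ring_hom_def)

lemma ring_hom_additive: "is_ring_hom h \<Longrightarrow> additive h"
  by (simp add: additive_def ring_hom_add)

lemmas ring_hom_0 = additive.zero[OF ring_hom_additive]
lemmas ring_hom_diff = additive.diff[OF ring_hom_additive]
lemmas ring_hom_sum = additive.sum[OF ring_hom_additive]

interpretation ideal: module_lists "(*) :: 'r::comm_ring_1 \<Rightarrow> 'r \<Rightarrow> 'r"
  by standard (simp_all add: algebra_simps)

(* for a ring acting on itself this simp rule is a * (b * x) = (a * b) * x, which undoes mult.assoc *)
declare ideal.scale_scale [simp del]

lemma ring_hom_vanishes_on_ideal: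
  assumes h: "is_ring_hom h" and "\<And>l. l \<in> L \<Longrightarrow> h l = 0" and "p \<in> ideal_generated L"
  shows "h p = 0"
proof -
  have "ideal_generated L \<subseteq> {p. h p = 0}"
    unfolding ideal_generated_def
    by (intro ideal.span_minimal ideal.subspaceI)
       (auto simp: assms(2) ring_hom_0[OF h] ring_hom_add[OF h] ring_hom_mult[OF h])
  then show ?thesis using assms(3) by auto
qed

section \<open>Substitution of polynomials for the variables\<close>

definition eval_monomial :: "('v::finite \<Rightarrow> 'r::comm_ring_1) \<Rightarrow> 'v monomial \<Rightarrow> 'r" where
  "eval_monomial g t = (\<Prod>v\<in>UNIV. g v ^ lookup t v)"

lemma eval_monomial_0 [simp]: "eval_monomial g 0 = 1"
  by (simp add: eval_monomial_def)

lemma eval_monomial_add: "eval_monomial g (s + t) = eval_monomial g s * eval_monomial g t"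
  by (simp add: eval_monomial_def lookup_add power_add prod.distrib)

lemma eval_monomial_single: "eval_monomial g (single v 1) = g v"
proof -
  have "eval_monomial g (single v 1) = (\<Prod>w\<in>UNIV. if w = v then g v else 1)"
    unfolding eval_monomial_def by (intro prod.cong) (auto simp: lookup_single when_def)
  then show ?thesis by (simp add: prod.delta)
qed

definition substitution ::
  "('v::finite \<Rightarrow> ('v, 'k::field) mpoly) \<Rightarrow> ('v, 'k) mpoly \<Rightarrow> ('v, 'k) mpoly" where
  "substitution g p = (\<Sum>t\<in>keys p. const_poly (lookup p t) * eval_monomial g t)"

lemma substitution_single: "substitution g (single t c) = const_poly c * eval_monomial g t"
  by (simp add: substitution_def)

lemma substitution_add: "substitution g (p + q) = substitution g p + substitution g q"
  unfolding substitution_def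
  by (rule Poly_Mapping.setsum_keys_plus_distrib) (auto simp: const_poly_add algebra_simps)

lemma substitution_mult: "substitution g (p * q) = substitution g p * substitution g q"
proof (induction p rule: sum_terms_induct)
  case zero
  show ?case by (simp add: substitution_def)
next
  case (single s a)
  show ?case
  proof (induction q rule: sum_terms_induct)
    case zero
    show ?case by (simp add: substitution_def)
  next
    case (single t b)
    show ?case
      unfolding mult_single substitution_single const_poly_mult eval_monomial_add
      by (simp only: mult.assoc mult.left_commute[of "eval_monomial g s"])
  qed (simp add: substitution_add algebra_simps)
qed (simp add: substitution_add algebra_simps)

lemma substitution_var: "substitution g (var_poly v) = g v"
  by (simp add: var_poly_eq substitution_single eval_monomial_single[simplified])

lemma substitution_const: "substitution g (const_poly c) = const_poly c"
  using substitution_single[of g 0 c] by (simp add: const_poly_def)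

lemma substitution_ring_hom: "is_ring_hom (substitution g)"
  using substitution_const[of g 1] by (simp add: is_ring_hom_def substitution_add substitution_mult)

section \<open>Monomial orders\<close>

text \<open>
  A sequence of natural numbers has a monotone or an antitone subsequence, and an antitone one is
  constant from the first place on where it attains its least value.
\<close>
lemma exists_monotone_subsequence:
  fixes X :: "nat \<Rightarrow> nat"
  shows "\<exists>r :: nat \<Rightarrow> nat. strict_mono r \<and> mono (X \<circ> r)"
proof -
  obtain r where r: "strict_mono r" and mon: "monoseq (\<lambda>n. X (r n))"
    using seq_monosub[of X] by auto
  show ?thesis
  proof (cases "incseq (\<lambda>n. X (r n))")
    case True
    with r show ?thesis unfolding o_def by blast
  next
    case False
    then have dec: "decseq (\<lambda>n. X (r n))"
      using mon by (auto simp: monoseq_iff)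
    define m where "m = (LEAST a. \<exists>n. X (r n) = a)"
    have "\<exists>n. X (r n) = m"
      unfolding m_def by (rule LeastI_ex) auto
    then obtain n where n: "X (r n) = m" by auto
    have "m \<le> X (r k)" for k
      unfolding m_def by (rule Least_le) auto
    moreover have "X (r k) \<le> m" if "n \<le> k" for k
      using decseqD[OF dec that] n by simp
    ultimately have eq: "X (r k) = m" if "n \<le> k" for k
      using that by (simp add: order_antisym)
    have "strict_mono (\<lambda>k. r (n + k))"
      using r by (simp add: strict_mono_def)
    moreover have "mono (X \<circ> (\<lambda>k. r (n + k)))"
      by (simp add: mono_def eq)
    ultimately show ?thesis by blast
  qed
qed

text \<open>
  Passing to a monotone subsequence for one variable after the other makes all exponents monotone.
\<close>
lemma Dickson:
  fixes s :: "nat \<Rightarrow> 'v::finite monomial"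
  shows "\<exists>i j. i < j \<and> (\<forall>v. lookup (s i) v \<le> lookup (s j) v)"
proof -
  have "\<exists>r :: nat \<Rightarrow> nat. strict_mono r \<and> (\<forall>v\<in>A. mono (\<lambda>n. lookup (s (r n)) v))" if "finite A" for A :: "'v set"
    using that
  proof induction
    case empty
    have "strict_mono (id :: nat \<Rightarrow> nat)" by (simp add: strict_mono_def)
    then show ?case by blast
  next
    case (insert v A)
    then obtain r :: "nat \<Rightarrow> nat" where r: "strict_mono r" "\<And>w. w \<in> A \<Longrightarrow> mono (\<lambda>n. lookup (s (r n)) w)"
      by auto
    obtain r' :: "nat \<Rightarrow> nat" where r': "strict_mono r'" "mono ((\<lambda>n. lookup (s (r n)) v) \<circ> r')"
      using exists_monotone_subsequence by blast
    have "strict_mono (r \<circ> r')"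
      using r(1) r'(1) by (rule strict_mono_o)
    moreover have "mono (\<lambda>n. lookup (s ((r \<circ> r') n)) w)" if "w \<in> insert v A" for w
      using that r(2)[of w] r'(2) strict_mono_mono[OF r'(1)] by (auto simp: mono_def)
    ultimately show ?case by blast
  qed
  from this[of UNIV] obtain r :: "nat \<Rightarrow> nat" where r: "strict_mono r" "\<And>v. mono (\<lambda>n. lookup (s (r n)) v)"
    by auto
  have "r 0 < r 1" "\<forall>v. lookup (s (r 0)) v \<le> lookup (s (r 1)) v"
    using r by (auto simp: strict_mono_def mono_def)
  then show ?thesis by blast
qed

lemma finite_strict_order_max:
  assumes "finite A" "A \<noteq> {}"
    and trans: "\<And>s t u. lt s t \<Longrightarrow> lt t u \<Longrightarrow> lt s u"
    and total: "\<And>s t. s \<noteq> t \<Longrightarrow> lt s t \<or> lt t s"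
  shows "\<exists>t\<in>A. \<forall>s\<in>A. s \<noteq> t \<longrightarrow> lt s t"
  using assms(1,2)
proof (induction rule: finite_ne_induct)
  case (insert a A)
  then obtain t where t: "t \<in> A" "\<forall>s\<in>A. s \<noteq> t \<longrightarrow> lt s t" by auto
  show ?case
  proof (cases "lt a t")
    case True
    with t show ?thesis by auto
  next
    case False
    have "a \<noteq> t" using t(1) insert.hyps by auto
    with False have "lt t a" using total[of a t] by auto
    moreover have "lt s a" if "s \<in> A" for s
      using that t(2) trans[OF _ \<open>lt t a\<close>] \<open>lt t a\<close> by (cases "s = t") auto
    ultimately show ?thesis by auto
  qed
qed auto

locale mon_order =
  fixes lt :: "'v::finite monomial \<Rightarrow> 'v monomial \<Rightarrow> bool"
  assumes order: "monomial_order lt"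
begin

lemma irrefl: "\<not> lt s s"
  and trans: "lt s t \<Longrightarrow> lt t u \<Longrightarrow> lt s u"
  and total: "s \<noteq> t \<Longrightarrow> lt s t \<or> lt t s"
  and zero_less: "t \<noteq> 0 \<Longrightarrow> lt 0 t"
  and add_right: "lt s t \<Longrightarrow> lt (s + u) (t + u)"
  using order unfolding monomial_order_def by blast+

lemma asym: "lt s t \<Longrightarrow> \<not> lt t s"
  using trans[of s t s] irrefl[of s] by blast

lemma add_left: "lt s t \<Longrightarrow> lt (u + s) (u + t)"
  using add_right[of s t u] by (simp add: add.commute)

text \<open>
  In an infinite descent some monomial would divide a later one, by Dickson's lemma, and hence
  be smaller than it.
\<close>
lemma wf: "wfp lt"
proof -
  have "\<not> (\<exists>s. \<forall>i. lt (s (Suc i)) (s i))"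
  proof
    assume "\<exists>s. \<forall>i. lt (s (Suc i)) (s i)"
    then obtain s where s: "\<And>i. lt (s (Suc i)) (s i)" by blast
    have desc: "lt (s j) (s i)" if "i < j" for i j
      using that by (induction rule: less_Suc_induct) (auto intro: s trans)
    obtain i j where ij: "i < j" "\<forall>v. lookup (s i) v \<le> lookup (s j) v"
      using Dickson by blast
    then have "s j = s i + (s j - s i)"
      by (intro poly_mapping_eqI) (simp add: lookup_add lookup_minus)
    then have "s j = s i \<or> lt (s i) (s j)"
      using zero_less[of "s j - s i"] add_left[of 0 "s j - s i" "s i"] by (metis add.right_neutral)
    with desc[OF ij(1)] irrefl trans show False by metis
  qed
  then show ?thesis
    by (simp add: wfp_def wf_iff_no_infinite_down_chain)
qed

lemma leading_monomial:
  assumes "p \<noteq> 0"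
  shows "leading_monomial lt p \<in> keys p"
    and "s \<in> keys p \<Longrightarrow> s \<noteq> leading_monomial lt p \<Longrightarrow> lt s (leading_monomial lt p)"
proof -
  have "\<exists>!t. t \<in> keys p \<and> (\<forall>s\<in>keys p. s \<noteq> t \<longrightarrow> lt s t)"
  proof -
    have "\<exists>t\<in>keys p. \<forall>s\<in>keys p. s \<noteq> t \<longrightarrow> lt s t"
    proof (rule finite_strict_order_max)
      show "lt s u" if "lt s t" "lt t u" for s t u using trans[OF that] .
      show "lt s t \<or> lt t s" if "s \<noteq> t" for s t using total[OF that] .
    qed (use assms in auto)
    then obtain t where t: "t \<in> keys p" "\<And>s. s \<in> keys p \<Longrightarrow> s \<noteq> t \<Longrightarrow> lt s t"
      by auto
    show ?thesis
    proof (rule ex1I[of _ t])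
      show "t \<in> keys p \<and> (\<forall>s\<in>keys p. s \<noteq> t \<longrightarrow> lt s t)" using t by simp
      show "t' = t" if "t' \<in> keys p \<and> (\<forall>s\<in>keys p. s \<noteq> t' \<longrightarrow> lt s t')" for t'
        using that t(1) t(2)[of t'] trans[of t t' t] irrefl[of t] by metis
    qed
  qed
  note * = theI'[OF this, folded leading_monomial_def]
  show "leading_monomial lt p \<in> keys p"
    by (rule conjunct1[OF *])
  show "lt s (leading_monomial lt p)" if "s \<in> keys p" "s \<noteq> leading_monomial lt p"
    by (rule conjunct2[OF *, rule_format, OF that])
qed

lemma leading_monomial_eqI:
  assumes "t \<in> keys p" "\<And>s. s \<in> keys p \<Longrightarrow> s \<noteq> t \<Longrightarrow> lt s t"
  shows "leading_monomial lt p = t"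
proof -
  have "p \<noteq> 0" using assms(1) by auto
  note * = leading_monomial[OF this]
  have "\<not> (lt t (leading_monomial lt p) \<and> lt (leading_monomial lt p) t)"
    using trans[of t _ t] irrefl by blast
  with *(1) *(2)[OF assms(1)] assms(2) show ?thesis by metis
qed

lemma leading_monomial_single_times:
  fixes p :: "('v, 'k::field) mpoly"
  assumes "c \<noteq> 0" "p \<noteq> 0"
  shows "leading_monomial lt (single u c * p) = u + leading_monomial lt p"
  using leading_monomial[OF assms(2)]
  by (intro leading_monomial_eqI) (auto simp: keys_single_times[OF assms(1)] intro!: add_left)

lemma leading_monomial_cancel:
  fixes p q :: "('v, 'k::field) mpoly"
  assumes "p \<noteq> 0" "q \<noteq> 0" "leading_monomial lt p = leading_monomial lt q"
    and "lookup p (leading_monomial lt p) = lookup q (leading_monomial lt q)" and "p - q \<noteq> 0"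
  shows "lt (leading_monomial lt (p - q)) (leading_monomial lt p)"
proof -
  let ?t = "leading_monomial lt (p - q)"
  have t: "?t \<in> keys (p - q)" using leading_monomial(1)[OF assms(5)] .
  then have "?t \<noteq> leading_monomial lt p"
    using assms(3,4) by (auto simp: in_keys_iff lookup_minus)
  moreover have "?t \<in> keys p \<union> keys q"
    using subsetD[OF keys_diff[of p q] t] .
  ultimately show ?thesis
    using leading_monomial(2)[OF assms(1), of ?t] leading_monomial(2)[OF assms(2), of ?t] assms(3)
    by (metis Un_iff)
qed

text \<open>
  Any other product of a term of \<open>p\<close> with a term of \<open>q\<close> is smaller, so nothing cancels.
\<close>
lemma lookup_mult_leading:
  fixes p q :: "('v, 'k::field) mpoly"
  assumes "p \<noteq> 0" "q \<noteq> 0"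
  shows "lookup (p * q) (leading_monomial lt p + leading_monomial lt q) =
    lookup p (leading_monomial lt p) * lookup q (leading_monomial lt q)"
proof -
  let ?s = "leading_monomial lt p" and ?t = "leading_monomial lt q"
  define p' where "p' = p - single ?s (lookup p ?s)"
  have below: "lt a ?s" if "a \<in> keys p'" for a
  proof -
    have "a \<noteq> ?s" using that by (auto simp: p'_def in_keys_iff lookup_minus)
    then have "a \<in> keys p" using that by (auto simp: p'_def in_keys_iff lookup_minus lookup_single)
    with \<open>a \<noteq> ?s\<close> show ?thesis by (intro leading_monomial(2) assms)
  qed
  have "?s + ?t \<notin> keys (p' * q)"
  proof
    assume "?s + ?t \<in> keys (p' * q)"
    then obtain a b where ab: "?s + ?t = a + b" "a \<in> keys p'" "b \<in> keys q"
      using keys_mult[of p' q] by auto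
    have "lt (a + b) (?s + b)" by (intro add_right below ab)
    moreover have "b = ?t \<or> lt (?s + b) (?s + ?t)"
      using leading_monomial(2)[OF assms(2) ab(3)] add_left by blast
    ultimately show False using ab(1) irrefl trans by metis
  qed
  moreover have "p * q = single ?s (lookup p ?s) * q + p' * q"
    by (simp add: p'_def algebra_simps)
  ultimately show ?thesis
    by (simp add: lookup_add lookup_single_times in_keys_iff)
qed

lemma no_zero_divisors:
  fixes p q :: "('v, 'k::field) mpoly"
  assumes "p * q = 0"
  shows "p = 0 \<or> q = 0"
  using lookup_mult_leading[of p q] leading_monomial(1)[of p] leading_monomial(1)[of q] assms
  by (auto simp: in_keys_iff)

end

text \<open>
  The lexicographic order along an enumeration of the variables. It is only used for showing that the
  polynomial ring is a domain, where any monomial order will do.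
\<close>
lemma exists_monomial_order: "\<exists>lt :: 'v::finite monomial \<Rightarrow> 'v monomial \<Rightarrow> bool. monomial_order lt"
proof -
  obtain e :: "'v \<Rightarrow> nat" and n where "inj_on e UNIV"
    using finite_imp_inj_to_nat_seg[of "UNIV :: 'v set"] by auto
  then have e: "e v = e w \<longleftrightarrow> v = w" for v w by (auto simp: inj_def)
  define lt :: "'v monomial \<Rightarrow> 'v monomial \<Rightarrow> bool" where
    "lt s t \<longleftrightarrow> (\<exists>v. lookup s v < lookup t v \<and> (\<forall>w. e w < e v \<longrightarrow> lookup s w = lookup t w))" for s t
  have "monomial_order lt"
    unfolding monomial_order_def
  proof (intro conjI allI impI)
    fix s t u
    show "\<not> lt s s" by (simp add: lt_def)
    show "lt s u" if st: "lt s t" and tu: "lt t u"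
    proof -
      obtain v where v: "lookup s v < lookup t v" "\<And>w. e w < e v \<Longrightarrow> lookup s w = lookup t w"
        using st by (auto simp: lt_def)
      obtain v' where v': "lookup t v' < lookup u v'" "\<And>w. e w < e v' \<Longrightarrow> lookup t w = lookup u w"
        using tu by (auto simp: lt_def)
      consider "e v < e v'" | "e v' < e v" | "v = v'" using e by (metis linorder_neqE_nat)
      then show ?thesis
      proof cases
        case 1
        then show ?thesis unfolding lt_def using v v' by (intro exI[of _ v]) auto
      next
        case 2
        then show ?thesis unfolding lt_def using v v' by (intro exI[of _ v']) auto
      next
        case 3
        then show ?thesis unfolding lt_def using v v' by (intro exI[of _ v]) auto
      qed
    qed
    have least: "lt s t \<or> lt t s" if "s \<noteq> t" for s t
    proof -
      obtain v where v: "lookup s v \<noteq> lookup t v"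
        using \<open>s \<noteq> t\<close> by (meson poly_mapping_eqI)
      define m where "m = (LEAST m. \<exists>v. lookup s v \<noteq> lookup t v \<and> e v = m)"
      have "\<exists>v. lookup s v \<noteq> lookup t v \<and> e v = m"
        unfolding m_def by (rule LeastI_ex) (use v in auto)
      then obtain v where v: "lookup s v \<noteq> lookup t v" "e v = m" by auto
      have "lookup s w = lookup t w" if "e w < e v" for w
        using that not_less_Least[of "e w" "\<lambda>m. \<exists>v. lookup s v \<noteq> lookup t v \<and> e v = m"]
        by (auto simp: v(2) m_def)
      then show ?thesis using v(1) unfolding lt_def by (metis linorder_neqE_nat)
    qed
    then show "lt s t \<or> lt t s" if "s \<noteq> t" using that .
    show "lt 0 t" if "t \<noteq> 0" using least[OF that] by (auto simp: lt_def)
    show "lt (s + u) (t + u)" if "lt s t" using that by (auto simp: lt_def lookup_add)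
  qed
  then show ?thesis by blast
qed

lemma polynomial_no_zero_divisors:
  fixes p q :: "('v::finite, 'k::field) mpoly"
  assumes "p * q = 0"
  shows "p = 0 \<or> q = 0"
proof -
  obtain lt :: "'v monomial \<Rightarrow> 'v monomial \<Rightarrow> bool" where "monomial_order lt"
    using exists_monomial_order by blast
  then interpret mon_order lt by unfold_locales
  show ?thesis using no_zero_divisors[OF assms] .
qed

section \<open>Ideals generated by linear forms\<close>

lemma ideal_mono: "L \<subseteq> L' \<Longrightarrow> ideal_generated L \<subseteq> ideal_generated L'"
  unfolding ideal_generated_def by (rule ideal.span_mono)

lemma ideal_base: "l \<in> L \<Longrightarrow> l \<in> ideal_generated L"
  unfolding ideal_generated_def by (rule ideal.span_base)

lemma ideal_mult: "p \<in> ideal_generated L \<Longrightarrow> q * p \<in> ideal_generated L"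
  unfolding ideal_generated_def by (rule ideal.span_scale)

lemma ideal_add: "p \<in> ideal_generated L \<Longrightarrow> q \<in> ideal_generated L \<Longrightarrow> p + q \<in> ideal_generated L"
  unfolding ideal_generated_def by (rule ideal.span_add)

lemma ideal_diff: "p \<in> ideal_generated L \<Longrightarrow> q \<in> ideal_generated L \<Longrightarrow> p - q \<in> ideal_generated L"
  unfolding ideal_generated_def by (rule ideal.span_diff)

lemma ideal_zero: "0 \<in> ideal_generated L"
  unfolding ideal_generated_def by (rule ideal.span_zero)

text \<open>
  Each form is required to lie outside the ideal, not just outside the linear span, of the preceding
  ones. This is the same as linear independence over \<open>K\<close>, but it is the property that colon ideals of
  such forms refer to.
\<close>
definition independent_linear_forms :: "('v, 'k::field) mpoly list \<Rightarrow> bool" where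
  "independent_linear_forms ls \<longleftrightarrow>
     set ls \<subseteq> forms 1 \<and> (\<forall>a<length ls. ls ! a \<notin> ideal_generated (set (take a ls)))"

lemma independent_snoc:
  "independent_linear_forms (ls @ [l]) \<longleftrightarrow>
     independent_linear_forms ls \<and> l \<in> forms 1 \<and> l \<notin> ideal_generated (set ls)"
  by (auto simp: independent_linear_forms_def nth_append less_Suc_eq)

lemma independent_take:
  "independent_linear_forms ls \<Longrightarrow> independent_linear_forms (take n ls)"
  by (auto simp: independent_linear_forms_def min_def dest: in_set_takeD)

text \<open>
  Each form is used to eliminate one variable that still occurs in its image under the previous
  eliminations; \<open>P\<close> collects these variables. The resulting endomorphism has the ideal as its kernel, and
  there cannot be more forms than variables.
\<close>
lemma eliminate_linear_forms:
  fixes ls :: "('v::finite, 'k::field) mpoly list"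
  assumes "independent_linear_forms ls"
  shows "\<exists>\<sigma> P. is_ring_hom \<sigma> \<and> (\<forall>p. p - \<sigma> p \<in> ideal_generated (set ls)) \<and> (\<forall>l\<in>set ls. \<sigma> l = 0) \<and>
    card P = length ls \<and> (\<forall>p\<in>forms 1. \<sigma> p \<in> forms 1 \<and> (\<forall>v\<in>P. lookup (\<sigma> p) (single v 1) = 0))"
  using assms
proof (induction ls rule: rev_induct)
  case Nil
  show ?case
    by (intro exI[of _ id] exI[of _ "{}"]) (simp add: is_ring_hom_def ideal_zero)
next
  case (snoc l ls)
  then obtain \<sigma> P where \<sigma>: "is_ring_hom \<sigma>" and diff: "\<And>p. p - \<sigma> p \<in> ideal_generated (set ls)"
    and van: "\<And>k. k \<in> set ls \<Longrightarrow> \<sigma> k = 0" and card: "card P = length ls"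
    and lin: "\<And>p. p \<in> forms 1 \<Longrightarrow> \<sigma> p \<in> forms 1"
    and free: "\<And>p v. p \<in> forms 1 \<Longrightarrow> v \<in> P \<Longrightarrow> lookup (\<sigma> p) (single v 1) = 0"
    by (auto simp: independent_snoc)
  have l: "l \<in> forms 1" "l \<notin> ideal_generated (set ls)" using snoc.prems by (auto simp: independent_snoc)
  define m where "m = \<sigma> l"
  have m: "m \<in> forms 1" "\<And>v. v \<in> P \<Longrightarrow> lookup m (single v 1) = 0"
    unfolding m_def using lin free l(1) by auto
  have "m \<noteq> 0" using diff[of l] l(2) by (auto simp: m_def)
  then obtain t where t: "t \<in> keys m" by (metis all_not_in_conv keys_eq_empty)
  then obtain v where v: "t = single v 1"
    using m(1) total_deg_1E[of t] by (auto simp: forms_def)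
  define c where "c = lookup m (single v 1)"
  have c: "c \<noteq> 0" using t v by (simp add: c_def in_keys_iff)
  then have "v \<notin> P" using m(2) by (auto simp: c_def)
  (* v is replaced such that m, in which it has coefficient c, becomes 0 *)
  define g :: "'v \<Rightarrow> ('v, 'k) mpoly" where
    "g w = var_poly w - (if w = v then const_poly (1 / c) * m else 0)" for w
  define \<tau> where "\<tau> = substitution g"
  have \<tau>: "is_ring_hom \<tau>" by (simp add: \<tau>_def substitution_ring_hom)
  have \<tau>_lin: "\<tau> q = q - const_poly (lookup q (single v 1) / c) * m" if "q \<in> forms 1" for q
  proof -
    have "\<tau> q = (\<Sum>w\<in>UNIV. const_poly (lookup q (single w 1)) * g w)"
      by (subst linear_form_eq[OF that])
         (simp add: \<tau>_def ring_hom_sum[OF substitution_ring_hom] substitution_mult substitution_const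
           substitution_var)
    also have "\<dots> = q - (\<Sum>w\<in>UNIV. const_poly (lookup q (single w 1)) * (if w = v then const_poly (1 / c) * m else 0))"
      unfolding g_def right_diff_distrib sum_subtractf linear_form_eq[OF that, symmetric] ..
    also have "(\<Sum>w\<in>UNIV. const_poly (lookup q (single w 1)) * (if w = v then const_poly (1 / c) * m else 0)) =
        (\<Sum>w\<in>UNIV. if w = v then const_poly (lookup q (single v 1)) * (const_poly (1 / c) * m) else 0)"
      by (intro sum.cong) auto
    also have "\<dots> = const_poly (lookup q (single v 1) / c) * m"
      by (simp add: sum.delta mult.assoc[symmetric] const_poly_mult[symmetric])
    finally show ?thesis .
  qed
  have \<tau>_diff: "p - \<tau> p \<in> ideal_generated {m}" for p
  proof (induction p rule: polynomial_induct)
    case (const a)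
    show ?case by (simp add: \<tau>_def substitution_const ideal_zero)
  next
    case (var w)
    show ?case by (simp add: \<tau>_def substitution_var g_def ideal_zero ideal_mult ideal_base)
  next
    case (add p q)
    have "p + q - \<tau> (p + q) = (p - \<tau> p) + (q - \<tau> q)"
      by (simp add: ring_hom_add[OF \<tau>])
    then show ?case using ideal_add[OF add] by (simp only:)
  next
    case (mult p q)
    have "p * q - \<tau> (p * q) = q * (p - \<tau> p) + \<tau> p * (q - \<tau> q)"
      by (simp add: ring_hom_mult[OF \<tau>] algebra_simps)
    then show ?case using ideal_add[OF ideal_mult[OF mult(1)] ideal_mult[OF mult(2)]] by (simp only:)
  qed
  have \<tau>_m: "\<tau> m = 0"
    using \<tau>_lin[OF m(1), folded c_def] c by simp
  let ?I = "ideal_generated (set (ls @ [l]))"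
  have "ideal_generated {m} \<subseteq> ?I"
  proof -
    have "m = l - (l - \<sigma> l)" by (simp add: m_def)
    moreover have "l - \<sigma> l \<in> ?I" using diff ideal_mono[of "set ls" "set (ls @ [l])"] by auto
    ultimately have "m \<in> ?I" using ideal_diff[of l] ideal_base by (metis in_set_conv_decomp)
    then show ?thesis
      unfolding ideal_generated_def by (intro ideal.span_minimal) auto
  qed
  then have d: "p - (\<tau> \<circ> \<sigma>) p \<in> ?I" for p
    using ideal_add[of "p - \<sigma> p" "set (ls @ [l])" "\<sigma> p - \<tau> (\<sigma> p)"] diff[of p] \<tau>_diff[of "\<sigma> p"]
      ideal_mono[of "set ls" "set (ls @ [l])"] by auto
  have h: "is_ring_hom (\<tau> \<circ> \<sigma>)"
    using \<sigma> \<tau> by (simp add: is_ring_hom_def)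
  have vl: "(\<tau> \<circ> \<sigma>) k = 0" if "k \<in> set (ls @ [l])" for k
    using that van \<tau>_m ring_hom_0[OF \<tau>] by (auto simp: m_def)
  have cd: "card (insert v P) = length (ls @ [l])"
    using \<open>v \<notin> P\<close> card by (simp add: card_insert_if)
  have fr: "(\<tau> \<circ> \<sigma>) p \<in> forms 1 \<and> (\<forall>w\<in>insert v P. lookup ((\<tau> \<circ> \<sigma>) p) (single w 1) = 0)"
    if p: "p \<in> forms 1" for p
  proof -
    have eq: "(\<tau> \<circ> \<sigma>) p = \<sigma> p - const_poly (lookup (\<sigma> p) (single v 1) / c) * m"
      using \<tau>_lin[OF lin[OF p]] by simp
    have "const_poly (lookup (\<sigma> p) (single v 1) / c) * m \<in> forms 1"
      using forms_mult[OF forms_const m(1)] by simp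
    then have "(\<tau> \<circ> \<sigma>) p \<in> forms 1"
      unfolding eq using lin[OF p] by (intro forms_diff)
    moreover have "lookup ((\<tau> \<circ> \<sigma>) p) (single w 1) = 0" if "w \<in> insert v P" for w
      unfolding eq using that free[OF p] m(2) c
      by (auto simp: lookup_minus lookup_const_times c_def[simplified, symmetric])
    ultimately show ?thesis by auto
  qed
  show ?case using h d vl cd fr by blast
qed

text \<open>
  The quotient embeds into the polynomial ring itself, a domain.
\<close>
lemma ideal_of_linear_forms_prime:
  fixes ls :: "('v::finite, 'k::field) mpoly list"
  assumes "independent_linear_forms ls" and "p * q \<in> ideal_generated (set ls)"
  shows "p \<in> ideal_generated (set ls) \<or> q \<in> ideal_generated (set ls)"
proof -
  obtain \<sigma> where \<sigma>: "is_ring_hom \<sigma>" and diff: "\<And>p. p - \<sigma> p \<in> ideal_generated (set ls)"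
    and van: "\<And>l. l \<in> set ls \<Longrightarrow> \<sigma> l = 0"
    using eliminate_linear_forms[OF assms(1)] by blast
  have "\<sigma> (p * q) = 0"
    using ring_hom_vanishes_on_ideal[OF \<sigma> van assms(2)] .
  then have "\<sigma> p = 0 \<or> \<sigma> q = 0"
    using ring_hom_mult[OF \<sigma>] polynomial_no_zero_divisors by metis
  then show ?thesis using diff[of p] diff[of q] by auto
qed

lemma independent_length:
  assumes "independent_linear_forms (ls :: ('v::finite, 'k::field) mpoly list)"
  shows "length ls \<le> card (UNIV :: 'v set)"
proof -
  obtain P :: "'v set" where "card P = length ls"
    using eliminate_linear_forms[OF assms] by blast
  then show ?thesis by (metis card_mono finite subset_UNIV)
qed

text \<open>
  An independent extension of maximal length exists, as the number of variables bounds the length.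
\<close>
lemma extend_independent:
  fixes ls :: "('v::finite, 'k::field) mpoly list"
  assumes "independent_linear_forms ls" and L: "L \<subseteq> forms 1"
  shows "\<exists>ws. set ws \<subseteq> L \<and> independent_linear_forms (ls @ ws) \<and> L \<subseteq> ideal_generated (set (ls @ ws))"
proof -
  define Q where "Q n \<longleftrightarrow> (\<exists>ws. set ws \<subseteq> L \<and> independent_linear_forms (ls @ ws) \<and> length ws = n)" for n
  have "Q 0" using assms by (simp add: Q_def)
  moreover have "n \<le> card (UNIV :: 'v set)" if "Q n" for n
    using that independent_length[of "ls @ _"] by (fastforce simp: Q_def)
  ultimately have "Q (GREATEST n. Q n)" and max: "\<And>n. Q n \<Longrightarrow> n \<le> (GREATEST n. Q n)"
    using GreatestI_nat[of Q 0] Greatest_le_nat[of Q] by blast+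
  then obtain ws where ws: "set ws \<subseteq> L" "independent_linear_forms (ls @ ws)" "length ws = (GREATEST n. Q n)"
    unfolding Q_def by blast
  have "l \<in> ideal_generated (set (ls @ ws))" if "l \<in> L" for l
  proof (rule ccontr)
    assume "l \<notin> ideal_generated (set (ls @ ws))"
    then have "independent_linear_forms (ls @ ws @ [l])"
      using ws(2) that L independent_snoc[of "ls @ ws" l] by auto
    then have "Q (length (ws @ [l]))" using ws(1) that unfolding Q_def by (intro exI[of _ "ws @ [l]"]) auto
    then show False using max ws(3) by fastforce
  qed
  with ws show ?thesis by blast
qed

section \<open>Linear quotients\<close>

lemma sum_pointwise: "(\<Sum>a\<in>A. f a) i = (\<Sum>a\<in>A. f a i)"
  by (induction A rule: infinite_finite_induct) simp_all

lemma linear_quotients_Nil: "linear_quotients scale []"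
  by (simp add: linear_quotients_def)

lemma linear_quotients_append:
  "linear_quotients scale (xs @ ys) \<longleftrightarrow> linear_quotients scale xs \<and>
    (\<forall>a<length ys. generated_by_linear_forms (colon_ideal scale (set xs \<union> set (take a ys)) (ys ! a)))"
  (is "?l \<longleftrightarrow> ?r")
proof
  assume ?l
  show ?r
  proof (intro conjI allI impI)
    show "linear_quotients scale xs"
      unfolding linear_quotients_def
    proof (intro allI impI)
      fix j assume "j < length xs"
      with \<open>?l\<close>[unfolded linear_quotients_def, rule_format, of j]
      show "generated_by_linear_forms (colon_ideal scale (set (take j xs)) (xs ! j))"
        by (simp add: nth_append)
    qed
    fix a assume "a < length ys"
    with \<open>?l\<close>[unfolded linear_quotients_def, rule_format, of "length xs + a"]
    show "generated_by_linear_forms (colon_ideal scale (set xs \<union> set (take a ys)) (ys ! a))"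
      by (simp add: nth_append)
  qed
next
  assume r: ?r
  show ?l
    unfolding linear_quotients_def
  proof (intro allI impI)
    fix j assume j: "j < length (xs @ ys)"
    show "generated_by_linear_forms (colon_ideal scale (set (take j (xs @ ys))) ((xs @ ys) ! j))"
    proof (cases "j < length xs")
      case True
      then show ?thesis using r by (simp add: linear_quotients_def nth_append)
    next
      case False
      then show ?thesis using r[THEN conjunct2, rule_format, of "j - length xs"] j
        by (simp add: nth_append)
    qed
  qed
qed

lemma linear_quotients_snoc:
  "linear_quotients scale (xs @ [x]) \<longleftrightarrow>
    linear_quotients scale xs \<and> generated_by_linear_forms (colon_ideal scale (set xs) x)"
  by (simp add: linear_quotients_append)

lemma generated_by_linear_formsE:
  fixes I :: "('v::finite, 'k::field) mpoly set"
  assumes "generated_by_linear_forms I"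
  obtains ls where "independent_linear_forms ls" "I = ideal_generated (set ls)"
proof -
  obtain L where L: "L \<subseteq> forms 1" "I = ideal_generated L"
    using assms by (auto simp: generated_by_linear_forms_def)
  obtain ls where ls: "set ls \<subseteq> L" "independent_linear_forms ls" "L \<subseteq> ideal_generated (set ls)"
    using extend_independent[OF _ L(1), of "[]"] by (auto simp: independent_linear_forms_def)
  have "I = ideal_generated (set ls)"
    using ls(1,3) ideal_mono[OF ls(1)] unfolding L(2) ideal_generated_def
    by (metis ideal.span_minimal ideal.subspace_span subset_antisym)
  with ls(2) that show ?thesis by blast
qed

lemma independent_linear: "independent_linear_forms ls \<Longrightarrow> set ls \<subseteq> forms 1"
  by (simp add: independent_linear_forms_def)

text \<open>
  This is \<open>\<mm>N\<close>, where \<open>\<mm>\<close> is the ideal of all variables and \<open>N\<close> is the submodule generated by \<open>B\<close>.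
\<close>
definition irrelevant_multiple ::
  "(('v, 'k::field) mpoly \<Rightarrow> 'b::ab_group_add \<Rightarrow> 'b) \<Rightarrow> 'b set \<Rightarrow> 'b set" where
  "irrelevant_multiple scale B = module.span scale {scale (var_poly v) h | v h. h \<in> B}"

locale polynomial_module = module_lists scale
  for scale :: "('v::finite, 'k::field) mpoly \<Rightarrow> 'b::ab_group_add \<Rightarrow> 'b" (infixr \<open>*s\<close> 75)
begin

lemma colon_ideal_subspace: "ideal.subspace (colon_ideal scale B g)"
  by (rule ideal.subspaceI)
     (auto simp: colon_ideal_def span_zero scale_left_distrib intro: span_add span_scale simp flip: scale_scale)

lemma ideal_subset_colon:
  "(\<And>l. l \<in> L \<Longrightarrow> l *s g \<in> span B) \<Longrightarrow> ideal_generated L \<subseteq> colon_ideal scale B g"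
  unfolding ideal_generated_def
  by (intro ideal.span_minimal colon_ideal_subspace) (auto simp: colon_ideal_def)

abbreviation \<mm> :: "'b set \<Rightarrow> 'b set" where
  "\<mm> B \<equiv> irrelevant_multiple scale B"

lemma \<mm>_subspace: "subspace (\<mm> B)"
  by (simp add: irrelevant_multiple_def)

lemma \<mm>_subset_span: "\<mm> B \<subseteq> span B"
  unfolding irrelevant_multiple_def
  by (intro span_minimal) (auto intro: span_scale span_base)

lemma var_scale_in_\<mm>:
  assumes "x \<in> span B"
  shows "var_poly v *s x \<in> \<mm> B"
proof -
  have "span B \<subseteq> {x. var_poly v *s x \<in> \<mm> B}"
  proof (rule span_minimal)
    show "B \<subseteq> {x. var_poly v *s x \<in> \<mm> B}"
      unfolding irrelevant_multiple_def by (auto intro!: span_base)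
    show "subspace {x. var_poly v *s x \<in> \<mm> B}"
      using \<mm>_subspace[of B]
      by (auto simp: subspace_def scale_right_distrib scale_left_commute[of "var_poly v"] simp del: scale_scale)
  qed
  with assms show ?thesis by auto
qed

lemma scale_in_\<mm>:
  assumes "lookup s 0 = 0" "x \<in> span B"
  shows "s *s x \<in> \<mm> B"
proof -
  have "single t (lookup s t) *s x \<in> \<mm> B" if "t \<in> keys s" for t
  proof -
    have "t \<noteq> 0" using that assms(1) by (auto simp: in_keys_iff)
    then obtain v where v: "lookup t v \<noteq> 0"
      using poly_mapping_eqI[of t 0] by auto
    have "single t (lookup s t) = var_poly v * single (t - single v 1) (lookup s t)"
      by (subst split_off_variable[OF v]) (simp add: var_poly_eq mult_single)
    then have "single t (lookup s t) *s x = var_poly v *s (single (t - single v 1) (lookup s t) *s x)"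
      by simp
    then show ?thesis using var_scale_in_\<mm>[OF span_scale[OF assms(2)]] by (simp only:)
  qed
  then have "(\<Sum>t\<in>keys s. single t (lookup s t) *s x) \<in> \<mm> B"
    by (intro subspace_sum[OF \<mm>_subspace])
  then show ?thesis by (simp only: scale_sum_left[symmetric] sum_of_terms[symmetric])
qed

lemma \<mm>_mono: "A \<subseteq> span B \<Longrightarrow> \<mm> A \<subseteq> \<mm> B"
  unfolding irrelevant_multiple_def[of _ A]
  by (intro span_minimal \<mm>_subspace) (auto intro: var_scale_in_\<mm>)

lemma \<mm>_cong: "span A = span B \<Longrightarrow> \<mm> A = \<mm> B"
  by (metis \<mm>_mono span_superset subset_antisym)

lemma \<mm>_combE:
  assumes "x \<in> \<mm> (set hs)"
  obtains v where "x = comb hs v" "\<And>i. lookup (v i) 0 = 0"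
proof -
  have "\<exists>v. x = comb hs v \<and> (\<forall>i. lookup (v i) 0 = 0)"
    using assms unfolding irrelevant_multiple_def
  proof (induction rule: span_induct_alt)
    case base
    show ?case by (intro exI[of _ "\<lambda>_. 0"]) auto
  next
    case (step c x y)
    then obtain i w v where i: "i < length hs" "x = var_poly w *s hs ! i"
      and y: "y = comb hs v" "\<And>i. lookup (v i) 0 = 0"
      by (auto simp: in_set_conv_nth)
    have "lookup (var_poly w) 0 = 0" by (rule forms_no_constant[OF forms_var]) simp
    then have "lookup (c * var_poly w) 0 = 0" by (rule no_constant_mult)
    then show ?case
      using comb_delta[OF i(1), of "c * var_poly w"]
      by (intro exI[of _ "\<lambda>j. (if j = i then c * var_poly w else 0) + v j"])
         (auto simp: comb_add i y lookup_add)
  qed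
  then obtain v where "x = comb hs v" "\<And>i. lookup (v i) 0 = 0" by auto
  then show ?thesis by (rule that)
qed

end

interpretation free: polynomial_module "free_scale :: ('v::finite, 'k::field) mpoly \<Rightarrow> (nat \<Rightarrow> ('v, 'k) mpoly) \<Rightarrow> _"
proof
  fix a b :: "('v, 'k) mpoly" and x y :: "nat \<Rightarrow> ('v, 'k) mpoly"
  show "free_scale a (x + y) = free_scale a x + free_scale a y"
    by (rule ext) (simp only: free_scale_def plus_fun_apply distrib_left)
  show "free_scale (a + b) x = free_scale a x + free_scale b x"
    by (rule ext) (simp only: free_scale_def plus_fun_apply distrib_right)
  show "free_scale a (free_scale b x) = free_scale (a * b) x"
    by (rule ext) (simp only: free_scale_def mult.assoc)
  show "free_scale 1 x = x"
    by (rule ext) (simp only: free_scale_def mult_1_left)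
qed

section \<open>Graded modules\<close>

lemma family_sum_zero: "(\<And>i. 0 \<in> M i) \<Longrightarrow> 0 \<in> family_sum M"
  unfolding family_sum_def by (intro CollectI exI[of _ 0]) simp

lemma family_sum_add:
  assumes "\<And>i a b. a \<in> M i \<Longrightarrow> b \<in> M i \<Longrightarrow> a + b \<in> M i" and "x \<in> family_sum M" "y \<in> family_sum M"
  shows "x + y \<in> family_sum M"
proof -
  obtain c where c: "x = (\<Sum>i\<in>keys c. lookup c i)" "\<And>i. lookup c i \<in> M i"
    using assms(2) by (auto simp: family_sum_def)
  obtain c' where c': "y = (\<Sum>i\<in>keys c'. lookup c' i)" "\<And>i. lookup c' i \<in> M i"
    using assms(3) by (auto simp: family_sum_def)
  have "(\<Sum>i\<in>keys (c + c'). lookup (c + c') i) = x + y"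
    unfolding c c' by (rule Poly_Mapping.setsum_keys_plus_distrib) auto
  moreover have "lookup (c + c') i \<in> M i" for i
    using assms(1) c(2) c'(2) by (simp add: lookup_add)
  ultimately show ?thesis
    unfolding family_sum_def by (intro CollectI exI[of _ "c + c'"]) simp
qed

lemma family_sum_component: "(\<And>i. 0 \<in> M i) \<Longrightarrow> x \<in> M e \<Longrightarrow> x \<in> family_sum M"
  unfolding family_sum_def by (intro CollectI exI[of _ "single e x"]) (auto simp: lookup_single when_def)

text \<open>
  The components need not span the ambient group: one component \<open>A\<^sub>k\<close> of a bigraded algebra
  is a graded module inside the whole algebra.
\<close>
locale graded_module = polynomial_module scale
  for scale :: "('v::finite, 'k::field) mpoly \<Rightarrow> 'b::ab_group_add \<Rightarrow> 'b" (infixr \<open>*s\<close> 75) +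
  fixes M :: "int \<Rightarrow> 'b set"
  assumes zero_comp: "0 \<in> M e"
    and add_comp: "x \<in> M e \<Longrightarrow> y \<in> M e \<Longrightarrow> x + y \<in> M e"
    and scale_comp: "s \<in> forms i \<Longrightarrow> x \<in> M e \<Longrightarrow> s *s x \<in> M (i + e)"
    and independent_comps:
      "finite E \<Longrightarrow> (\<And>e. e \<in> E \<Longrightarrow> u e \<in> M e) \<Longrightarrow> (\<Sum>e\<in>E. u e) = 0 \<Longrightarrow> e \<in> E \<Longrightarrow> u e = 0"
begin

lemma diff_comp: "x \<in> M e \<Longrightarrow> y \<in> M e \<Longrightarrow> x - y \<in> M e"
  using add_comp[of x e "- y"] scale_comp[OF forms_const, of y e "- 1"]
  by (simp add: const_poly_def single_uminus)

lemma sum_comp: "(\<And>a. a \<in> A \<Longrightarrow> x a \<in> M e) \<Longrightarrow> sum x A \<in> M e"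
  by (induction A rule: infinite_finite_induct) (auto intro: add_comp zero_comp)

lemma comb_comp:
  "(\<And>i. i < length hs \<Longrightarrow> v i \<in> forms (e - d i)) \<Longrightarrow> (\<And>i. i < length hs \<Longrightarrow> hs ! i \<in> M (d i)) \<Longrightarrow>
    comb hs v \<in> M e"
  unfolding comb_def
proof (intro sum_comp)
  fix i assume *: "\<And>i. i < length hs \<Longrightarrow> v i \<in> forms (e - d i)"
    "\<And>i. i < length hs \<Longrightarrow> hs ! i \<in> M (d i)" "i \<in> {..<length hs}"
  then show "v i *s hs ! i \<in> M e" using scale_comp[of "v i" "e - d i" "hs ! i" "d i"] by simp
qed

text \<open>
  Sorting all terms of the combination by their degree in the module, only those of degree \<open>e\<close> can
  contribute to an element of \<open>M e\<close>.
\<close>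
lemma homogeneous_coefficients:
  assumes d: "\<And>i. i < length hs \<Longrightarrow> hs ! i \<in> M (d i)" and x: "comb hs v \<in> M e"
  obtains u where "comb hs v = comb hs u" "\<And>i. u i \<in> forms (e - d i)"
proof -
  define deg where "deg i t = int (total_deg t) + d i" for i and t :: "'v monomial"
  define E where "E = insert e (\<Union>i<length hs. deg i ` keys (v i))"
  define y where "y e' = comb hs (\<lambda>i. restrict_terms (\<lambda>t. deg i t = e') (v i))" for e'
  have "finite E" by (simp add: E_def)
  have homog: "restrict_terms (\<lambda>t. deg i t = e') (v i) \<in> forms (e' - d i)" for i e'
    by (auto simp: forms_def keys_restrict_terms deg_def)
  have y: "y e' \<in> M e'" for e'
    unfolding y_def using homog d by (intro comb_comp)
  have "comb hs v = (\<Sum>i<length hs. (\<Sum>e'\<in>E. restrict_terms (\<lambda>t. deg i t = e') (v i)) *s hs ! i)"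
    unfolding comb_def
  proof (intro sum.cong refl)
    fix i assume "i \<in> {..<length hs}"
    then have "v i = (\<Sum>e'\<in>E. restrict_terms (\<lambda>t. deg i t = e') (v i))"
      by (intro sum_restrict_terms \<open>finite E\<close>) (auto simp: E_def)
    then show "v i *s hs ! i = (\<Sum>e'\<in>E. restrict_terms (\<lambda>t. deg i t = e') (v i)) *s hs ! i" by simp
  qed
  also have "\<dots> = (\<Sum>e'\<in>E. y e')"
    unfolding y_def comb_def scale_sum_left by (rule sum.swap)
  finally have sum: "comb hs v = (\<Sum>e'\<in>E. y e')" .
  (* the components of the combination minus those of its value: a family with sum 0 *)
  define z where "z e' = y e' - (if e' = e then comb hs v else 0)" for e'
  have "z e = 0"
  proof (rule independent_comps[of E])
    show "z e' \<in> M e'" for e' unfolding z_def using y x zero_comp by (auto intro: diff_comp)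
    show "(\<Sum>e'\<in>E. z e') = 0"
      unfolding z_def sum_subtractf sum[symmetric] using \<open>finite E\<close> by (simp add: E_def)
  qed (use \<open>finite E\<close> in \<open>auto simp: E_def\<close>)
  then have "comb hs v = comb hs (\<lambda>i. restrict_terms (\<lambda>t. deg i t = e) (v i))"
    by (simp add: z_def y_def)
  then show ?thesis using that homog by blast
qed

lemma span_homogeneousE:
  assumes "\<And>i. i < length hs \<Longrightarrow> hs ! i \<in> M (d i)" and "x \<in> span (set hs)" "x \<in> M e"
  obtains u where "x = comb hs u" "\<And>i. u i \<in> forms (e - d i)"
  using assms homogeneous_coefficients[of hs d _ e] unfolding span_list by blast

lemma family_sum_scale:
  assumes "x \<in> family_sum M"
  shows "s *s x \<in> family_sum M"
proof -
  note add = family_sum_add[of M, OF add_comp]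
  have sum: "sum f A \<in> family_sum M" if "\<And>a. a \<in> A \<Longrightarrow> f a \<in> family_sum M" for f and A :: "'i set"
    using that by (induction A rule: infinite_finite_induct) (auto intro: add family_sum_zero zero_comp)
  have hom: "s *s x \<in> family_sum M" if "x \<in> M e" for x e s
  proof (induction s rule: sum_terms_induct)
    case (single t c)
    show ?case
      using scale_comp[OF forms_single[OF refl] that]
      by (rule family_sum_component[of M, OF zero_comp])
  qed (auto simp: scale_left_distrib intro: add family_sum_zero zero_comp)
  obtain c where c: "x = (\<Sum>i\<in>keys c. lookup c i)" "\<And>i. lookup c i \<in> M i"
    using assms by (auto simp: family_sum_def)
  show ?thesis unfolding c(1) scale_sum_right by (rule sum, rule hom, rule c(2))
qed

lemma family_sum_eq_span: "family_sum M = span (\<Union>e. M e)"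
proof
  show "family_sum M \<subseteq> span (\<Union>e. M e)"
  proof
    fix x assume "x \<in> family_sum M"
    then obtain c where c: "x = (\<Sum>i\<in>keys c. lookup c i)" "\<And>i. lookup c i \<in> M i"
      by (auto simp: family_sum_def)
    show "x \<in> span (\<Union>e. M e)"
      unfolding c(1) using c(2) by (intro span_sum span_base) blast
  qed
  show "span (\<Union>e. M e) \<subseteq> family_sum M"
  proof (rule span_minimal)
    show "(\<Union>e. M e) \<subseteq> family_sum M"
      using family_sum_component[of M, OF zero_comp] by auto
    show "subspace (family_sum M)"
      by (intro subspaceI family_sum_zero family_sum_scale family_sum_add zero_comp add_comp)
  qed
qed

section \<open>Linear quotients of syzygies and of \<open>\<mm>N\<close>\<close>

text \<open>
  A new generator \<open>h\<close> contributes one syzygy \<open>z a\<close> for each linear form \<open>l\<^sub>a\<close> in a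
  list of independent generators of its colon ideal: the relation that writes \<open>l\<^sub>a h\<close> by the earlier
  generators. Looking at the last coordinate, and using that ideals of linear forms are prime,
  the colon ideal of \<open>z a\<close> is seen to be \<open>(l\<^sub>1,\<dots>,l\<^bsub>a-1\<^esub>)\<close>. The statement includes that the entries are
  linear forms, so that the syzygies again have one common degree.
\<close>
lemma linear_syzygies:
  assumes "set hs \<subseteq> M d" "linear_quotients scale hs"
  shows "\<exists>zs. (\<forall>z\<in>set zs. (\<forall>i. z i \<in> forms 1) \<and> (\<forall>i\<ge>length hs. z i = 0)) \<and>
    linear_quotients free_scale zs \<and>
    free.span (set zs) = {v. (\<forall>i\<ge>length hs. v i = 0) \<and> comb hs v = 0}"
  using assms
proof (induction hs rule: rev_induct)
  case Nil
  have "{v :: nat \<Rightarrow> ('v, 'k) mpoly. \<forall>i. v i = 0} = {0}" by (auto simp: fun_eq_iff)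
  then show ?case by (intro exI[of _ "[]"]) (simp add: linear_quotients_Nil)
next
  case (snoc h hs)
  define n where "n = length hs"
  have "set hs \<subseteq> M d" "linear_quotients scale hs"
    using snoc.prems by (auto simp: linear_quotients_snoc)
  from snoc.IH[OF this, folded n_def] obtain zs
    where zs': "\<forall>z\<in>set zs. (\<forall>i. z i \<in> forms 1) \<and> (\<forall>i\<ge>n. z i = 0)"
      and lq: "linear_quotients free_scale zs"
      and ker: "free.span (set zs) = {v. (\<forall>i\<ge>n. v i = 0) \<and> comb hs v = 0}"
    by blast
  have zs: "z i \<in> forms 1" "i \<ge> n \<Longrightarrow> z i = 0" if "z \<in> set zs" for z i
    using zs' that by auto
  have hs: "\<And>i. i < length hs \<Longrightarrow> hs ! i \<in> M d" and h: "h \<in> M d"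
    using snoc.prems(1) nth_mem by fastforce+
  obtain ls where ls: "independent_linear_forms ls" "colon_ideal scale (set hs) h = ideal_generated (set ls)"
    using snoc.prems(2) by (auto simp: linear_quotients_snoc elim: generated_by_linear_formsE)
  have "\<exists>c. ls ! a *s h = comb hs c \<and> (\<forall>i. c i \<in> forms 1)" if "a < length ls" for a
  proof -
    have "ls ! a \<in> colon_ideal scale (set hs) h" "ls ! a \<in> forms 1"
      using ls that independent_linear[OF ls(1)] by (auto intro: ideal_base)
    then have "ls ! a *s h \<in> span (set hs)" "ls ! a *s h \<in> M (1 + d)"
      using scale_comp h by (auto simp: colon_ideal_def)
    from span_homogeneousE[OF hs this] show ?thesis by auto
  qed
  then obtain c where c: "\<And>a. a < length ls \<Longrightarrow> ls ! a *s h = comb hs (c a)"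
    "\<And>a i. a < length ls \<Longrightarrow> c a i \<in> forms 1"
    by metis
  define z where "z a = (\<lambda>i. if i < n then - c a i else if i = n then ls ! a else 0)" for a
  define ys where "ys = map z [0..<length ls]"
  have z_n: "z a n = ls ! a" for a by (simp add: z_def)
  have z_forms: "z a i \<in> forms 1" if "a < length ls" for a i
    using c(2)[OF that, of i] independent_linear[OF ls(1)] that forms_diff[of 0 1 "c a i"]
    by (auto simp: z_def)
  have z_beyond: "z a i = 0" if "i > n" for a i
    using that by (simp add: z_def)
  have z_comb: "comb (hs @ [h]) (z a) = 0" if "a < length ls" for a
  proof -
    have "comb hs (z a) = comb hs (\<lambda>i. 0 - c a i)"
      by (intro comb_cong) (simp add: z_def n_def)
    also have "\<dots> = - comb hs (c a)" unfolding comb_diff by simp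
    finally show ?thesis
      using c(1)[OF that] z_n[of a] by (simp add: comb_snoc n_def[symmetric])
  qed
  let ?ker = "{v. (\<forall>i\<ge>length (hs @ [h]). v i = 0) \<and> comb (hs @ [h]) v = 0}"
  have ker_subspace: "free.subspace ?ker"
    by (rule free.subspaceI) (auto simp: free_scale_def comb_add comb_scale zero_fun_def plus_fun_def)
  have zs_ker: "set zs \<subseteq> ?ker"
  proof
    fix y assume "y \<in> set zs"
    then have "y \<in> free.span (set zs)" by (rule free.span_base)
    then show "y \<in> ?ker" unfolding ker using n_def by (auto simp: comb_snoc)
  qed
  have ys_ker: "z a \<in> ?ker" if "a < length ls" for a
    using z_comb[OF that] z_beyond n_def by auto
  have mem_zs: "v \<in> free.span (set zs)" if "v \<in> ?ker" "v n = 0" for v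
    unfolding ker
  proof (intro CollectI conjI allI impI)
    show "v i = 0" if "n \<le> i" for i
      using that \<open>v \<in> ?ker\<close> \<open>v n = 0\<close> n_def by (cases "i = n") auto
    show "comb hs v = 0"
      using that by (simp add: comb_snoc n_def)
  qed
  have colon: "colon_ideal free_scale (set zs \<union> set (take a ys)) (ys ! a) = ideal_generated (set (take a ls))"
    if a: "a < length ys" for a
  proof
    have a': "a < length ls" using a by (simp add: ys_def)
    have ys_a: "ys ! a = z a" using a' by (simp add: ys_def)
    have take: "set (take a ys) = z ` {..<a}"
      using a' by (auto simp: ys_def take_map)
    have take_ls: "ls ! b \<in> set (take a ls)" if "b < a" for b
      using that a' by (auto simp: in_set_conv_nth)
    show "colon_ideal free_scale (set zs \<union> set (take a ys)) (ys ! a) \<subseteq> ideal_generated (set (take a ls))"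
    proof
      fix s assume "s \<in> colon_ideal free_scale (set zs \<union> set (take a ys)) (ys ! a)"
      then have mem: "free_scale s (z a) \<in> free.span (set zs \<union> z ` {..<a})"
        by (simp add: colon_ideal_def take ys_a)
      have "free.span (set zs \<union> z ` {..<a}) \<subseteq> {v. v n \<in> ideal_generated (set (take a ls))}"
      proof (rule free.span_minimal)
        show "set zs \<union> z ` {..<a} \<subseteq> {v. v n \<in> ideal_generated (set (take a ls))}"
        proof
          fix x assume "x \<in> set zs \<union> z ` {..<a}"
          then have "x n = 0 \<or> x n \<in> set (take a ls)"
            using zs(2)[of x n] take_ls by (auto simp: z_n)
          then show "x \<in> {v. v n \<in> ideal_generated (set (take a ls))}"
            using ideal_zero[of "set (take a ls)"] by (auto intro: ideal_base)
        qed
        show "free.subspace {v. v n \<in> ideal_generated (set (take a ls))}"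
          by (rule free.subspaceI) (auto simp: free_scale_def ideal_zero intro: ideal_add ideal_mult)
      qed
      with mem have "s * ls ! a \<in> ideal_generated (set (take a ls))"
        by (auto simp: free_scale_def z_n)
      then show "s \<in> ideal_generated (set (take a ls))"
        using ideal_of_linear_forms_prime[OF independent_take[OF ls(1)]] ls(1) a'
        unfolding independent_linear_forms_def by blast
    qed
    show "ideal_generated (set (take a ls)) \<subseteq> colon_ideal free_scale (set zs \<union> set (take a ys)) (ys ! a)"
    proof (rule free.ideal_subset_colon)
      fix l assume "l \<in> set (take a ls)"
      then obtain b where b: "b < a" "l = ls ! b"
        using a' by (auto simp: in_set_conv_nth)
      (* the Koszul relation between the two linear forms *)
      define w where "w = free_scale l (z a) - free_scale (ls ! a) (z b)"
      have "w \<in> ?ker"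
        unfolding w_def using ker_subspace a' b ys_ker
        by (intro free.subspace_diff free.subspace_scale) auto
      moreover have "w n = 0"
        by (simp add: w_def free_scale_def z_n b)
      ultimately have "w \<in> free.span (set zs)" by (rule mem_zs)
      then have "w \<in> free.span (set zs \<union> z ` {..<a})"
        using free.span_mono by blast
      moreover have "free_scale (ls ! a) (z b) \<in> free.span (set zs \<union> z ` {..<a})"
        using b by (intro free.span_scale free.span_base) auto
      ultimately have "w + free_scale (ls ! a) (z b) \<in> free.span (set zs \<union> z ` {..<a})"
        by (rule free.span_add)
      then show "free_scale l (ys ! a) \<in> free.span (set zs \<union> set (take a ys))"
        by (simp add: w_def take ys_a)
    qed
  qed
  have "linear_quotients free_scale (zs @ ys)"
    unfolding linear_quotients_append
  proof (intro conjI allI impI lq)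
    fix a assume "a < length ys"
    then show "generated_by_linear_forms (colon_ideal free_scale (set zs \<union> set (take a ys)) (ys ! a))"
      unfolding colon[OF \<open>a < length ys\<close>] generated_by_linear_forms_def
      using independent_linear[OF ls(1)] by (intro exI[of _ "set (take a ls)"]) (auto dest: in_set_takeD)
  qed
  moreover have "free.span (set (zs @ ys)) = ?ker"
  proof
    show "free.span (set (zs @ ys)) \<subseteq> ?ker"
      by (intro free.span_minimal ker_subspace) (use zs_ker ys_ker in \<open>auto simp: ys_def\<close>)
    show "?ker \<subseteq> free.span (set (zs @ ys))"
    proof
      fix v assume v: "v \<in> ?ker"
      then have "v n *s h = 0 - comb hs v"
        by (auto simp: comb_snoc n_def eq_neg_iff_add_eq_0 add.commute)
      then have "v n *s h \<in> span (set hs)"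
        using comb_in_span span_diff span_zero by metis
      then have "v n \<in> ideal_generated (set ls)"
        unfolding ls(2)[symmetric] by (simp add: colon_ideal_def)
      then obtain s where s: "v n = ideal.comb ls s"
        unfolding ideal_generated_def ideal.span_list by auto
      define w where "w = v - (\<Sum>a<length ls. free_scale (s a) (z a))"
      have sum: "(\<Sum>a<length ls. free_scale (s a) (z a)) \<in> free.span (set ys)"
        by (intro free.span_sum free.span_scale free.span_base) (auto simp: ys_def)
      have "(\<Sum>a<length ls. free_scale (s a) (z a)) n = v n"
        by (simp add: sum_pointwise free_scale_def z_n s ideal.comb_def)
      then have "w n = 0" by (simp add: w_def)
      moreover have "w \<in> ?ker"
        unfolding w_def using ys_ker
        by (intro free.subspace_diff[OF ker_subspace v] free.subspace_sum[OF ker_subspace]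
            free.subspace_scale[OF ker_subspace]) auto
      ultimately have "w \<in> free.span (set zs)" by (intro mem_zs)
      then have "w + (\<Sum>a<length ls. free_scale (s a) (z a)) \<in> free.span (set (zs @ ys))"
        using sum free.span_mono[of "set zs" "set (zs @ ys)"] free.span_mono[of "set ys" "set (zs @ ys)"]
        by (intro free.span_add) auto
      then show "v \<in> free.span (set (zs @ ys))" by (simp add: w_def)
    qed
  qed
  moreover have "y i \<in> forms 1" if "y \<in> set (zs @ ys)" for y i
    using that zs(1) z_forms by (auto simp: ys_def)
  moreover have "y i = 0" if "y \<in> set (zs @ ys)" "i \<ge> length (hs @ [h])" for y i
    using that zs(2)[of y i] z_beyond[of i] n_def by (auto simp: ys_def)
  ultimately show ?case by (intro exI[of _ "zs @ ys"]) blast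
qed

text \<open>
  A new generator \<open>h\<close> of \<open>N\<close>, with colon ideal \<open>I\<close>, contributes the generators \<open>w h\<close> of \<open>\<mm>N\<close>, where \<open>w\<close>
  runs through linear forms that complete those of \<open>I\<close> to the ideal of all variables. As \<open>I\<close> and the
  preceding \<open>w\<close> generate a prime ideal that does not contain the next \<open>w\<close>, this ideal is the new colon
  ideal.
\<close>
lemma linear_quotients_irrelevant_multiple:
  assumes "set hs \<subseteq> M d" "linear_quotients scale hs"
  shows "\<exists>hs'. set hs' \<subseteq> M (d + 1) \<and> linear_quotients scale hs' \<and> span (set hs') = \<mm> (set hs)"
  using assms
proof (induction hs rule: rev_induct)
  case Nil
  show ?case by (intro exI[of _ "[]"]) (simp add: linear_quotients_Nil irrelevant_multiple_def)
next
  case (snoc h hs)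
  then obtain hs' where hs': "set hs' \<subseteq> M (d + 1)" "linear_quotients scale hs'" "span (set hs') = \<mm> (set hs)"
    by (auto simp: linear_quotients_snoc)
  have hs: "\<And>i. i < length hs \<Longrightarrow> hs ! i \<in> M d" and h: "h \<in> M d"
    using snoc.prems(1) nth_mem by fastforce+
  obtain ls where ls: "independent_linear_forms ls" "colon_ideal scale (set hs) h = ideal_generated (set ls)"
    using snoc.prems(2) by (auto simp: linear_quotients_snoc elim: generated_by_linear_formsE)
  have "range var_poly \<subseteq> forms 1" using forms_var by auto
  from extend_independent[OF ls(1) this] obtain ws where ws: "independent_linear_forms (ls @ ws)"
    "range var_poly \<subseteq> ideal_generated (set (ls @ ws))" by blast
  have lin: "\<And>l. l \<in> set (ls @ ws) \<Longrightarrow> l \<in> forms 1" using independent_linear[OF ws(1)] by auto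
  define ys where "ys = map (\<lambda>w. w *s h) ws"
  (* homogeneity: the colon ideal of the new generator maps it into \<mm>N, not only into N *)
  have colon_h: "p *s h \<in> \<mm> (set hs)" if "p \<in> colon_ideal scale (set hs) h" for p
  proof -
    have "ideal_generated (set ls) \<subseteq> {p. p *s h \<in> \<mm> (set hs)}"
      unfolding ideal_generated_def
    proof (rule ideal.span_minimal)
      show "ideal.subspace {p. p *s h \<in> \<mm> (set hs)}"
        using \<mm>_subspace[of "set hs"]
        by (intro ideal.subspaceI)
           (auto simp: scale_left_distrib subspace_0 subspace_add subspace_scale simp flip: scale_scale)
      show "set ls \<subseteq> {p. p *s h \<in> \<mm> (set hs)}"
      proof
        fix l assume l: "l \<in> set ls"
        have "l *s h \<in> span (set hs)"
          using l ls(2) ideal_base[OF l] by (auto simp: colon_ideal_def)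
        moreover have "l *s h \<in> M (1 + d)" using l lin h by (intro scale_comp) auto
        ultimately obtain u where u: "l *s h = comb hs u" "\<And>i. u i \<in> forms (1 + d - d)"
          using span_homogeneousE[OF hs] by metis
        have "comb hs u \<in> \<mm> (set hs)"
          unfolding comb_def
          using u(2) forms_no_constant[of _ 1]
          by (intro subspace_sum[OF \<mm>_subspace] scale_in_\<mm>) (auto intro: span_base)
        then show "l \<in> {p. p *s h \<in> \<mm> (set hs)}" using u(1) by simp
      qed
    qed
    with that ls(2) show ?thesis by auto
  qed
  have colon: "colon_ideal scale (set hs' \<union> set (take a ys)) (ys ! a) = ideal_generated (set (ls @ take a ws))"
    if a: "a < length ys" for a
  proof
    have a': "a < length ws" using a by (simp add: ys_def)
    have ys_a: "ys ! a = ws ! a *s h" using a' by (simp add: ys_def)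
    have take: "set (take a ys) = (\<lambda>w. w *s h) ` set (take a ws)"
      by (auto simp: ys_def take_map)
    let ?I = "ideal_generated (set (ls @ take a ws))"
    have ind: "independent_linear_forms (ls @ take a ws)"
      using independent_take[OF ws(1), of "length ls + a"] by simp
    have notin: "ws ! a \<notin> ?I"
    proof -
      have "length ls + a < length (ls @ ws)" using a' by simp
      then have "(ls @ ws) ! (length ls + a) \<notin> ideal_generated (set (take (length ls + a) (ls @ ws)))"
        using ws(1) unfolding independent_linear_forms_def by blast
      then show ?thesis by simp
    qed
    show "colon_ideal scale (set hs' \<union> set (take a ys)) (ys ! a) \<subseteq> ?I"
    proof
      fix s assume "s \<in> colon_ideal scale (set hs' \<union> set (take a ys)) (ys ! a)"
      then have "(s * ws ! a) *s h \<in> span (set hs' \<union> (\<lambda>w. w *s h) ` set (take a ws))"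
        by (simp add: colon_ideal_def take ys_a)
      then obtain x y where xy: "(s * ws ! a) *s h = x + y" "x \<in> span (set hs')"
        "y \<in> span ((\<lambda>w. w *s h) ` set (take a ws))"
        unfolding span_Un by blast
      have "span ((\<lambda>w. w *s h) ` set (take a ws)) \<subseteq> {p *s h | p. p \<in> ideal_generated (set (take a ws))}"
      proof (rule span_minimal)
        show "subspace {p *s h |p. p \<in> ideal_generated (set (take a ws))}"
        proof (rule subspaceI)
          show "0 \<in> {p *s h |p. p \<in> ideal_generated (set (take a ws))}"
            using ideal_zero[of "set (take a ws)"] scale_zero_left[of h] by (metis (mono_tags, lifting) mem_Collect_eq)
          show "x + y \<in> {p *s h |p. p \<in> ideal_generated (set (take a ws))}"
            if "x \<in> {p *s h |p. p \<in> ideal_generated (set (take a ws))}"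
              "y \<in> {p *s h |p. p \<in> ideal_generated (set (take a ws))}" for x y
            using that ideal_add scale_left_distrib[symmetric] by blast
          show "c *s x \<in> {p *s h |p. p \<in> ideal_generated (set (take a ws))}"
            if "x \<in> {p *s h |p. p \<in> ideal_generated (set (take a ws))}" for c x
            using that ideal_mult scale_scale by blast
        qed
      qed (auto intro: ideal_base)
      then obtain p where p: "y = p *s h" "p \<in> ideal_generated (set (take a ws))"
        using xy(3) by blast
      have "(s * ws ! a - p) *s h = x"
        using xy(1) p(1) by (simp add: scale_left_diff_distrib)
      moreover have "x \<in> span (set hs)" using xy(2) hs'(3) \<mm>_subset_span by auto
      ultimately have "s * ws ! a - p \<in> ideal_generated (set ls)"
        unfolding ls(2)[symmetric] by (simp add: colon_ideal_def)
      then have "s * ws ! a - p + p \<in> ?I"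
        using p(2) ideal_mono[of "set ls" "set (ls @ take a ws)"] ideal_mono[of "set (take a ws)" "set (ls @ take a ws)"]
        by (intro ideal_add) auto
      then have "s * ws ! a \<in> ?I" by simp
      with notin show "s \<in> ?I" using ideal_of_linear_forms_prime[OF ind] by blast
    qed
    show "?I \<subseteq> colon_ideal scale (set hs' \<union> set (take a ys)) (ys ! a)"
    proof (rule ideal_subset_colon)
      fix l assume "l \<in> set (ls @ take a ws)"
      then consider "l \<in> set ls" | "l \<in> set (take a ws)" by auto
      then show "l *s ys ! a \<in> span (set hs' \<union> set (take a ys))"
      proof cases
        case 1
        then have "l *s h \<in> \<mm> (set hs)"
          using ls(2) ideal_base by (intro colon_h) auto
        then have "ws ! a *s (l *s h) \<in> span (set hs')"
          unfolding hs'(3)[symmetric] by (rule span_scale)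
        then have "ws ! a *s (l *s h) \<in> span (set hs' \<union> set (take a ys))"
          using span_mono by blast
        then show ?thesis by (simp add: ys_a mult.commute)
      next
        case 2
        then have "ws ! a *s (l *s h) \<in> span (set hs' \<union> set (take a ys))"
          by (intro span_scale span_base) (auto simp: take)
        then show ?thesis by (simp add: ys_a mult.commute)
      qed
    qed
  qed
  have "linear_quotients scale (hs' @ ys)"
    unfolding linear_quotients_append
  proof (intro conjI allI impI hs'(2))
    fix a assume "a < length ys"
    then show "generated_by_linear_forms (colon_ideal scale (set hs' \<union> set (take a ys)) (ys ! a))"
      unfolding colon[OF \<open>a < length ys\<close>] generated_by_linear_forms_def
      using lin by (intro exI[of _ "set (ls @ take a ws)"]) (auto dest: in_set_takeD)
  qed
  moreover have "set (hs' @ ys) \<subseteq> M (d + 1)"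
    using hs'(1) scale_comp[OF lin h] by (auto simp: ys_def add.commute)
  moreover have "span (set (hs' @ ys)) = \<mm> (set (hs @ [h]))"
  proof
    have sub: "\<mm> (set hs) \<subseteq> \<mm> (set (hs @ [h]))"
      by (rule \<mm>_mono) (auto intro: span_base)
    show "span (set (hs' @ ys)) \<subseteq> \<mm> (set (hs @ [h]))"
    proof (intro span_minimal \<mm>_subspace)
      have "set hs' \<subseteq> \<mm> (set (hs @ [h]))" using sub hs'(3) span_superset by blast
      moreover have "set ys \<subseteq> \<mm> (set (hs @ [h]))"
        using lin forms_no_constant[of _ 1] by (auto simp: ys_def intro!: scale_in_\<mm> span_base)
      ultimately show "set (hs' @ ys) \<subseteq> \<mm> (set (hs @ [h]))" by auto
    qed
    have h_in: "var_poly v *s h \<in> span (set (hs' @ ys))" for v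
    proof -
      have "ideal_generated (set (ls @ ws)) \<subseteq> colon_ideal scale (set (hs' @ ys)) h"
      proof (rule ideal_subset_colon)
        fix l assume "l \<in> set (ls @ ws)"
        then consider "l \<in> set ls" | "l \<in> set ws" by auto
        then show "l *s h \<in> span (set (hs' @ ys))"
        proof cases
          case 1
          then have "l *s h \<in> span (set hs')"
            using ls(2) ideal_base unfolding hs'(3) by (intro colon_h) auto
          then show ?thesis using span_mono[of "set hs'" "set (hs' @ ys)"] by auto
        next
          case 2
          then show ?thesis by (intro span_base) (simp add: ys_def)
        qed
      qed
      with ws(2) show ?thesis by (auto simp: colon_ideal_def)
    qed
    have old: "var_poly v *s g \<in> span (set (hs' @ ys))" if "g \<in> set hs" for v g
    proof -
      have "var_poly v *s g \<in> span (set hs')"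
        unfolding hs'(3) using that by (intro var_scale_in_\<mm> span_base)
      then show ?thesis using span_mono[of "set hs'" "set (hs' @ ys)"] by auto
    qed
    show "\<mm> (set (hs @ [h])) \<subseteq> span (set (hs' @ ys))"
      unfolding irrelevant_multiple_def
      by (intro span_minimal) (use h_in old in auto)
  qed
  ultimately show ?case by (intro exI[of _ "hs' @ ys"]) simp
qed

end

section \<open>Linear resolutions\<close>

lemma forms_independent:
  fixes u :: "int \<Rightarrow> ('v, 'k::field) mpoly"
  assumes "finite E" "\<And>e. e \<in> E \<Longrightarrow> u e \<in> forms (e - a)" "(\<Sum>e\<in>E. u e) = 0" "e \<in> E"
  shows "u e = 0"
proof (rule poly_mapping_eqI)
  fix t
  show "lookup (u e) t = lookup 0 t"
  proof (cases "int (total_deg t) = e - a")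
    case True
    have "lookup (u e') t = 0" if "e' \<in> E - {e}" for e'
    proof -
      have "t \<notin> keys (u e')" using assms(2)[of e'] that True by (auto simp: forms_def)
      then show ?thesis by (simp add: in_keys_iff)
    qed
    then have "(\<Sum>e'\<in>E - {e}. lookup (u e') t) = 0"
      by (intro sum.neutral) blast
    then have "lookup (\<Sum>e\<in>E. u e) t = lookup (u e) t"
      by (simp add: lookup_sum sum.remove[OF assms(1,4), of "\<lambda>e. lookup (u e) t"])
    with assms(3) show ?thesis by simp
  next
    case False
    then show ?thesis using assms(2)[OF assms(4)] by (auto simp: forms_def in_keys_iff)
  qed
qed

text \<open>
  Vectors are graded by the common degree of their entries. The syzygies obtained from
  \<open>linear_syzygies\<close> have degree one in this grading, whatever the number of generators.
\<close>
lemma graded_free_module: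
  "graded_module (free_scale :: ('v::finite, 'k::field) mpoly \<Rightarrow> _) (\<lambda>e. {v. \<forall>i. v i \<in> forms e})"
proof
  fix E :: "int set" and u :: "int \<Rightarrow> nat \<Rightarrow> ('v, 'k) mpoly" and e
  assume *: "finite E" "\<And>e. e \<in> E \<Longrightarrow> u e \<in> {v. \<forall>i. v i \<in> forms e}" "(\<Sum>e\<in>E. u e) = 0" "e \<in> E"
  show "u e = 0"
  proof
    fix i
    have "(\<Sum>e\<in>E. u e i) = 0" using *(3) by (metis sum_pointwise zero_fun_apply)
    then have "u e i = 0" using *(1,2,4) by (intro forms_independent[of E "\<lambda>e. u e i" 0]) auto
    then show "u e i = 0 i" by simp
  qed
qed (auto simp: free_scale_def intro: forms_add forms_mult)

lemma graded_shifted_free: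
  "graded_module (free_scale :: ('v::finite, 'k::field) mpoly \<Rightarrow> _) (shifted_free b a)"
proof
  fix E :: "int set" and u :: "int \<Rightarrow> nat \<Rightarrow> ('v, 'k) mpoly" and e
  assume *: "finite E" "\<And>e. e \<in> E \<Longrightarrow> u e \<in> shifted_free b a e" "(\<Sum>e\<in>E. u e) = 0" "e \<in> E"
  show "u e = 0"
  proof
    fix i
    have "(\<Sum>e\<in>E. u e i) = 0" using *(3) by (metis sum_pointwise zero_fun_apply)
    moreover have "u e i \<in> forms (e - a)" if "e \<in> E" for e
      using *(2)[OF that] by (cases "i < b") (auto simp: shifted_free_def)
    ultimately have "u e i = 0" using *(1,4) by (intro forms_independent[of E "\<lambda>e. u e i" a]) auto
    then show "u e i = 0 i" by simp
  qed
next
  fix s :: "('v, 'k) mpoly" and x :: "nat \<Rightarrow> ('v, 'k) mpoly" and i e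
  assume "s \<in> forms i" "x \<in> shifted_free b a e"
  then show "free_scale s x \<in> shifted_free b a (i + e)"
    using forms_mult[of s i "x _" "e - a"] by (auto simp: shifted_free_def free_scale_def add_diff_eq)
qed (auto simp: shifted_free_def intro: forms_add)

lemma family_sum_shifted_free:
  "family_sum (shifted_free b a) = {v :: nat \<Rightarrow> ('v::finite, 'k::field) mpoly. \<forall>i\<ge>b. v i = 0}" (is "?l = ?r")
proof -
  interpret sf: graded_module "free_scale :: ('v, 'k) mpoly \<Rightarrow> _" "shifted_free b a"
    by (rule graded_shifted_free)
  have "?l = free.span (\<Union>e. shifted_free b a e)" by (rule sf.family_sum_eq_span)
  also have "\<dots> = ?r"
  proof
    show "free.span (\<Union>e. shifted_free b a e) \<subseteq> ?r"
      by (rule free.span_minimal) (auto simp: shifted_free_def free_scale_def intro!: free.subspaceI)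
    show "?r \<subseteq> free.span (\<Union>e. shifted_free b a e)"
    proof
      fix v assume v: "v \<in> ?r"
      define unit :: "nat \<Rightarrow> nat \<Rightarrow> ('v, 'k) mpoly" where "unit i j = (if j = i then 1 else 0)" for i j
      have "unit i \<in> shifted_free b a a" if "i < b" for i
        using that forms_const[of 1] by (auto simp: shifted_free_def unit_def)
      then have "(\<Sum>i<b. free_scale (v i) (unit i)) \<in> free.span (\<Union>e. shifted_free b a e)"
        by (intro free.span_sum free.span_scale free.span_base) auto
      moreover have "v = (\<Sum>i<b. free_scale (v i) (unit i))"
      proof
        fix j
        have "(\<Sum>i<b. free_scale (v i) (unit i)) j = (\<Sum>i<b. if i = j then v j else 0)"
          unfolding sum_pointwise by (intro sum.cong) (auto simp: free_scale_def unit_def)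
        also have "\<dots> = v j" using v by (auto simp: sum.delta')
        finally show "v j = (\<Sum>i<b. free_scale (v i) (unit i)) j" by simp
      qed
      ultimately show "v \<in> free.span (\<Union>e. shifted_free b a e)" by simp
    qed
  qed
  finally show ?thesis .
qed

context graded_module
begin

text \<open>
  A submodule with homogeneous generators is the sum of its intersections with the components.
\<close>
lemma family_sum_span:
  assumes "B \<subseteq> (\<Union>e. M e)"
  shows "family_sum (\<lambda>e. span B \<inter> M e) = span B"
proof
  show "family_sum (\<lambda>e. span B \<inter> M e) \<subseteq> span B"
    by (auto simp: family_sum_def intro!: span_sum)
  interpret sub: graded_module scale "\<lambda>e. span B \<inter> M e"
  proof
    fix E :: "int set" and u e
    assume "finite E" "\<And>e. e \<in> E \<Longrightarrow> u e \<in> span B \<inter> M e" "(\<Sum>e\<in>E. u e) = 0" "e \<in> E"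
    then show "u e = 0" using independent_comps[of E u] by blast
  qed (auto intro: span_zero zero_comp span_add add_comp span_scale scale_comp)
  show "span B \<subseteq> family_sum (\<lambda>e. span B \<inter> M e)"
    unfolding sub.family_sum_eq_span
    by (rule span_mono) (use assms in \<open>auto intro: span_base\<close>)
qed

text \<open>
  Passing from a list of generators to the generators of its syzygies can be iterated for ever, since
  linear quotients in a single degree are inherited.
\<close>
lemma linear_quotients_linear_resolution:
  assumes hs: "set hs \<subseteq> M d" and lq: "linear_quotients scale hs"
  shows "has_linear_resolution scale (\<lambda>e. span (set hs) \<inter> M e)"
proof -
  interpret fm: graded_module "free_scale :: ('v, 'k) mpoly \<Rightarrow> _" "\<lambda>e. {v. \<forall>i. v i \<in> forms e}"
    by (rule graded_free_module)
  (* zs 0 generates the syzygies of hs, and zs (Suc n) those of zs n *)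
  define P :: "nat \<Rightarrow> (nat \<Rightarrow> ('v, 'k) mpoly) list \<Rightarrow> bool" where
    "P n zs \<longleftrightarrow> linear_quotients free_scale zs \<and> (\<forall>z\<in>set zs. \<forall>i. z i \<in> forms 1) \<and>
      (n = 0 \<longrightarrow> (\<forall>z\<in>set zs. \<forall>i\<ge>length hs. z i = 0) \<and>
        free.span (set zs) = {v. (\<forall>i\<ge>length hs. v i = 0) \<and> comb hs v = 0})" for n zs
  define Q :: "nat \<Rightarrow> (nat \<Rightarrow> ('v, 'k) mpoly) list \<Rightarrow> (nat \<Rightarrow> ('v, 'k) mpoly) list \<Rightarrow> bool" where
    "Q n zs zs' \<longleftrightarrow> (\<forall>z\<in>set zs'. \<forall>i\<ge>length zs. z i = 0) \<and>
        free.span (set zs') = {v. (\<forall>i\<ge>length zs. v i = 0) \<and> free.comb zs v = 0}" for n zs zs'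
  have "\<exists>zs. \<forall>n. P n (zs n) \<and> Q n (zs n) (zs (Suc n))"
  proof (rule dependent_nat_choice)
    show "\<exists>zs. P 0 zs"
    proof -
      obtain zs where "\<forall>z\<in>set zs. (\<forall>i. z i \<in> forms 1) \<and> (\<forall>i\<ge>length hs. z i = 0)"
        "linear_quotients free_scale zs"
        "free.span (set zs) = {v. (\<forall>i\<ge>length hs. v i = 0) \<and> comb hs v = 0}"
        using linear_syzygies[OF hs lq] by auto
      then have "P 0 zs" by (simp add: P_def)
      then show ?thesis by blast
    qed
    show "\<exists>zs'. P (Suc n) zs' \<and> Q n zs zs'" if "P n zs" for n zs
    proof -
      have "set zs \<subseteq> {v. \<forall>i. v i \<in> forms 1}" "linear_quotients free_scale zs"
        using that by (auto simp: P_def)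
      from fm.linear_syzygies[OF this] obtain zs' where
        zs': "\<forall>z\<in>set zs'. (\<forall>i. z i \<in> forms 1) \<and> (\<forall>i\<ge>length zs. z i = 0)"
        "linear_quotients free_scale zs'"
        "free.span (set zs') = {v. (\<forall>i\<ge>length zs. v i = 0) \<and> free.comb zs v = 0}"
        by blast
      have "P (Suc n) zs'" using zs'(1,2) by (simp add: P_def)
      moreover have "Q n zs zs'" unfolding Q_def using zs'(1) by (intro conjI zs'(3)) simp
      ultimately show ?thesis by blast
    qed
  qed
  then obtain zs where P: "\<And>n. P n (zs n)" and Q: "\<And>n. Q n (zs n) (zs (Suc n))" by blast
  define b where "b n = (case n of 0 \<Rightarrow> length hs | Suc n \<Rightarrow> length (zs n))" for n
  have b: "b 0 = length hs" "\<And>n. b (Suc n) = length (zs n)" by (auto simp: b_def)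
  define F where "F i = (shifted_free (b i) (d + int i) :: int \<Rightarrow> (nat \<Rightarrow> ('v, 'k) mpoly) set)" for i
  define \<phi> where "\<phi> i = free.comb (zs i)" for i
  have Fsum: "family_sum (F i) = {v. \<forall>k\<ge>b i. v k = 0}" for i
    by (simp add: F_def family_sum_shifted_free)
  have sum: "family_sum (\<lambda>e. span (set hs) \<inter> M e) = span (set hs)"
    using hs by (intro family_sum_span) auto
  have entries: "z k \<in> forms 1" "k \<ge> b i \<Longrightarrow> z k = 0" if "z \<in> set (zs i)" for i z k
  proof -
    show "z k \<in> forms 1" using P[of i] that by (auto simp: P_def)
    show "z k = 0" if "k \<ge> b i"
    proof (cases i)
      case 0
      then show ?thesis using P[of 0] that \<open>z \<in> _\<close> by (auto simp: P_def b)
    next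
      case (Suc j)
      then show ?thesis using Q[of j] that \<open>z \<in> _\<close> by (auto simp: Q_def b)
    qed
  qed
  have \<epsilon>_hom: "graded_hom free_scale (F 0) scale (\<lambda>e. span (set hs) \<inter> M e) (comb hs)"
    unfolding graded_hom_def
  proof (intro conjI allI ballI)
    show "comb hs (u + v) = comb hs u + comb hs v" for u v
      using comb_add by (simp add: plus_fun_def)
    show "comb hs (free_scale s u) = s *s comb hs u" for s u
      using comb_scale by (simp add: free_scale_def)
    show "comb hs ` F 0 e \<subseteq> span (set hs) \<inter> M e" for e
    proof
      fix x assume "x \<in> comb hs ` F 0 e"
      then obtain v where v: "x = comb hs v" "v \<in> F 0 e" by auto
      have "comb hs v \<in> M e"
        by (rule comb_comp[where d = "\<lambda>_. d"]) (use v hs in \<open>auto simp: F_def shifted_free_def b\<close>)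
      then show "x \<in> span (set hs) \<inter> M e" using v comb_in_span by simp
    qed
  qed
  have \<phi>_hom: "graded_hom free_scale (F (Suc i)) free_scale (F i) (\<phi> i)" for i
    unfolding graded_hom_def
  proof (intro conjI allI ballI)
    show "\<phi> i (u + v) = \<phi> i u + \<phi> i v" for u v
      using free.comb_add by (simp add: plus_fun_def \<phi>_def)
    show "\<phi> i (free_scale s u) = free_scale s (\<phi> i u)" for s u
      using free.comb_scale[of "zs i" s u] by (simp add: free_scale_def \<phi>_def)
    show "\<phi> i ` F (Suc i) e \<subseteq> F i e" for e
    proof
      fix x assume "x \<in> \<phi> i ` F (Suc i) e"
      then obtain v where v: "x = \<phi> i v" "\<And>k. k < length (zs i) \<Longrightarrow> v k \<in> forms (e - (d + int (Suc i)))"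
        by (auto simp: F_def shifted_free_def b)
      have x: "x k = (\<Sum>j<length (zs i). v j * (zs i ! j) k)" for k
        by (simp add: v \<phi>_def free.comb_def sum_pointwise free_scale_def)
      have "x k \<in> forms (e - (d + int i))" for k
        unfolding x
      proof (rule forms_sum)
        fix j assume j: "j \<in> {..<length (zs i)}"
        then have "v j * (zs i ! j) k \<in> forms (e - (d + int (Suc i)) + 1)"
          by (intro forms_mult v(2) entries(1)[OF nth_mem]) auto
        then show "v j * (zs i ! j) k \<in> forms (e - (d + int i))" by (simp add: algebra_simps)
      qed
      moreover have "x k = 0" if "k \<ge> b i" for k
        unfolding x using entries(2)[OF nth_mem that] by (intro sum.neutral) auto
      ultimately show "x \<in> F i e" by (simp add: F_def shifted_free_def)
    qed
  qed
  have im: "\<phi> i ` family_sum (F (Suc i)) = free.span (set (zs i))" for i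
    unfolding Fsum b \<phi>_def by (rule free.comb_image)
  have "comb hs ` family_sum (F 0) = family_sum (\<lambda>e. span (set hs) \<inter> M e)"
    unfolding sum Fsum b by (rule comb_image)
  moreover have "\<phi> 0 ` family_sum (F 1) = {u \<in> family_sum (F 0). comb hs u = 0}"
    using im[of 0] P[of 0] unfolding Fsum P_def b One_nat_def by simp
  moreover have "\<phi> (Suc i) ` family_sum (F (Suc (Suc i))) = {u \<in> family_sum (F (Suc i)). \<phi> i u = 0}" for i
    using Q[of i] unfolding im unfolding Fsum Q_def b \<phi>_def by simp
  ultimately show ?thesis
    unfolding has_linear_resolution_def
    by (intro exI[of _ d] exI[of _ b] exI[of _ "comb hs"] exI[of _ \<phi>])
       (simp only: Let_def F_def[symmetric] \<epsilon>_hom \<phi>_hom simp_thms)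
qed

section \<open>Linear quotients and componentwise linearity\<close>

text \<open>
  Every monomial of sufficiently large degree factors through the degree that leads from \<open>e\<close> to \<open>j\<close>,
  with a variable to spare if the inequality is strict.
\<close>
lemma scale_in_\<mm>_component:
  assumes x: "x \<in> M e" and s: "s \<in> forms r" and e: "e \<le> j"
  shows "r + e \<ge> j \<Longrightarrow> s *s x \<in> span (M j)" and "r + e > j \<Longrightarrow> s *s x \<in> \<mm> (M j)"
proof -
  have terms: "single t c *s x \<in> span (M j)" if "int (total_deg t) + e \<ge> j" for t c
    using that
  proof (induction t rule: monomial_induct)
    case zero
    then have "e = j" using e by simp
    then show ?case using scale_comp[OF forms_const x] by (simp add: span_base const_poly_def)
  next
    case (var v t)
    show ?case
    proof (cases "int (total_deg t) + e \<ge> j")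
      case True
      have "single (single v 1 + t) c = var_poly v * single t c" by (simp add: var_poly_eq mult_single)
      then show ?thesis using span_scale[OF var.IH[OF True], of "var_poly v"] by simp
    next
      case False
      then have "int (total_deg (single v 1 + t)) + e = j" using var.prems by (simp add: total_deg_add)
      then show ?thesis using scale_comp[OF forms_single[OF refl] x] by (metis span_base)
    qed
  qed
  have expand: "s *s x = (\<Sum>t\<in>keys s. single t (lookup s t) *s x)"
    by (simp only: scale_sum_left[symmetric] sum_of_terms[symmetric])
  show "s *s x \<in> span (M j)" if "r + e \<ge> j"
    unfolding expand using that s by (intro span_sum terms) (auto simp: forms_def)
  show "s *s x \<in> \<mm> (M j)" if "r + e > j"
    unfolding expand
  proof (rule subspace_sum[OF \<mm>_subspace])
    fix t assume t: "t \<in> keys s"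
    have deg: "int (total_deg t) + e > j" using t s that by (auto simp: forms_def)
    then have "t \<noteq> 0" using e by auto
    then obtain v where v: "lookup t v \<noteq> 0"
      using poly_mapping_eqI[of t 0] by auto
    note eq = split_off_variable[OF v]
    have "int (total_deg (t - single v 1)) + e \<ge> j"
      using deg by (subst (asm) eq) (simp add: total_deg_add)
    then have "var_poly v *s (single (t - single v 1) (lookup s t) *s x) \<in> \<mm> (M j)"
      by (intro var_scale_in_\<mm> terms)
    moreover have "single t (lookup s t) = var_poly v * single (t - single v 1) (lookup s t)"
      by (subst eq) (simp add: var_poly_eq mult_single)
    ultimately show "single t (lookup s t) *s x \<in> \<mm> (M j)" by simp
  qed
qed

text \<open>
  The induction on the degree \<open>j\<close> adds the generators of degree \<open>j\<close> after those of smaller degree, which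
  may differ from the given order. Minimality makes this harmless: if \<open>s\<close> is in the colon ideal of a
  generator, then \<open>s\<close> times this generator is a combination of those earlier generators whose degree is
  not larger. A generator that comes later in the list but has smaller degree can therefore be
  replaced by earlier ones whenever it occurs in a relation.
\<close>
theorem linear_quotients_imp_componentwise_linear:
  assumes gens: "homogeneous_minimal_generators scale M gs" and lq: "linear_quotients scale gs"
  shows "componentwise_linear scale M"
proof -
  define n where "n = length gs"
  have "\<forall>i. \<exists>e. i < n \<longrightarrow> gs ! i \<in> M e"
    using gens by (auto simp: homogeneous_minimal_generators_def n_def)
  then obtain e where e: "\<And>i. i < n \<Longrightarrow> gs ! i \<in> M (e i)" by metis
  have span: "span (set gs) = family_sum M"
    and min: "\<And>i. i < n \<Longrightarrow> gs ! i \<notin> span ((!) gs ` ({..<n} - {i}))"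
    using gens by (auto simp: homogeneous_minimal_generators_def irredundant_def n_def)
  define I where "I i = colon_ideal scale (set (take i gs)) (gs ! i)" for i
  have colon_def: "s \<in> I i \<longleftrightarrow> s *s gs ! i \<in> span ((!) gs ` {..<i})" if "i < n" for i s
  proof -
    have "set (take i gs) = (!) gs ` {..<i}"
      using that nth_image[of i gs] by (simp add: n_def lessThan_atLeast0)
    then show ?thesis by (simp add: I_def colon_ideal_def)
  qed
  (* a linear syzygy has a constant coefficient at a generator of the next degree, and minimality
     excludes nonzero constants *)
  have colon_low: "s *s gs ! p \<in> span ((!) gs ` {q. q < p \<and> e q \<le> e p})" if p: "p < n" and s: "s \<in> I p" for p s
  proof -
    obtain L where L: "L \<subseteq> forms 1" "I p = ideal_generated L"
      using lq p unfolding linear_quotients_def n_def I_def generated_by_linear_forms_def by blast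
    have "I p \<subseteq> colon_ideal scale ((!) gs ` {q. q < p \<and> e q \<le> e p}) (gs ! p)"
      unfolding L(2)
    proof (rule ideal_subset_colon)
      fix l assume l: "l \<in> L"
      have "l *s gs ! p \<in> span (set (take p gs))"
        using l L(2) ideal_base by (auto simp: I_def colon_ideal_def)
      moreover have "l *s gs ! p \<in> M (1 + e p)"
        using l L(1) e[OF p] by (intro scale_comp) auto
      moreover have "\<And>i. i < length (take p gs) \<Longrightarrow> take p gs ! i \<in> M (e i)"
        using e p by (simp add: n_def)
      ultimately obtain u where u: "l *s gs ! p = comb (take p gs) u" "\<And>i. u i \<in> forms (1 + e p - e i)"
        using span_homogeneousE by metis
      have eq: "l *s gs ! p = (\<Sum>q<p. u q *s gs ! q)"
        using p unfolding u(1) comb_def n_def by (intro sum.cong) auto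
      have zero: "u q = 0" if q: "q < p" "e q > e p" for q
      proof (cases "e q > 1 + e p")
        case True
        then show ?thesis using forms_negative[OF _ u(2)[of q]] by simp
      next
        case False
        then have "1 + e p - e q = 0" using q(2) by simp
        then have "u q \<in> forms 0" using u(2)[of q] by (simp only:)
        then obtain c where c: "u q = const_poly c" using forms_0_eq_const by blast
        have "c = 0"
        proof (rule ccontr)
          assume "c \<noteq> 0"
          have "gs ! q = const_poly (1 / c) *s (u q *s gs ! q)"
            using \<open>c \<noteq> 0\<close> by (simp add: c const_poly_mult[symmetric])
          also have "u q *s gs ! q = l *s gs ! p - (\<Sum>q'\<in>{..<p} - {q}. u q' *s gs ! q')"
            unfolding eq using q by (simp add: sum.remove[of "{..<p}" q])
          also have "const_poly (1 / c) *s \<dots> \<in> span ((!) gs ` ({..<n} - {q}))"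
            using p q by (intro span_scale span_diff span_sum span_base) auto
          finally show False using min[of q] q p by simp
        qed
        with c show ?thesis by simp
      qed
      have "l *s gs ! p = (\<Sum>q\<in>{q. q < p \<and> e q \<le> e p}. u q *s gs ! q)"
        unfolding eq 
        by (rule sum.mono_neutral_cong_right) (auto, metis zero leI scale_zero_left)
      also have "\<dots> \<in> span ((!) gs ` {q. q < p \<and> e q \<le> e p})"
        by (intro span_sum span_scale span_base) auto
      finally show "l *s gs ! p \<in> span ((!) gs ` {q. q < p \<and> e q \<le> e p})" .
    qed
    with s show ?thesis by (auto simp: colon_ideal_def)
  qed
  (* the generator of largest index m > i in a relation is eliminated by means of colon_low; the
     bound m on the indices decreases, and generators of degree e i are not introduced since e m < e i *)
  have reorder: "s \<in> I i" if i: "i < n" and P: "P \<subseteq> {p. p < m \<and> p < n \<and> p \<noteq> i \<and> e p \<le> e i \<and> (e p = e i \<longrightarrow> p < i)}"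
    and s: "s *s gs ! i \<in> span ((!) gs ` P)" for s i P m
    using P s
  proof (induction m arbitrary: P)
    case 0
    then have "span ((!) gs ` P) \<subseteq> span ((!) gs ` {..<i})" by (intro span_mono) auto
    with 0 show ?case using colon_def[OF i] by auto
  next
    case (Suc m)
    show ?case
    proof (cases "m \<in> P \<and> i < m")
      case False
      show ?thesis
      proof (cases "m \<in> P")
        case False
        then have "P \<subseteq> {p. p < m \<and> p < n \<and> p \<noteq> i \<and> e p \<le> e i \<and> (e p = e i \<longrightarrow> p < i)}"
          using Suc.prems(1) by (auto simp: less_Suc_eq)
        then show ?thesis using Suc.IH Suc.prems(2) by blast
      next
        case True
        then have "m < i" using False Suc.prems(1) by (auto simp: less_Suc_eq)
        then have "span ((!) gs ` P) \<subseteq> span ((!) gs ` {..<i})"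
          using Suc.prems(1) by (intro span_mono) (auto simp: less_Suc_eq)
        then show ?thesis using Suc.prems(2) colon_def[OF i] by auto
      qed
    next
      case True
      then have m: "m < n" "e m < e i" "i < m" using Suc.prems(1) by force+
      define R where "R = (!) gs ` (P - {m})"
      have "(!) gs ` P = insert (gs ! m) R" using True by (auto simp: R_def)
      then obtain t where t: "s *s gs ! i - t *s gs ! m \<in> span R"
        using Suc.prems(2) by (auto simp: span_insert)
      have "t *s gs ! m = s *s gs ! i - (s *s gs ! i - t *s gs ! m)" by simp
      also have "\<dots> \<in> span ((!) gs ` {..<m})"
      proof (rule span_diff)
        show "s *s gs ! i \<in> span ((!) gs ` {..<m})"
          using m(3) by (intro span_scale span_base) auto
        have "R \<subseteq> (!) gs ` {..<m}"
          using Suc.prems(1) by (auto simp: R_def less_Suc_eq)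
        then show "s *s gs ! i - t *s gs ! m \<in> span ((!) gs ` {..<m})"
          using t span_mono by blast
      qed
      finally have "t \<in> I m" using colon_def[OF m(1)] by simp
      then have tm: "t *s gs ! m \<in> span ((!) gs ` {q. q < m \<and> e q \<le> e m})" by (rule colon_low[OF m(1)])
      define P' where "P' = (P - {m}) \<union> {q. q < m \<and> e q \<le> e m}"
      have "(s *s gs ! i - t *s gs ! m) + t *s gs ! m \<in> span ((!) gs ` P')"
        using t tm span_mono[of R "(!) gs ` P'"] span_mono[of "(!) gs ` {q. q < m \<and> e q \<le> e m}" "(!) gs ` P'"]
        by (intro span_add) (auto simp: R_def P'_def)
      then have "s *s gs ! i \<in> span ((!) gs ` P')" by simp
      moreover have "P' \<subseteq> {p. p < m \<and> p < n \<and> p \<noteq> i \<and> e p \<le> e i \<and> (e p = e i \<longrightarrow> p < i)}"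
        using Suc.prems(1) m by (auto simp: P'_def less_Suc_eq)
      ultimately show ?thesis using Suc.IH by blast
    qed
  qed
  have comp_span: "\<exists>u. x = (\<Sum>i<n. u i *s gs ! i) \<and> (\<forall>i. u i \<in> forms (j - e i))" if "x \<in> M j" for x j
  proof -
    have "x \<in> span (set gs)"
      unfolding span using that family_sum_component[of M, OF zero_comp] by blast
    then show ?thesis
      using span_homogeneousE[of gs e x j] e that unfolding n_def comb_def by metis
  qed
  define Q where "Q j \<longleftrightarrow> (\<exists>hs. set hs \<subseteq> M j \<and> linear_quotients scale hs \<and> span (set hs) = span (M j))" for j
  (* below all generator degrees M j vanishes and the empty list serves *)
  have start: "Q j" if j: "\<And>i. i < n \<Longrightarrow> j < e i" for j
  proof -
    have "M j \<subseteq> {0}"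
    proof
      fix x assume "x \<in> M j"
      then obtain u where u: "x = (\<Sum>i<n. u i *s gs ! i)" "\<And>i. u i \<in> forms (j - e i)"
        using comp_span by blast
      have "u i = 0" if "i < n" for i using u(2)[of i] j[OF that] forms_negative[of "j - e i"] by simp
      then show "x \<in> {0}" using u(1) by simp
    qed
    then have "span (M j) = {0}" using span_minimal[OF _ subspace_single_0] span_zero by blast
    then show ?thesis unfolding Q_def by (intro exI[of _ "[]"]) (simp add: linear_quotients_Nil)
  qed
  have step: "Q (j + 1)" if "Q j" for j
  proof -
    obtain hs where hs: "set hs \<subseteq> M j" "linear_quotients scale hs" "span (set hs) = span (M j)"
      using \<open>Q j\<close> by (auto simp: Q_def)
    obtain hs' where hs': "set hs' \<subseteq> M (j + 1)" "linear_quotients scale hs'" "span (set hs') = \<mm> (M j)"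
      using linear_quotients_irrelevant_multiple[OF hs(1,2)] \<mm>_cong[OF hs(3)] by auto
    define new where "new m = filter (\<lambda>i. e i = j + 1) [0..<m]" for m
    have set_new: "set (map ((!) gs) (new m)) = (!) gs ` {p. p < m \<and> e p = j + 1}" for m
      by (auto simp: new_def)
    have low: "M j \<subseteq> span ((!) gs ` {p. p < n \<and> e p \<le> j})"
    proof
      fix x assume "x \<in> M j"
      then obtain u where u: "x = (\<Sum>i<n. u i *s gs ! i)" "\<And>i. u i \<in> forms (j - e i)"
        using comp_span by blast
      have zero: "u i = 0" if "\<not> e i \<le> j" for i
        using u(2)[of i] that forms_negative[of "j - e i"] by simp
      have "u i *s gs ! i \<in> span ((!) gs ` {p. p < n \<and> e p \<le> j})" if "i < n" for i
        using that zero[of i] by (cases "e i \<le> j") (auto intro: span_scale span_base span_zero)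
      then show "x \<in> span ((!) gs ` {p. p < n \<and> e p \<le> j})"
        unfolding u(1) by (intro span_sum) auto
    qed
    have lq_new: "linear_quotients scale (hs' @ map ((!) gs) (new m))" if "m \<le> n" for m
      using that
    proof (induction m)
      case 0
      then show ?case using hs'(2) by (simp add: new_def)
    next
      case (Suc m)
      show ?case
      proof (cases "e m = j + 1")
        case False
        then show ?thesis using Suc by (simp add: new_def)
      next
        case True
        have m: "m < n" using Suc.prems by simp
        define B where "B = set hs' \<union> (!) gs ` {p. p < m \<and> e p = j + 1}"
        obtain L where L: "L \<subseteq> forms 1" "I m = ideal_generated L"
          using lq m unfolding linear_quotients_def n_def I_def generated_by_linear_forms_def by blast
        have "colon_ideal scale B (gs ! m) = I m"
        proof
          show "I m \<subseteq> colon_ideal scale B (gs ! m)"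
            unfolding L(2)
          proof (rule ideal_subset_colon)
            fix l assume l: "l \<in> L"
            define ps where "ps = filter (\<lambda>q. e q \<le> e m) [0..<m]"
            have "(!) gs ` {q. q < m \<and> e q \<le> e m} = set (map ((!) gs) ps)"
              by (auto simp: ps_def)
            then have "l *s gs ! m \<in> span (set (map ((!) gs) ps))"
              using colon_low[OF m, of l] L(2) ideal_base[OF l] by simp
            moreover have "l *s gs ! m \<in> M (1 + e m)"
              using l L(1) e[OF m] by (intro scale_comp) auto
            moreover have ps: "ps ! i < n" "e (ps ! i) \<le> j + 1" "ps ! i < m" if "i < length ps" for i
              using nth_mem[OF that] m True by (auto simp: ps_def)
            then have "\<And>i. i < length (map ((!) gs) ps) \<Longrightarrow> map ((!) gs) ps ! i \<in> M (e (ps ! i))"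
              using e by simp
            ultimately obtain u where u: "l *s gs ! m = comb (map ((!) gs) ps) u"
              "\<And>i. u i \<in> forms (1 + e m - e (ps ! i))"
              using span_homogeneousE[of "map ((!) gs) ps" "\<lambda>i. e (ps ! i)"] by metis
            show "l *s gs ! m \<in> span B"
              unfolding u(1) comb_def
            proof (rule span_sum)
              fix i assume "i \<in> {..<length (map ((!) gs) ps)}"
              then have i: "i < length ps" by simp
              show "u i *s map ((!) gs) ps ! i \<in> span B"
              proof (cases "e (ps ! i) = j + 1")
                case True
                then show ?thesis using ps(3)[OF i] i by (intro span_scale span_base) (auto simp: B_def)
              next
                case False
                then have "u i *s gs ! (ps ! i) \<in> \<mm> (M j)"
                  using ps(1,2)[OF i] True u(2)[of i] e
                  by (intro scale_in_\<mm>_component(2)[of _ "e (ps ! i)" _ "1 + e m - e (ps ! i)"]) auto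
                then show ?thesis using hs'(3) span_mono[of "set hs'" B] i by (auto simp: B_def)
              qed
            qed
          qed
          show "colon_ideal scale B (gs ! m) \<subseteq> I m"
          proof
            fix s assume s: "s \<in> colon_ideal scale B (gs ! m)"
            let ?P = "{p. p < n \<and> e p \<le> j} \<union> {p. p < m \<and> e p = j + 1}"
            have "set hs' \<subseteq> span (M j)" using hs'(3) \<mm>_subset_span span_superset by blast
            also have "span (M j) \<subseteq> span ((!) gs ` {p. p < n \<and> e p \<le> j})"
              using low by (simp add: span_subset_iff)
            also have "\<dots> \<subseteq> span ((!) gs ` ?P)" by (intro span_mono) auto
            finally have "B \<subseteq> span ((!) gs ` ?P)" unfolding B_def by (auto intro: span_base)
            then have "span B \<subseteq> span ((!) gs ` ?P)" by (simp add: span_subset_iff)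
            then have "s *s gs ! m \<in> span ((!) gs ` ?P)" using s by (auto simp: colon_ideal_def)
            then show "s \<in> I m"
              using m True by (intro reorder[of m ?P n]) auto
          qed
        qed
        then have "generated_by_linear_forms (colon_ideal scale B (gs ! m))"
          using L by (auto simp: generated_by_linear_forms_def)
        moreover have "new (Suc m) = new m @ [m]" using True by (simp add: new_def)
        moreover have "set (hs' @ map ((!) gs) (new m)) = B"
          unfolding B_def set_append set_new ..
        ultimately show ?thesis
          using Suc linear_quotients_snoc[of scale "hs' @ map ((!) gs) (new m)" "gs ! m"] by simp
      qed
    qed
    define ks where "ks = hs' @ map ((!) gs) (new n)"
    have "linear_quotients scale ks" using lq_new[of n] by (simp add: ks_def)
    moreover have ks: "set ks \<subseteq> M (j + 1)"
      using hs'(1) e unfolding ks_def set_append set_new by fastforce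
    moreover have "span (set ks) = span (M (j + 1))"
    proof
      show "span (set ks) \<subseteq> span (M (j + 1))" using ks by (rule span_mono)
      have "M (j + 1) \<subseteq> span (set ks)"
      proof
        fix x assume "x \<in> M (j + 1)"
        then obtain u where u: "x = (\<Sum>i<n. u i *s gs ! i)" "\<And>i. u i \<in> forms (j + 1 - e i)"
          using comp_span by blast
        have "u i *s gs ! i \<in> span (set ks)" if i: "i < n" for i
        proof -
          consider "e i \<le> j" | "e i = j + 1" | "j + 1 < e i" by linarith
          then show ?thesis
          proof cases
            case 1
            then have "u i *s gs ! i \<in> \<mm> (M j)"
              using scale_in_\<mm>_component(2)[OF e[OF i] u(2)] by simp
            then show ?thesis using hs'(3) span_mono[of "set hs'" "set ks"] by (auto simp: ks_def)
          next
            case 2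
            then show ?thesis using i by (intro span_scale span_base) (auto simp: ks_def new_def)
          next
            case 3
            then have "u i = 0" using forms_negative[OF _ u(2)[of i]] by simp
            then show ?thesis by (simp add: span_zero)
          qed
        qed
        then show "x \<in> span (set ks)" unfolding u(1) by (intro span_sum) auto
      qed
      then show "span (M (j + 1)) \<subseteq> span (set ks)" by (simp add: span_subset_iff)
    qed
    ultimately show ?thesis unfolding Q_def by blast
  qed
  have "Q j" for j
  proof -
    obtain k where k: "k \<le> j" "\<And>i. i < n \<Longrightarrow> k < e i"
    proof
      let ?k = "Min (insert j ((\<lambda>i. e i - 1) ` {..<n}))"
      show "?k \<le> j" by simp
      show "?k < e i" if "i < n" for i
      proof -
        have "?k \<le> e i - 1" using that by (intro Min_le) auto
        then show ?thesis by simp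
      qed
    qed
    from k(1) show ?thesis
    proof (induction rule: int_ge_induct)
      case base
      show ?case by (rule start) (rule k(2))
    qed (rule step)
  qed
  then have "has_linear_resolution scale (\<lambda>e. span (M j) \<inter> M e)" for j
    using linear_quotients_linear_resolution unfolding Q_def by metis
  moreover have "\<exists>B. finite B \<and> span B = family_sum M"
    using span by (intro exI[of _ "set gs"]) auto
  ultimately show ?thesis unfolding componentwise_linear_def by auto
qed

end

section \<open>Monomials in two sets of variables\<close>

lemma lookup_x_part: "lookup (x_part t) i = lookup t (Inl i)"
  by (simp add: x_part_def map_key.rep_eq)

lemma lookup_y_part: "lookup (y_part t) j = lookup t (Inr j)"
  by (simp add: y_part_def map_key.rep_eq)

lemma x_part_add: "x_part (s + t) = x_part s + x_part t"
  by (rule poly_mapping_eqI) (simp add: lookup_x_part lookup_add)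

lemma y_part_add: "y_part (s + t) = y_part s + y_part t"
  by (rule poly_mapping_eqI) (simp add: lookup_y_part lookup_add)

lemma x_part_0 [simp]: "x_part 0 = 0"
  by (rule poly_mapping_eqI) (simp add: lookup_x_part)

lemma y_part_0 [simp]: "y_part 0 = 0"
  by (rule poly_mapping_eqI) (simp add: lookup_y_part)

lemma parts_eqI:
  assumes "x_part s = x_part t" "y_part s = y_part t"
  shows "s = t"
proof (rule poly_mapping_eqI)
  fix v
  show "lookup s v = lookup t v"
    using lookup_x_part[of s] lookup_x_part[of t] lookup_y_part[of s] lookup_y_part[of t] assms
    by (cases v) metis+
qed

definition join :: "'x::finite monomial \<Rightarrow> 'y::finite monomial \<Rightarrow> ('x + 'y) monomial" where
  "join u b = (\<Sum>i\<in>UNIV. single (Inl i) (lookup u i)) + (\<Sum>j\<in>UNIV. single (Inr j) (lookup b j))"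

lemma x_part_join [simp]: "x_part (join u b) = u"
  by (rule poly_mapping_eqI)
     (simp add: lookup_x_part join_def lookup_add lookup_sum lookup_single when_def sum.delta)

lemma y_part_join [simp]: "y_part (join u b) = b"
  by (rule poly_mapping_eqI)
     (simp add: lookup_y_part join_def lookup_add lookup_sum lookup_single when_def sum.delta)

lemma join_parts [simp]: "join (x_part t) (y_part t) = t"
  by (rule parts_eqI) simp_all

lemma join_add: "join (u + u') (b + b') = join u b + join u' b'"
  by (rule parts_eqI) (simp_all add: x_part_add y_part_add)

lemma join_eq_iff: "join u b = t \<longleftrightarrow> u = x_part t \<and> b = y_part t"
  by (metis join_parts x_part_join y_part_join)

lemma total_deg_parts:
  fixes t :: "('x::finite + 'y::finite) monomial"
  shows "total_deg t = total_deg (x_part t) + total_deg (y_part t)"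
proof -
  have "(\<Sum>v\<in>UNIV. lookup t v) = (\<Sum>i\<in>UNIV. lookup t (Inl i)) + (\<Sum>j\<in>UNIV. lookup t (Inr j))"
    using sum.Plus[of "UNIV :: 'x set" "UNIV :: 'y set" "lookup t"] by (simp add: o_def)
  then show ?thesis by (simp add: total_deg_eq lookup_x_part lookup_y_part)
qed

lemma induced_monomial_order:
  assumes "monomial_order lty" "monomial_order ltx"
  shows "monomial_order (induced_order lty ltx :: ('x::finite + 'y::finite) monomial \<Rightarrow> _)"
proof -
  interpret X: mon_order ltx by unfold_locales (rule assms)
  interpret Y: mon_order lty by unfold_locales (rule assms)
  show ?thesis
    unfolding monomial_order_def
  proof (intro conjI allI impI)
    fix s t u :: "('x + 'y) monomial"
    show "\<not> induced_order lty ltx s s"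
      using X.irrefl Y.irrefl by (auto simp: induced_order_def)
    show "induced_order lty ltx s u" if "induced_order lty ltx s t" "induced_order lty ltx t u"
      using that Y.trans[of "y_part s" "y_part t" "y_part u"] X.trans[of "x_part s" "x_part t" "x_part u"]
      by (auto simp: induced_order_def)
    show "induced_order lty ltx s t \<or> induced_order lty ltx t s" if "s \<noteq> t"
      using that parts_eqI[of s t] X.total[of "x_part s" "x_part t"] Y.total[of "y_part s" "y_part t"]
      unfolding induced_order_def by metis
    show "induced_order lty ltx 0 t" if "t \<noteq> 0"
      using that parts_eqI[of t 0] X.zero_less[of "x_part t"] Y.zero_less[of "y_part t"]
      by (auto simp: induced_order_def)
    show "induced_order lty ltx (s + u) (t + u)" if "induced_order lty ltx s t"
      using that X.add_right[of "x_part s" "x_part t" "x_part u"] Y.add_right[of "y_part s" "y_part t" "y_part u"]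
      by (auto simp: induced_order_def x_part_add y_part_add)
  qed
qed

text \<open>
  The ring \<open>T\<close> is read as \<open>K[x][y]\<close>: the relations in \<open>J\<close> are relations with coefficients in
  \<open>K[x]\<close> between the images of the monomials \<open>y\<^sup>b\<close>, and \<open>assemble\<close> goes back from such a relation
  to an element of \<open>J\<close>.
\<close>

definition y_coeff :: "('x::finite + 'y::finite, 'k::field) mpoly \<Rightarrow> 'y monomial \<Rightarrow> ('x, 'k) mpoly" where
  "y_coeff p b = (\<Sum>t\<in>{t \<in> keys p. y_part t = b}. single (x_part t) (lookup p t))"

lemma lookup_y_coeff: "lookup (y_coeff p b) u = lookup p (join u b)"
proof -
  have "lookup (y_coeff p b) u = (\<Sum>t\<in>{t \<in> keys p. y_part t = b}. if t = join u b then lookup p t else 0)"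
    unfolding y_coeff_def lookup_sum by (intro sum.cong) (auto simp: lookup_single when_def)
  also have "\<dots> = lookup p (join u b)"
    by (subst sum.delta) (auto simp: in_keys_iff)
  finally show ?thesis .
qed

definition assemble :: "'y::finite monomial set \<Rightarrow> ('y monomial \<Rightarrow> ('x::finite, 'k::field) mpoly) \<Rightarrow> ('x + 'y, 'k) mpoly" where
  "assemble B s = (\<Sum>b\<in>B. \<Sum>u\<in>keys (s b). single (join u b) (lookup (s b) u))"

lemma lookup_assemble:
  assumes "finite B"
  shows "lookup (assemble B s) t = (if y_part t \<in> B then lookup (s (y_part t)) (x_part t) else 0)"
proof -
  have "lookup (\<Sum>u\<in>keys (s b). single (join u b) (lookup (s b) u)) t =
      (if b = y_part t then lookup (s b) (x_part t) else 0)" for b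
  proof -
    have "lookup (\<Sum>u\<in>keys (s b). single (join u b) (lookup (s b) u)) t =
        (\<Sum>u\<in>keys (s b). if u = x_part t then (if b = y_part t then lookup (s b) u else 0) else 0)"
      unfolding lookup_sum by (intro sum.cong) (auto simp: lookup_single when_def join_eq_iff)
    also have "\<dots> = (if b = y_part t then lookup (s b) (x_part t) else 0)"
      by (subst sum.delta) (auto simp: in_keys_iff)
    finally show ?thesis .
  qed
  then have "lookup (assemble B s) t = (\<Sum>b\<in>B. if b = y_part t then lookup (s b) (x_part t) else 0)"
    by (simp add: assemble_def lookup_sum[of _ B])
  also have "\<dots> = (if y_part t \<in> B then lookup (s (y_part t)) (x_part t) else 0)"
    using assms by (simp add: sum.delta)
  finally show ?thesis .
qed

section \<open>Monomial ideals and minimal generators\<close>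

text \<open>
  All terms of a member of a monomial ideal are divisible by one of the generating monomials.
\<close>
lemma monomial_in_monomial_ideal:
  assumes "monom_poly t \<in> ideal_generated (monom_poly ` B :: ('v, 'k::field) mpoly set)"
  shows "\<exists>q\<in>B. \<exists>u. t = q + u"
proof -
  have "ideal_generated (monom_poly ` B) \<subseteq> {p :: ('v, 'k) mpoly. \<forall>t\<in>keys p. \<exists>q\<in>B. \<exists>u. t = q + u}"
    unfolding ideal_generated_def
  proof (rule ideal.span_minimal)
    show "monom_poly ` B \<subseteq> {p. \<forall>t\<in>keys p. \<exists>q\<in>B. \<exists>u. t = q + u}"
      by (auto simp: monom_poly_def) (metis add.right_neutral)
    show "ideal.subspace {p :: ('v, 'k) mpoly. \<forall>t\<in>keys p. \<exists>q\<in>B. \<exists>u. t = q + u}"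
    proof (rule ideal.subspaceI)
      fix p q :: "('v, 'k) mpoly"
      assume "p \<in> {p. \<forall>t\<in>keys p. \<exists>q\<in>B. \<exists>u. t = q + u}" "q \<in> {p. \<forall>t\<in>keys p. \<exists>q\<in>B. \<exists>u. t = q + u}"
      then show "p + q \<in> {p. \<forall>t\<in>keys p. \<exists>q\<in>B. \<exists>u. t = q + u}"
        using keys_add[of p q] by blast
    next
      fix c p :: "('v, 'k) mpoly"
      assume p: "p \<in> {p. \<forall>t\<in>keys p. \<exists>q\<in>B. \<exists>u. t = q + u}"
      show "c * p \<in> {p. \<forall>t\<in>keys p. \<exists>q\<in>B. \<exists>u. t = q + u}"
      proof (intro CollectI ballI)
        fix t assume "t \<in> keys (c * p)"
        then obtain a b where ab: "t = a + b" "b \<in> keys p" using keys_mult[of c p] by auto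
        with p obtain q u where "q \<in> B" "b = q + u" by blast
        with ab show "\<exists>q\<in>B. \<exists>u. t = q + u"
          by (intro bexI[of _ q] exI[of _ "a + u"]) (auto simp: ac_simps)
      qed
    qed auto
  qed
  with assms show ?thesis by (auto simp: monom_poly_def)
qed

context polynomial_module
begin

text \<open>
  Induction over the generators from the last one down: a relation modulo \<open>\<mm>\<close> has its last coefficient,
  up to an element of \<open>\<mm>\<close>, in the colon ideal; by assumption this coefficient lies in \<open>\<mm>\<close>, and its term
  can be moved to the right-hand side.
\<close>
lemma no_constant_syzygy:
  assumes colon: "\<And>i s. i < length gs \<Longrightarrow> s \<in> colon_ideal scale (set (take i gs)) (gs ! i) \<Longrightarrow>
      lookup s 0 = 0 \<and> s *s gs ! i \<in> \<mm> (set (take i gs))"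
    and "n \<le> length gs" "comb (take n gs) v \<in> \<mm> (set (take n gs))" "i < n"
  shows "lookup (v i) 0 = 0"
  using assms(2-)
proof (induction n arbitrary: v i)
  case (Suc n)
  have n: "n < length gs" "length (take n gs) = n" using Suc.prems(1) by auto
  have take: "take (Suc n) gs = take n gs @ [gs ! n]" using n by (simp add: take_Suc_conv_app_nth)
  obtain w where w: "comb (take (Suc n) gs) v = comb (take (Suc n) gs) w" "\<And>i. lookup (w i) 0 = 0"
    using \<mm>_combE[OF Suc.prems(2)] by metis
  have eq: "(v n - w n) *s gs ! n = comb (take n gs) w - comb (take n gs) v"
    using w(1) unfolding take comb_snoc n(2)
    by (simp add: scale_left_diff_distrib algebra_simps)
  then have "v n - w n \<in> colon_ideal scale (set (take n gs)) (gs ! n)"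
    by (simp add: colon_ideal_def span_diff comb_in_span)
  from colon[OF n(1) this] have c: "lookup (v n - w n) 0 = 0" "(v n - w n) *s gs ! n \<in> \<mm> (set (take n gs))"
    by auto
  have "comb (take n gs) w \<in> \<mm> (set (take n gs))"
    unfolding comb_def[of "take n gs" w]
    by (intro subspace_sum[OF \<mm>_subspace] scale_in_\<mm> w(2) span_base nth_mem) auto
  then have "comb (take n gs) w - (v n - w n) *s gs ! n \<in> \<mm> (set (take n gs))"
    using c(2) by (rule subspace_diff[OF \<mm>_subspace])
  then have "comb (take n gs) v \<in> \<mm> (set (take n gs))" by (simp add: eq)
  then have "lookup (v i) 0 = 0" if "i < n" for i
    using Suc.IH that n(1) by simp
  moreover have "lookup (v n) 0 = 0" using c(1) w(2) by (simp add: lookup_minus)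
  ultimately show ?case using Suc.prems(3) by (cases "i = n") auto
qed simp

text \<open>
  A redundant generator would give a syzygy with coefficient 1.
\<close>
lemma irredundantI:
  assumes colon: "\<And>i s. i < length gs \<Longrightarrow> s \<in> colon_ideal scale (set (take i gs)) (gs ! i) \<Longrightarrow>
      lookup s 0 = 0 \<and> s *s gs ! i \<in> \<mm> (set (take i gs))"
  shows "irredundant scale (\<lambda>i. gs ! i) {..<length gs}"
  unfolding irredundant_def
proof
  fix j assume j: "j \<in> {..<length gs}"
  show "gs ! j \<notin> span ((!) gs ` ({..<length gs} - {j}))"
  proof
    assume "gs ! j \<in> span ((!) gs ` ({..<length gs} - {j}))"
    then obtain r where r: "gs ! j = (\<Sum>i\<in>{..<length gs} - {j}. r i *s gs ! i)"
      by (rule span_imageE) simp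
    define v where "v i = (if i = j then 1 else - r i)" for i
    have "comb gs v = v j *s gs ! j + (\<Sum>i\<in>{..<length gs} - {j}. v i *s gs ! i)"
      unfolding comb_def using j by (simp add: sum.remove)
    also have "(\<Sum>i\<in>{..<length gs} - {j}. v i *s gs ! i) = - (\<Sum>i\<in>{..<length gs} - {j}. r i *s gs ! i)"
      unfolding sum_negf[symmetric] by (intro sum.cong) (auto simp: v_def)
    also have "v j *s gs ! j + - (\<Sum>i\<in>{..<length gs} - {j}. r i *s gs ! i) = 0"
      unfolding r[symmetric] by (simp add: v_def)
    finally have "comb (take (length gs) gs) v \<in> \<mm> (set (take (length gs) gs))"
      using subspace_0[OF \<mm>_subspace] by simp
    then have "lookup (v j) 0 = 0"
      using j no_constant_syzygy[OF colon, of "length gs" v j] by auto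
    then show False by (simp add: v_def)
  qed
qed

end

lemma finite_monomials_of_degree: "finite {t :: 'v::finite monomial. total_deg t = k}"
proof (induction k)
  case 0
  then show ?case by (simp add: total_deg_eq_0_iff)
next
  case (Suc k)
  have "{t :: 'v monomial. total_deg t = Suc k} \<subseteq> (\<Union>v. (+) (single v 1) ` {t. total_deg t = k})"
  proof
    fix t :: "'v monomial" assume t: "t \<in> {t. total_deg t = Suc k}"
    then have "t \<noteq> 0" by auto
    then obtain v where v: "lookup t v \<noteq> 0" using poly_mapping_eqI[of t 0] by auto
    note eq = split_off_variable[OF v]
    have "total_deg t = 1 + total_deg (t - single v 1)"
      by (subst eq) (simp only: total_deg_add total_deg_single)
    with t eq show "t \<in> (\<Union>v. (+) (single v 1) ` {t. total_deg t = k})" by auto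
  qed
  with Suc show ?case by (meson finite_UN finite_imageI finite_subset finite)
qed

lemma (in mon_order) finite_sorted_list:
  assumes "finite B"
  shows "\<exists>bs. set bs = B \<and> sorted_wrt lt bs"
  using assms
proof (induction "card B" arbitrary: B)
  case (Suc n)
  have "\<exists>b\<in>B. \<forall>c\<in>B. c \<noteq> b \<longrightarrow> lt c b"
  proof (rule finite_strict_order_max)
    show "lt s u" if "lt s t" "lt t u" for s t u using trans[OF that] .
    show "lt s t \<or> lt t s" if "s \<noteq> t" for s t using total[OF that] .
  qed (use Suc in auto)
  then obtain b where b: "b \<in> B" "\<And>c. c \<in> B \<Longrightarrow> c \<noteq> b \<Longrightarrow> lt c b" by blast
  have "n = card (B - {b})" "finite (B - {b})" using Suc b by auto
  then obtain bs where bs: "set bs = B - {b}" "sorted_wrt lt bs" using Suc.hyps(1) by blast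
  then show ?case using b by (intro exI[of _ "bs @ [b]"]) (auto simp: sorted_wrt_append)
qed auto

lemma (in mon_order) set_take_sorted:
  assumes "sorted_wrt lt bs" "i < length bs"
  shows "set (take i bs) = {c \<in> set bs. lt c (bs ! i)}"
proof
  show "set (take i bs) \<subseteq> {c \<in> set bs. lt c (bs ! i)}"
  proof
    fix c assume "c \<in> set (take i bs)"
    then obtain j where j: "j < i" "c = bs ! j" using assms(2) by (auto simp: in_set_conv_nth)
    then show "c \<in> {c \<in> set bs. lt c (bs ! i)}"
      using sorted_wrt_nth_less[OF assms(1) j(1) assms(2)] assms(2) by simp
  qed
  show "{c \<in> set bs. lt c (bs ! i)} \<subseteq> set (take i bs)"
  proof
    fix c assume "c \<in> {c \<in> set bs. lt c (bs ! i)}"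
    then obtain j where j: "j < length bs" "c = bs ! j" "lt (bs ! j) (bs ! i)"
      by (auto simp: in_set_conv_nth)
    have "j < i"
    proof (rule ccontr)
      assume "\<not> j < i"
      then consider "j = i" | "i < j" by linarith
      then show False
      proof cases
        case 1
        with j(3) show False using irrefl by simp
      next
        case 2
        then have "lt (bs ! i) (bs ! j)" using sorted_wrt_nth_less[OF assms(1)] j(1) by simp
        with asym[OF j(3)] show False by simp
      qed
    qed
    then show "c \<in> set (take i bs)"
      using j(1,2) by (auto simp: in_set_conv_nth)
  qed
qed

section \<open>Algebras with a quadratic initial ideal\<close>

context bigraded_algebra
begin

lemma sum_mem: "(\<And>a. a \<in> A \<Longrightarrow> x a \<in> G i j) \<Longrightarrow> sum x A \<in> G i j"
  by (induction A rule: infinite_finite_induct) (auto intro: zero_mem add_mem)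

text \<open>
  The family is a decomposition of \<open>0\<close> into homogeneous components, hence the trivial one.
\<close>
lemma independent_components:
  assumes "finite E" "\<And>p. p \<in> E \<Longrightarrow> y p \<in> G (fst p) (snd p)" "(\<Sum>p\<in>E. y p) = 0" "p \<in> E"
  shows "y p = 0"
proof -
  define c where "c = (\<Sum>p\<in>E. single p (y p))"
  have lookup_c: "lookup c q = (if q \<in> E then y q else 0)" for q
  proof -
    have "lookup c q = (\<Sum>p\<in>E. if p = q then y q else 0)"
      unfolding c_def lookup_sum by (intro sum.cong) (auto simp: lookup_single when_def)
    then show ?thesis using assms(1) by (simp add: sum.delta)
  qed
  have "(\<Sum>p\<in>keys c. lookup c p) = (\<Sum>p\<in>E. lookup c p)"
    using assms(1) by (intro sum.mono_neutral_left) (auto simp: in_keys_iff lookup_c split: if_splits)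
  then have sum: "0 = (\<Sum>p\<in>keys c. lookup c p)" using assms(3) by (simp add: lookup_c)
  have mem: "lookup c (i, j) \<in> G i j" for i j
    using assms(2)[of "(i, j)"] by (auto simp: lookup_c zero_mem)
  have "c = 0"
    using direct_sum[of 0] sum mem zero_mem by (metis (no_types, lifting) keys_zero lookup_zero sum.empty)
  then show ?thesis using lookup_c[of p] assms(4) by simp
qed

end

locale quadratic_initial_ideal = bigraded_algebra \<kappa> G
  for \<kappa> :: "'k::field \<Rightarrow> 'a::comm_ring_1" and G :: "int \<Rightarrow> nat \<Rightarrow> 'a set" +
  fixes \<iota> :: "('n::finite, 'k) mpoly \<Rightarrow> 'a"
    and f :: "'m::finite \<Rightarrow> 'a"
    and d :: "'m \<Rightarrow> int"
    and \<phi> :: "('n + 'm, 'k) mpoly \<Rightarrow> 'a"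
    and J :: "('n + 'm, 'k) mpoly set"
    and lty :: "'m monomial \<Rightarrow> 'm monomial \<Rightarrow> bool"
    and ltx :: "'n monomial \<Rightarrow> 'n monomial \<Rightarrow> bool"
  assumes A0_hom: "is_ring_hom \<iota>" and A0_inj: "inj \<iota>" and A0_const: "\<iota> (const_poly c) = \<kappa> c"
    and A0_graded: "\<iota> ` forms i = G i 0"
    and standard: "fg_standard_graded G"
    and f_degree: "f j \<in> G (d j) 1"
    and f_generates: "module.span (scale_via \<iota>) (range f) = component G 1"
    and f_minimal: "irredundant (scale_via \<iota>) f UNIV"
    and phi_hom: "is_ring_hom \<phi>" and phi_const: "\<phi> (const_poly c) = \<kappa> c"
    and phi_x: "\<phi> (var_poly (Inl v)) = \<iota> (var_poly v)"
    and phi_y: "\<phi> (var_poly (Inr j)) = f j"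
    and J_def: "J = {p. \<phi> p = 0}"
    and lty: "monomial_order lty" and ltx: "monomial_order ltx"
    and quadratic: "generated_by_quadratic_monomials (initial_ideal (induced_order lty ltx) J)"
begin

abbreviation lt :: "('n + 'm) monomial \<Rightarrow> ('n + 'm) monomial \<Rightarrow> bool" where
  "lt \<equiv> induced_order lty ltx"

sublocale X: mon_order ltx by unfold_locales (rule ltx)
sublocale Y: mon_order lty by unfold_locales (rule lty)
sublocale XY: mon_order lt by unfold_locales (rule induced_monomial_order[OF lty ltx])

sublocale A: polynomial_module "scale_via \<iota>"
  by standard (simp_all add: scale_via_def ring_hom_add[OF A0_hom] ring_hom_mult[OF A0_hom]
      ring_hom_1[OF A0_hom] distrib_left distrib_right mult.assoc)

lemma graded_component: "graded_module (scale_via \<iota>) (\<lambda>i. G i k)"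
proof
  show "scale_via \<iota> s x \<in> G (i + e) k" if "s \<in> forms i" "x \<in> G e k" for s i x e
    using mult_mem[of "\<iota> s" i 0 x e k] A0_graded[of i] that by (auto simp: scale_via_def)
  show "u e = 0" if "finite E" "\<And>e. e \<in> E \<Longrightarrow> u e \<in> G e k" "(\<Sum>e\<in>E. u e) = 0" "e \<in> E" for E u e
  proof -
    have "(\<Sum>p\<in>(\<lambda>e. (e, k)) ` E. u (fst p)) = 0"
      using that(3) by (subst sum.reindex) (auto simp: inj_on_def)
    then have "u (fst (e, k)) = 0"
      by (rule independent_components[of "(\<lambda>e. (e, k)) ` E", rotated 2]) (use that in auto)
    then show ?thesis by simp
  qed
qed (auto intro: zero_mem add_mem)

text \<open>The image of \<open>y\<^sup>b\<close> under \<open>\<phi>\<close>.\<close>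

abbreviation g :: "'m monomial \<Rightarrow> 'a" where
  "g \<equiv> eval_monomial f"

lemma phi_single: "\<phi> (single t c) = \<iota> (single (x_part t) c) * g (y_part t)"
proof -
  have "\<phi> (monom_poly t) = \<iota> (monom_poly (x_part t)) * g (y_part t)"
  proof (induction t rule: monomial_induct)
    case zero
    then show ?case
      using ring_hom_1[OF phi_hom] ring_hom_1[OF A0_hom] by (simp add: monom_poly_def)
  next
    case (var v t)
    have split: "\<phi> (monom_poly (single v 1 + t)) = \<phi> (var_poly v) * \<phi> (monom_poly t)"
      by (simp add: var_poly_eq monom_poly_def mult_single flip: ring_hom_mult[OF phi_hom])
    show ?case
    proof (cases v)
      case (Inl i)
      have parts: "x_part (single (Inl i) 1 :: ('n + 'm) monomial) = single i 1" "y_part (single (Inl i) 1 :: ('n + 'm) monomial) = 0"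
        by (auto intro!: poly_mapping_eqI simp: lookup_x_part lookup_y_part lookup_single when_def)
      have "\<iota> (monom_poly (single i 1 + x_part t)) = \<iota> (var_poly i) * \<iota> (monom_poly (x_part t))"
        by (simp add: var_poly_eq monom_poly_def mult_single flip: ring_hom_mult[OF A0_hom])
      then show ?thesis
        unfolding split var.IH unfolding Inl phi_x x_part_add y_part_add parts by (simp add: mult.assoc)
    next
      case (Inr j)
      have parts: "x_part (single (Inr j) 1 :: ('n + 'm) monomial) = 0" "y_part (single (Inr j) 1 :: ('n + 'm) monomial) = single j 1"
        by (auto intro!: poly_mapping_eqI simp: lookup_x_part lookup_y_part lookup_single when_def)
      show ?thesis
        unfolding split var.IH unfolding Inr phi_y x_part_add y_part_add parts eval_monomial_add eval_monomial_single
        by (simp add: mult.left_commute)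
    qed
  qed
  then show ?thesis
    unfolding single_eq_const_monom ring_hom_mult[OF phi_hom] ring_hom_mult[OF A0_hom] phi_const A0_const
    by (simp only: mult.assoc)
qed

lemma phi_y_coeffs: "\<phi> p = (\<Sum>b\<in>y_part ` keys p. \<iota> (y_coeff p b) * g b)"
proof -
  have "\<phi> p = (\<Sum>t\<in>keys p. \<phi> (single t (lookup p t)))"
    by (subst sum_of_terms) (rule ring_hom_sum[OF phi_hom])
  also have "\<dots> = (\<Sum>b\<in>y_part ` keys p. \<Sum>t\<in>{t \<in> keys p. y_part t = b}. \<phi> (single t (lookup p t)))"
    by (rule sum.image_gen) simp
  also have "\<dots> = (\<Sum>b\<in>y_part ` keys p. \<iota> (y_coeff p b) * g b)"
    by (intro sum.cong refl)
       (simp add: y_coeff_def ring_hom_sum[OF A0_hom] sum_distrib_right phi_single)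
  finally show ?thesis .
qed

lemma phi_assemble:
  assumes "finite B"
  shows "\<phi> (assemble B s) = (\<Sum>b\<in>B. \<iota> (s b) * g b)"
proof -
  have "\<phi> (\<Sum>u\<in>keys (s b). single (join u b) (lookup (s b) u)) = \<iota> (s b) * g b" for b
  proof -
    have "\<phi> (\<Sum>u\<in>keys (s b). single (join u b) (lookup (s b) u)) = \<iota> (\<Sum>u\<in>keys (s b). single u (lookup (s b) u)) * g b"
      by (simp add: ring_hom_sum[OF phi_hom] phi_single ring_hom_sum[OF A0_hom] sum_distrib_right)
    then show ?thesis by (simp only: sum_of_terms[symmetric])
  qed
  then show ?thesis by (simp add: assemble_def ring_hom_sum[OF phi_hom])
qed

definition y_weight :: "'m monomial \<Rightarrow> int" where
  "y_weight b = (\<Sum>j\<in>UNIV. d j * int (lookup b j))"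

definition bidegree :: "('n + 'm) monomial \<Rightarrow> int \<times> nat" where
  "bidegree t = (int (total_deg (x_part t)) + y_weight (y_part t), total_deg (y_part t))"

lemma y_weight_add: "y_weight (b + c) = y_weight b + y_weight c"
  by (simp add: y_weight_def lookup_add distrib_left sum.distrib)

lemma y_weight_single: "y_weight (single j 1) = d j"
proof -
  have "y_weight (single j 1) = (\<Sum>i\<in>UNIV. if i = j then d j else 0)"
    unfolding y_weight_def by (intro sum.cong) (auto simp: lookup_single when_def)
  then show ?thesis by (simp add: sum.delta)
qed

lemma g_mem: "g b \<in> G (y_weight b) (total_deg b)"
proof (induction b rule: monomial_induct)
  case zero
  then show ?case by (simp add: one_mem y_weight_def)
next
  case (var j b)
  show ?case
    using mult_mem[OF f_degree[of j] var]
    unfolding eval_monomial_add eval_monomial_single y_weight_add y_weight_single total_deg_add total_deg_single .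
qed

lemma phi_homogeneous:
  assumes "\<And>t. t \<in> keys p \<Longrightarrow> bidegree t = e"
  shows "\<phi> p \<in> G (fst e) (snd e)"
proof -
  have "\<phi> p = (\<Sum>t\<in>keys p. \<phi> (single t (lookup p t)))"
    by (subst sum_of_terms) (rule ring_hom_sum[OF phi_hom])
  also have "\<dots> \<in> G (fst e) (snd e)"
  proof (rule sum_mem)
    fix t assume t: "t \<in> keys p"
    have "\<iota> (single (x_part t) (lookup p t)) \<in> G (int (total_deg (x_part t))) 0"
      unfolding A0_graded[symmetric] by (intro imageI forms_single refl)
    from mult_mem[OF this g_mem] assms[OF t] show "\<phi> (single t (lookup p t)) \<in> G (fst e) (snd e)"
      by (auto simp: phi_single bidegree_def)
  qed
  finally show ?thesis .
qed

text \<open>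
  The bihomogeneous components of \<open>p\<close> are mapped to those of \<open>\<phi> p\<close>. For \<open>\<phi> p = 0\<close> this says that
  \<open>J\<close> is bihomogeneous.
\<close>
lemma phi_restrict_terms:
  assumes "\<phi> p \<in> G (fst e) (snd e)"
  shows "\<phi> (restrict_terms (\<lambda>t. bidegree t = e) p) = \<phi> p"
proof -
  define E where "E = insert e (bidegree ` keys p)"
  have "finite E" by (simp add: E_def)
  define y where "y e' = \<phi> (restrict_terms (\<lambda>t. bidegree t = e') p) - (if e' = e then \<phi> p else 0)" for e'
  have mem: "y q \<in> G (fst q) (snd q)" for q
  proof -
    interpret gm: graded_module "scale_via \<iota>" "\<lambda>i. G i (snd q)" by (rule graded_component)
    have "\<phi> (restrict_terms (\<lambda>t. bidegree t = q) p) \<in> G (fst q) (snd q)"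
      by (rule phi_homogeneous) (simp add: keys_restrict_terms)
    then show ?thesis
      using gm.diff_comp[of _ "fst q" "\<phi> p"] assms by (cases "q = e") (auto simp: y_def)
  qed
  have "\<phi> p = (\<Sum>q\<in>E. \<phi> (restrict_terms (\<lambda>t. bidegree t = q) p))"
    using sum_restrict_terms[OF \<open>finite E\<close>, of p bidegree] ring_hom_sum[OF phi_hom] by (metis E_def imageI insertI2)
  then have "(\<Sum>q\<in>E. y q) = 0"
    unfolding y_def sum_subtractf using \<open>finite E\<close> by (simp add: E_def)
  from independent_components[OF \<open>finite E\<close> mem this]
  have "y e = 0" by (auto simp: E_def)
  then show ?thesis by (simp add: y_def)
qed

lemma J_restrict_terms: "p \<in> J \<Longrightarrow> restrict_terms (\<lambda>t. bidegree t = e) p \<in> J"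
  using phi_restrict_terms[of p e] by (simp add: J_def zero_mem)

lemma J_mult: "p \<in> J \<Longrightarrow> q * p \<in> J"
  by (simp add: J_def ring_hom_mult[OF phi_hom])

definition quads :: "('n + 'm) monomial set" where
  "quads = (SOME Q. (\<forall>t\<in>Q. total_deg t = 2) \<and> initial_ideal lt J = ideal_generated (monom_poly ` Q))"

lemma quads: "t \<in> quads \<Longrightarrow> total_deg t = 2" "initial_ideal lt J = ideal_generated (monom_poly ` quads)"
proof -
  have "(\<forall>t\<in>quads. total_deg t = 2) \<and> initial_ideal lt J = ideal_generated (monom_poly ` quads)"
    using quadratic unfolding generated_by_quadratic_monomials_def quads_def by (rule someI_ex)
  then show "t \<in> quads \<Longrightarrow> total_deg t = 2" "initial_ideal lt J = ideal_generated (monom_poly ` quads)"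
    by auto
qed

lemma initial_ideal_eq:
  "initial_ideal lt J = ideal_generated (monom_poly ` {leading_monomial lt p | p. p \<in> J \<and> p \<noteq> 0})"
proof -
  have "{monom_poly (leading_monomial lt p) :: ('n + 'm, 'k) mpoly | p. p \<in> J \<and> p \<noteq> 0} =
      monom_poly ` {leading_monomial lt p | p. p \<in> J \<and> p \<noteq> 0}" by auto
  then show ?thesis by (simp only: initial_ideal_def)
qed

lemma leading_monomial_divisible:
  assumes "p \<in> J" "p \<noteq> 0"
  shows "\<exists>q\<in>quads. \<exists>u. leading_monomial lt p = q + u"
proof -
  have "monom_poly (leading_monomial lt p) \<in> ideal_generated (monom_poly ` quads :: ('n + 'm, 'k) mpoly set)"
    unfolding quads(2)[symmetric] initial_ideal_eq by (rule ideal_base) (use assms in auto)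
  then show ?thesis by (rule monomial_in_monomial_ideal)
qed

text \<open>
  A relation with a given leading monomial can be made bihomogeneous by restricting it to
  the bidegree of that monomial.
\<close>
lemma multiple_is_leading_monomial:
  assumes "q \<in> quads"
  shows "\<exists>p\<in>J. p \<noteq> 0 \<and> leading_monomial lt p = q + u \<and> (\<forall>t\<in>keys p. bidegree t = bidegree (q + u))"
proof -
  have "monom_poly q \<in> ideal_generated (monom_poly ` {leading_monomial lt p | p. p \<in> J \<and> p \<noteq> 0} :: ('n + 'm, 'k) mpoly set)"
    unfolding initial_ideal_eq[symmetric] quads(2) by (rule ideal_base) (use assms in auto)
  then obtain p w where p: "p \<in> J" "p \<noteq> 0" "q = leading_monomial lt p + w"
    using monomial_in_monomial_ideal by blast
  define r where "r = single (w + u) 1 * p"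
  have r: "r \<in> J" "leading_monomial lt r = q + u"
    using J_mult[OF p(1)] p(2,3) XY.leading_monomial_single_times[of "1 :: 'k" p "w + u"]
    by (simp_all add: r_def add_ac)
  have "keys r \<noteq> {}" using p(2) by (simp add: r_def keys_single_times del: keys_eq_empty) simp
  then have "r \<noteq> 0" by auto
  note lead = XY.leading_monomial[OF this, unfolded r(2)]
  define r' where "r' = restrict_terms (\<lambda>t. bidegree t = bidegree (q + u)) r"
  have "leading_monomial lt r' = q + u"
    by (rule XY.leading_monomial_eqI) (use lead in \<open>auto simp: r'_def keys_restrict_terms\<close>)
  moreover have "r' \<noteq> 0" using lead(1) by (auto simp: r'_def keys_restrict_terms simp flip: keys_eq_empty)
  moreover have "r' \<in> J" unfolding r'_def by (rule J_restrict_terms[OF r(1)])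
  moreover have "\<forall>t\<in>keys r'. bidegree t = bidegree (q + u)" by (simp add: r'_def keys_restrict_terms)
  ultimately show ?thesis by blast
qed

definition standard_monomial :: "'m monomial \<Rightarrow> bool" where
  "standard_monomial b \<longleftrightarrow> \<not> (\<exists>q\<in>quads. \<exists>u. join 0 b = q + u)"

definition standard_below :: "'m monomial \<Rightarrow> 'm monomial set" where
  "standard_below b = {c. standard_monomial c \<and> total_deg c = total_deg b \<and> lty c b}"

lemma finite_standard_below: "finite (standard_below b)"
  unfolding standard_below_def by (rule finite_subset[OF _ finite_monomials_of_degree[of "total_deg b"]]) auto

lemma y_part_keys:
  assumes "p \<noteq> 0" "leading_monomial lt p = join u b" "t \<in> keys p"
  shows "y_part t = b \<or> lty (y_part t) b"
  using XY.leading_monomial(2)[OF assms(1,3)] assms(2)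
  by (cases "t = join u b") (auto simp: induced_order_def)

text \<open>
  A nonstandard \<open>y\<^sup>b\<close> is the leading monomial of a bihomogeneous element of \<open>J\<close>. There the coefficient
  of \<open>y\<^sup>b\<close> is a constant, since its leading monomial is \<open>1\<close>, and the remaining monomials in \<open>y\<close> are
  smaller and of the same degree. Well-founded induction applies to them.
\<close>
lemma straighten:
  "g b \<in> A.span (g ` {c. standard_monomial c \<and> total_deg c = total_deg b \<and> (c = b \<or> lty c b)})"
proof (induction b rule: wfp_induct_rule[OF Y.wf])
  case (1 b)
  let ?S = "{c. standard_monomial c \<and> total_deg c = total_deg b \<and> (c = b \<or> lty c b)}"
  show ?case
  proof (cases "standard_monomial b")
    case True
    then show ?thesis by (intro A.span_base) auto
  next
    case False
    then obtain q u where "q \<in> quads" "join 0 b = q + u" by (auto simp: standard_monomial_def)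
    then obtain p where p: "p \<in> J" "p \<noteq> 0" "leading_monomial lt p = join 0 b"
      and bd: "\<And>t. t \<in> keys p \<Longrightarrow> bidegree t = bidegree (join 0 b)"
      using multiple_is_leading_monomial[of q u] by auto
    note lead = XY.leading_monomial[OF p(2), unfolded p(3)]
    define c where "c = lookup p (join 0 b)"
    have c: "c \<noteq> 0" using lead(1) by (simp add: c_def in_keys_iff)
    have "y_coeff p b = const_poly c"
    proof (rule poly_mapping_eqI)
      fix w
      show "lookup (y_coeff p b) w = lookup (const_poly c) w"
      proof (cases "w = 0")
        case False
        then have "\<not> lt (join w b) (join 0 b)"
          using X.zero_less[of w] X.asym[of 0 w] Y.irrefl by (auto simp: induced_order_def)
        then have "join w b \<notin> keys p"
          using lead(2)[of "join w b"] False by (metis x_part_join)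
        then show ?thesis
          using False by (simp add: lookup_y_coeff in_keys_iff const_poly_def lookup_single)
      qed (simp add: lookup_y_coeff c_def const_poly_def)
    qed
    moreover have "b \<in> y_part ` keys p" using lead(1) by (metis imageI y_part_join)
    moreover have "\<phi> p = 0" using p(1) by (simp add: J_def)
    ultimately have "\<iota> (const_poly c) * g b = 0 - (\<Sum>a\<in>y_part ` keys p - {b}. \<iota> (y_coeff p a) * g a)"
      using phi_y_coeffs[of p] sum.remove[of "y_part ` keys p" b "\<lambda>a. \<iota> (y_coeff p a) * g a"]
      by (simp add: eq_neg_iff_add_eq_0)
    also have "\<dots> \<in> A.span (g ` ?S)"
    proof (intro A.span_diff A.span_sum A.span_zero)
      fix a assume a: "a \<in> y_part ` keys p - {b}"
      then obtain t where t: "t \<in> keys p" "a = y_part t" by auto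
      have "lty a b" using y_part_keys[OF p(2,3) t(1)] t(2) a by auto
      moreover have "total_deg a = total_deg b" using bd[OF t(1)] t(2) by (simp add: bidegree_def)
      ultimately have "{c. standard_monomial c \<and> total_deg c = total_deg a \<and> (c = a \<or> lty c a)} \<subseteq> ?S"
        using Y.trans by auto
      then have "g a \<in> A.span (g ` ?S)" using 1[OF \<open>lty a b\<close>] A.span_mono[OF image_mono] by blast
      then show "\<iota> (y_coeff p a) * g a \<in> A.span (g ` ?S)"
        using A.span_scale by (simp add: scale_via_def)
    qed
    finally have "scale_via \<iota> (const_poly (1 / c)) (\<iota> (const_poly c) * g b) \<in> A.span (g ` ?S)"
      by (rule A.span_scale)
    moreover have "\<iota> (const_poly (1 / c)) * \<iota> (const_poly c) = 1"
      using c ring_hom_1[OF A0_hom]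
      by (simp flip: ring_hom_mult[OF A0_hom] const_poly_mult)
    then have "scale_via \<iota> (const_poly (1 / c)) (\<iota> (const_poly c) * g b) = g b"
      by (simp add: scale_via_def flip: mult.assoc)
    ultimately show ?thesis by simp
  qed
qed

lemma straighten_below:
  assumes "lty c b" "total_deg c = total_deg b"
  shows "g c \<in> A.span (g ` standard_below b)"
proof -
  have "{a. standard_monomial a \<and> total_deg a = total_deg c \<and> (a = c \<or> lty a c)} \<subseteq> standard_below b"
    using assms Y.trans by (auto simp: standard_below_def)
  then show ?thesis using straighten[of c] A.span_mono[OF image_mono] by blast
qed

text \<open>
  Monomials without \<open>y\<close> are smaller than all others, so an element of \<open>J\<close> with such a leading monomial
  would be a nonzero element of \<open>S\<close> that vanishes in \<open>A\<close>.
\<close>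
lemma no_x_quads:
  assumes "q \<in> quads"
  shows "y_part q \<noteq> 0"
proof
  assume q: "y_part q = 0"
  obtain p where p: "p \<in> J" "p \<noteq> 0" "leading_monomial lt p = q"
    using multiple_is_leading_monomial[OF assms, of 0] by auto
  have "y_part ` keys p = {0}"
  proof -
    have "leading_monomial lt p = join (x_part q) 0" using p(3) q join_parts[of q] by simp
    note below = y_part_keys[OF p(2) this]
    have "y_part t = 0" if "t \<in> keys p" for t
      using below[OF that] Y.zero_less[of "y_part t"] Y.asym[of "y_part t" 0] by auto
    then have "y_part ` keys p \<subseteq> {0}" by auto
    moreover have "y_part ` keys p \<noteq> {}" using p(2) by simp
    ultimately show ?thesis by (simp only: subset_singleton_iff simp_thms)
  qed
  then have "\<iota> (y_coeff p 0) = 0"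
    using phi_y_coeffs[of p] p(1) by (simp add: J_def)
  then have "y_coeff p 0 = 0"
    using A0_inj ring_hom_0[OF A0_hom] by (metis injD)
  then have "lookup p (join (x_part q) 0) = 0"
    by (metis lookup_y_coeff lookup_zero)
  then show False
    using XY.leading_monomial(1)[OF p(2)] p(3) join_parts[of q] q by (simp add: in_keys_iff)
qed

text \<open>
  A bihomogeneous element of \<open>J\<close> with leading monomial \<open>x\<^sub>i y\<^sub>l\<close> is linear in \<open>y\<close>, and its coefficient of \<open>y\<^sub>l\<close>
  is a linear form. All its other coefficients are homogeneous; a nonzero constant among them would make
  some \<open>f\<^sub>j\<close> redundant.
\<close>
lemma linear_syzygy_of_quad:
  assumes q: "join (single i 1) (single l 1) \<in> quads"
  obtains k r where "k \<in> forms 1" "k \<noteq> 0" "leading_monomial ltx k = single i 1"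
    "\<iota> k * f l = (\<Sum>j\<in>{j. lty (single j 1) (single l 1)}. \<iota> (r j) * f j)" "\<And>j. lookup (r j) 0 = 0"
proof -
  define w where "w = join (single i 1) (single l 1 :: 'm monomial)"
  obtain p where p: "p \<in> J" "p \<noteq> 0" "leading_monomial lt p = w"
    and bd: "\<And>t. t \<in> keys p \<Longrightarrow> bidegree t = bidegree w"
    using multiple_is_leading_monomial[OF q, of 0] by (auto simp: w_def)
  note lead = XY.leading_monomial[OF p(2), unfolded p(3)]
  have bw: "bidegree w = (1 + d l, 1)"
    by (simp add: bidegree_def w_def y_weight_single[simplified])
  define s where "s j = y_coeff p (single j 1)" for j
  have s_forms: "s j \<in> forms (1 + d l - d j)" for j
    unfolding forms_def
  proof (intro CollectI ballI)
    fix u assume "u \<in> keys (s j)"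
    then have "join u (single j 1) \<in> keys p" by (simp add: s_def in_keys_iff lookup_y_coeff)
    from trans[OF bd[OF this] bw] show "int (total_deg u) = 1 + d l - d j"
      by (simp add: bidegree_def y_weight_single[simplified])
  qed
  have inj: "inj (\<lambda>j::'m. single j (1::nat))"
    by (rule injI) (metis lookup_single_eq lookup_single_not_eq zero_neq_one)
  have supp: "y_part ` keys p \<subseteq> (\<lambda>j. single j 1) ` {j. j = l \<or> lty (single j 1) (single l 1)}"
  proof
    fix b assume "b \<in> y_part ` keys p"
    then obtain t where t: "t \<in> keys p" "b = y_part t" by auto
    have "total_deg b = 1" using trans[OF bd[OF t(1)] bw] t(2) by (simp add: bidegree_def)
    then obtain j where j: "b = single j 1" by (rule total_deg_1E)
    have "b = single l 1 \<or> lty b (single l 1)"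
      using y_part_keys[OF p(2) _ t(1)] p(3) t(2) by (auto simp: w_def)
    then show "b \<in> (\<lambda>j. single j 1) ` {j. j = l \<or> lty (single j 1) (single l 1)}"
      using j inj by (auto simp: inj_def)
  qed
  have zero: "y_coeff p b = 0" if "b \<notin> y_part ` keys p" for b
  proof (rule poly_mapping_eqI)
    fix u
    have "join u b \<notin> keys p" using that by (metis imageI y_part_join)
    then show "lookup (y_coeff p b) u = lookup 0 u" by (simp add: lookup_y_coeff in_keys_iff)
  qed
  have "0 = \<phi> p" using p(1) by (simp add: J_def)
  also have "\<dots> = (\<Sum>b\<in>(\<lambda>j. single j 1) ` {j. j = l \<or> lty (single j 1) (single l 1)}. \<iota> (y_coeff p b) * g b)"
    unfolding phi_y_coeffs using supp zero ring_hom_0[OF A0_hom] by (intro sum.mono_neutral_left) auto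
  also have "\<dots> = (\<Sum>j\<in>{j. j = l \<or> lty (single j 1) (single l 1)}. \<iota> (s j) * f j)"
    using inj by (subst sum.reindex) (auto simp: inj_on_def inj_def s_def eval_monomial_single[simplified])
  also have "{j. j = l \<or> lty (single j 1) (single l 1)} = insert l {j. lty (single j 1) (single l 1)}" by auto
  also have "(\<Sum>j\<in>\<dots>. \<iota> (s j) * f j) = \<iota> (s l) * f l + (\<Sum>j\<in>{j. lty (single j 1) (single l 1)}. \<iota> (s j) * f j)"
    using Y.irrefl by (intro sum.insert) auto
  finally have rel: "\<iota> (s l) * f l + (\<Sum>j\<in>{j. lty (single j 1) (single l 1)}. \<iota> (s j) * f j) = 0" by simp
  have const: "lookup (s j) 0 = 0" if j: "lty (single j 1) (single l 1)" for j
  proof (cases "1 + d l - d j = 0")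
    case False
    then show ?thesis using forms_no_constant[OF s_forms] by blast
  next
    case True
    define c where "c = lookup (s j) 0"
    have sj: "s j = const_poly c" using s_forms[of j] True forms_0_eq_const by (simp add: c_def)
    show ?thesis
    proof (rule ccontr)
      assume "lookup (s j) 0 \<noteq> 0"
      then have c: "c \<noteq> 0" by (simp add: c_def)
      have "j \<noteq> l" using j Y.irrefl by auto
      let ?L = "{j. lty (single j 1) (single l 1)}"
      have "(\<Sum>j\<in>?L. \<iota> (s j) * f j) = \<iota> (s j) * f j + (\<Sum>j\<in>?L - {j}. \<iota> (s j) * f j)"
        using j by (intro sum.remove) auto
      moreover have "a = 0 - b - z" if "x = a + z" "b + x = 0" for a b x z :: 'a
        using that by (simp add: eq_diff_eq eq_neg_iff_add_eq_0 add_ac)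
      ultimately have "\<iota> (s j) * f j = 0 - \<iota> (s l) * f l - (\<Sum>j\<in>?L - {j}. \<iota> (s j) * f j)"
        using rel by blast
      also have "\<dots> \<in> A.span (f ` (UNIV - {j}))"
        using \<open>j \<noteq> l\<close> unfolding scale_via_def[symmetric]
        by (intro A.span_diff A.span_zero A.span_sum A.span_scale A.span_base) auto
      finally have "scale_via \<iota> (const_poly (1 / c)) (scale_via \<iota> (s j) (f j)) \<in> A.span (f ` (UNIV - {j}))"
        unfolding scale_via_def[symmetric] by (rule A.span_scale)
      moreover have "const_poly (1 / c) * s j = 1" using c by (simp add: sj flip: const_poly_mult)
      ultimately have "f j \<in> A.span (f ` (UNIV - {j}))" by simp
      then show False using f_minimal by (auto simp: irredundant_def)
    qed
  qed
  define r where "r j = (if lty (single j 1) (single l 1) then - s j else 0)" for j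
  have leadl: "leading_monomial ltx (s l) = single i 1"
  proof (rule X.leading_monomial_eqI)
    show "single i 1 \<in> keys (s l)"
      using lead(1) by (simp add: s_def in_keys_iff lookup_y_coeff w_def)
    fix u assume u: "u \<in> keys (s l)" "u \<noteq> single i 1"
    then have "join u (single l 1) \<in> keys p" "join u (single l 1) \<noteq> w"
      by (auto simp: s_def in_keys_iff lookup_y_coeff w_def join_eq_iff)
    from lead(2)[OF this] show "ltx u (single i 1)"
      using Y.irrefl by (auto simp: induced_order_def w_def)
  qed
  have "lookup (s l) (single i 1) \<noteq> 0"
    using lead(1) by (simp add: s_def in_keys_iff lookup_y_coeff w_def)
  then have "s l \<noteq> 0" by auto
  moreover have "\<iota> (s l) * f l = (\<Sum>j\<in>{j. lty (single j 1) (single l 1)}. \<iota> (r j) * f j)"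
  proof -
    have "(\<Sum>j\<in>{j. lty (single j 1) (single l 1)}. \<iota> (r j) * f j) =
        (\<Sum>j\<in>{j. lty (single j 1) (single l 1)}. - (\<iota> (s j) * f j))"
      by (intro sum.cong) (auto simp: r_def additive.minus[OF ring_hom_additive[OF A0_hom]])
    also have "\<dots> = \<iota> (s l) * f l"
      unfolding sum_negf using rel by (metis eq_neg_iff_add_eq_0)
    finally show ?thesis by (rule sym)
  qed
  moreover have "lookup (r j) 0 = 0" for j using const by (simp add: r_def)
  ultimately show ?thesis
    using s_forms[of l] leadl by (intro that[of "s l" r]) auto
qed

text \<open>
  The leading monomials of the colon ideal are governed by linear forms in it. These forms
  even map \<open>g b\<close> into \<open>\<mm>\<close> times the span of the smaller standard monomials, which is what
  minimality of the generators requires.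
\<close>
lemma colon_leading_monomial:
  assumes b: "standard_monomial b" and s: "s \<noteq> 0" "\<iota> s * g b \<in> A.span (g ` standard_below b)"
  obtains k u where "k \<in> forms 1" "k \<noteq> 0" "leading_monomial ltx s = u + leading_monomial ltx k"
    "\<iota> k * g b \<in> A.\<mm> (g ` standard_below b)"
proof -
  let ?B = "standard_below b"
  obtain r where r: "\<iota> s * g b = (\<Sum>c\<in>?B. scale_via \<iota> (r c) (g c))"
    by (rule A.span_imageE[OF s(2) finite_standard_below])
  define v where "v c = (if c = b then s else - r c)" for c
  define p where "p = assemble (insert b ?B) v"
  have fin: "finite (insert b ?B)" using finite_standard_below by simp
  have nb: "b \<notin> ?B" using Y.irrefl by (auto simp: standard_below_def)
  have "\<phi> p = \<iota> s * g b + (\<Sum>c\<in>?B. \<iota> (v c) * g c)"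
    unfolding p_def phi_assemble[OF fin] using nb finite_standard_below by (simp add: v_def)
  also have "(\<Sum>c\<in>?B. \<iota> (v c) * g c) = (\<Sum>c\<in>?B. - scale_via \<iota> (r c) (g c))"
    using nb by (intro sum.cong) (auto simp: v_def scale_via_def additive.minus[OF ring_hom_additive[OF A0_hom]])
  finally have pJ: "p \<in> J" using r by (simp add: J_def sum_negf)
  have lookup_p: "lookup p t = (if y_part t \<in> insert b ?B then lookup (v (y_part t)) (x_part t) else 0)" for t
    unfolding p_def by (rule lookup_assemble[OF fin])
  note leads = X.leading_monomial[OF s(1)]
  define w where "w = join (leading_monomial ltx s) b"
  have w_key: "w \<in> keys p"
    using leads(1) by (simp add: in_keys_iff lookup_p w_def v_def)
  have lead: "leading_monomial lt p = w"
  proof (rule XY.leading_monomial_eqI[OF w_key])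
    fix t assume t: "t \<in> keys p" "t \<noteq> w"
    then have y: "y_part t \<in> insert b ?B" "lookup (v (y_part t)) (x_part t) \<noteq> 0"
      by (auto simp: in_keys_iff lookup_p split: if_splits)
    show "lt t w"
    proof (cases "y_part t = b")
      case True
      then have "x_part t \<in> keys s" "x_part t \<noteq> leading_monomial ltx s"
        using y(2) t(2) by (auto simp: v_def in_keys_iff w_def join_eq_iff eq_commute[of t])
      then show ?thesis using leads(2) True by (simp add: induced_order_def w_def)
    next
      case False
      then show ?thesis using y(1) by (simp add: induced_order_def w_def standard_below_def)
    qed
  qed
  have "p \<noteq> 0" using w_key by auto
  from leading_monomial_divisible[OF pJ this] obtain q z where q: "q \<in> quads" "w = q + z"
    unfolding lead by blast
  have xs: "leading_monomial ltx s = x_part q + x_part z" and yb: "b = y_part q + y_part z"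
    using arg_cong[OF q(2), of x_part] arg_cong[OF q(2), of y_part]
    by (auto simp: w_def x_part_add y_part_add)
  have "x_part q \<noteq> 0"
  proof
    assume "x_part q = 0"
    then have "join 0 (y_part q) = q" using join_parts[of q] by simp
    then have "join 0 b = q + join 0 (y_part z)"
      using join_add[of "0 :: 'n monomial" 0 "y_part q" "y_part z"] unfolding yb by simp
    with b q(1) show False by (auto simp: standard_monomial_def)
  qed
  moreover note no_x_quads[OF q(1)]
  moreover have "total_deg (x_part q) + total_deg (y_part q) = 2"
    using quads(1)[OF q(1)] total_deg_parts[of q] by simp
  ultimately have "total_deg (x_part q) = 1" "total_deg (y_part q) = 1"
    using total_deg_eq_0_iff[of "x_part q"] total_deg_eq_0_iff[of "y_part q"] by linarith+
  then obtain i l where il: "x_part q = single i 1" "y_part q = single l 1"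
    by (meson total_deg_1E)
  then have "join (single i 1) (single l 1) \<in> quads" using q(1) join_parts[of q] by simp
  then obtain k r where k: "k \<in> forms 1" "k \<noteq> 0" "leading_monomial ltx k = single i 1"
    and rel: "\<iota> k * f l = (\<Sum>j\<in>{j. lty (single j 1) (single l 1)}. \<iota> (r j) * f j)" "\<And>j. lookup (r j) 0 = 0"
    by (rule linear_syzygy_of_quad) (rule that)
  (* multiply the linear syzygy by the complementary monomial in y and rewrite by standard monomials *)
  have "\<iota> k * g b = (\<iota> k * f l) * g (y_part z)"
    unfolding yb il eval_monomial_add eval_monomial_single by (simp only: mult.assoc)
  also have "\<dots> = (\<Sum>j\<in>{j. lty (single j 1) (single l 1)}. scale_via \<iota> (r j) (g (single j 1 + y_part z)))"
    unfolding rel(1) sum_distrib_right scale_via_def eval_monomial_add eval_monomial_single by (simp only: mult.assoc)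
  also have "\<dots> \<in> A.\<mm> (g ` ?B)"
  proof (rule A.subspace_sum[OF A.\<mm>_subspace])
    fix j assume "j \<in> {j. lty (single j 1) (single l 1)}"
    then have "lty (single j 1 + y_part z) b"
      unfolding yb il using Y.add_right by blast
    then have "g (single j 1 + y_part z) \<in> A.span (g ` ?B)"
      by (rule straighten_below) (simp add: yb il total_deg_add)
    with rel(2) show "scale_via \<iota> (r j) (g (single j 1 + y_part z)) \<in> A.\<mm> (g ` ?B)"
      by (intro A.scale_in_\<mm>)
  qed
  finally have "\<iota> k * g b \<in> A.\<mm> (g ` ?B)" .
  moreover have "leading_monomial ltx s = x_part z + leading_monomial ltx k"
    by (simp add: xs il k(3) add.commute)
  ultimately show ?thesis using that[OF k(1,2)] by blast
qed

text \<open>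
  Division with remainder: subtracting a multiple of one of the linear forms lowers the leading
  monomial.
\<close>
lemma colon_standard:
  assumes "standard_monomial b"
  shows "colon_ideal (scale_via \<iota>) (g ` standard_below b) (g b) =
    ideal_generated {k \<in> forms 1. \<iota> k * g b \<in> A.\<mm> (g ` standard_below b)}"
    (is "?C = ideal_generated ?L")
proof
  show "ideal_generated ?L \<subseteq> ?C"
    by (rule A.ideal_subset_colon) (use A.\<mm>_subset_span in \<open>auto simp: scale_via_def\<close>)
  have C: "s \<in> ?C \<longleftrightarrow> \<iota> s * g b \<in> A.span (g ` standard_below b)" for s
    by (simp add: colon_ideal_def scale_via_def)
  have "\<forall>s. s \<in> ?C \<longrightarrow> s \<noteq> 0 \<longrightarrow> leading_monomial ltx s = t \<longrightarrow> s \<in> ideal_generated ?L" for t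
  proof (induction t rule: wfp_induct_rule[OF X.wf])
    case (1 t)
    show ?case
    proof (intro allI impI)
      fix s assume s: "s \<in> ?C" "s \<noteq> 0" "leading_monomial ltx s = t"
      then have "\<iota> s * g b \<in> A.span (g ` standard_below b)" by (simp add: C)
      then obtain k u where k: "k \<in> forms 1" "k \<noteq> 0" "t = u + leading_monomial ltx k"
        "\<iota> k * g b \<in> A.\<mm> (g ` standard_below b)"
        using colon_leading_monomial[OF assms s(2)] s(3) by metis
      then have kL: "k \<in> ideal_generated ?L" by (intro ideal_base) simp
      define a where "a = lookup s t / lookup k (leading_monomial ltx k)"
      have lc: "lookup k (leading_monomial ltx k) \<noteq> 0" "lookup s t \<noteq> 0"
        using X.leading_monomial(1)[OF k(2)] X.leading_monomial(1)[OF s(2)] s(3) by (simp_all add: in_keys_iff)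
      then have a: "a \<noteq> 0" by (simp add: a_def)
      define q where "q = single u a * k"
      have q: "q \<in> ideal_generated ?L" unfolding q_def by (rule ideal_mult[OF kL])
      have lq: "leading_monomial ltx q = t"
        unfolding q_def by (simp add: X.leading_monomial_single_times[OF a k(2)] k(3))
      have cq: "lookup q t = lookup s t"
        using lc by (simp add: q_def k(3) lookup_single_times a_def)
      then have q0: "q \<noteq> 0" using lc by auto
      have "q \<in> ?C" using q \<open>ideal_generated ?L \<subseteq> ?C\<close> by auto
      then have diff: "s - q \<in> ?C" using s(1) A.colon_ideal_subspace ideal.subspace_diff by blast
      have "s - q \<in> ideal_generated ?L"
      proof (cases "s - q = 0")
        case True
        then show ?thesis by (simp add: ideal_zero)
      next
        case False
        then have "ltx (leading_monomial ltx (s - q)) t"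
          using X.leading_monomial_cancel[OF s(2) q0] s(3) lq cq by simp
        from 1[OF this] diff False show ?thesis by blast
      qed
      from ideal_add[OF this q] show "s \<in> ideal_generated ?L" by simp
    qed
  qed
  then show "?C \<subseteq> ideal_generated ?L" using ideal_zero by blast
qed

text \<open>
  The algebra is generated by \<open>A\<^sub>0\<close> and \<open>A\<^sub>1\<close>, and the image of \<open>\<phi>\<close> contains \<open>S\<close> and the \<open>f\<^sub>j\<close>.
\<close>
lemma phi_surj: "range \<phi> = UNIV"
proof -
  have add: "a + b \<in> range \<phi>" and mult: "a * b \<in> range \<phi>" and diff: "a - b \<in> range \<phi>"
    if "a \<in> range \<phi>" "b \<in> range \<phi>" for a b
    using that by (auto simp flip: ring_hom_add[OF phi_hom] ring_hom_mult[OF phi_hom] ring_hom_diff[OF phi_hom])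
  have zero: "0 \<in> range \<phi>" using ring_hom_0[OF phi_hom] by (metis rangeI)
  have \<iota>_range: "\<iota> s \<in> range \<phi>" for s
  proof (induction s rule: polynomial_induct)
    case (const c)
    show ?case using phi_const[of c] A0_const[of c] by (metis rangeI)
  next
    case (var v)
    show ?case using phi_x[of v] by (metis rangeI)
  qed (auto simp: ring_hom_add[OF A0_hom] ring_hom_mult[OF A0_hom] intro: add mult)
  have sum: "sum x E \<in> range \<phi>" if "\<And>e. e \<in> E \<Longrightarrow> x e \<in> range \<phi>" for x and E :: "int set"
    using that by (induction E rule: infinite_finite_induct) (auto intro: add zero)
  have "component G 0 \<subseteq> range \<phi>"
  proof
    fix a assume "a \<in> component G 0"
    then obtain c where c: "a = (\<Sum>i\<in>keys c. lookup c i)" "\<And>i. lookup c i \<in> G i 0"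
      by (auto simp: component_def family_sum_def)
    have "lookup c i \<in> range \<phi>" for i
    proof -
      obtain s where "lookup c i = \<iota> s" using c(2)[of i] A0_graded[of i] by blast
      then show ?thesis using \<iota>_range by simp
    qed
    then show "a \<in> range \<phi>" unfolding c(1) by (intro sum)
  qed
  moreover have "component G 1 \<subseteq> range \<phi>"
    unfolding f_generates[symmetric]
  proof (rule A.span_minimal)
    show "range f \<subseteq> range \<phi>" using phi_y by (metis image_subsetI rangeI)
    show "A.subspace (range \<phi>)"
      by (intro A.subspaceI zero add) (auto simp: scale_via_def intro: mult \<iota>_range)
  qed
  ultimately have "component G 0 \<union> component G 1 \<subseteq> range \<phi>" by simp
  moreover have "a \<in> range \<phi>" if "a \<in> subring_generated B" "B \<subseteq> range \<phi>" for a B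
    using that
  proof induction
    case one
    show ?case using ring_hom_1[OF phi_hom] by (metis rangeI)
  qed (auto intro: diff mult)
  ultimately show ?thesis using standard unfolding fg_standard_graded_def by blast
qed

lemma monomials_span:
  assumes "x \<in> G i k"
  shows "x \<in> A.span (g ` {b. standard_monomial b \<and> total_deg b = k})"
proof -
  let ?S = "g ` {b. standard_monomial b \<and> total_deg b = k}"
  obtain p where "x = \<phi> p" using phi_surj by blast
  with assms have "x = \<phi> (restrict_terms (\<lambda>t. bidegree t = (i, k)) p)"
    using phi_restrict_terms[of p "(i, k)"] by simp
  also have "\<dots> \<in> A.span ?S"
    unfolding phi_y_coeffs[of "restrict_terms _ _"] scale_via_def[symmetric]
  proof (intro A.span_sum A.span_scale)
    fix b assume "b \<in> y_part ` keys (restrict_terms (\<lambda>t. bidegree t = (i, k)) p)"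
    then have "total_deg b = k" by (auto simp: keys_restrict_terms bidegree_def)
    then have "{c. standard_monomial c \<and> total_deg c = total_deg b \<and> (c = b \<or> lty c b)}
        \<subseteq> {b. standard_monomial b \<and> total_deg b = k}" by auto
    then show "g b \<in> A.span ?S" using straighten[of b] A.span_mono[OF image_mono] by blast
  qed
  finally show ?thesis .
qed

text \<open>
  The standard monomials are listed increasingly, so that those preceding \<open>b\<close> are exactly the members of
  \<open>standard_below b\<close>.
\<close>
theorem component_linear_quotients:
  "\<exists>gs. homogeneous_minimal_generators (scale_via \<iota>) (\<lambda>i. G i k) gs \<and> linear_quotients (scale_via \<iota>) gs"
proof -
  interpret gm: graded_module "scale_via \<iota>" "\<lambda>i. G i k" by (rule graded_component)
  let ?S = "{b. standard_monomial b \<and> total_deg b = k}"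
  have "finite ?S" by (rule finite_subset[OF _ finite_monomials_of_degree[of k]]) auto
  then obtain bs where bs: "set bs = ?S" "sorted_wrt lty bs" using Y.finite_sorted_list by blast
  define gs where "gs = map g bs"
  have take: "set (take i gs) = g ` standard_below (bs ! i)" if "i < length bs" for i
  proof -
    have "bs ! i \<in> ?S" using that bs(1) nth_mem by blast
    then have "{c \<in> set bs. lty c (bs ! i)} = standard_below (bs ! i)"
      unfolding bs(1) by (auto simp: standard_below_def)
    then show ?thesis
      using Y.set_take_sorted[OF bs(2) that] by (simp add: gs_def take_map)
  qed
  define L where "L b = {k \<in> forms 1. \<iota> k * g b \<in> A.\<mm> (g ` standard_below b)}" for b
  have colon: "colon_ideal (scale_via \<iota>) (set (take i gs)) (gs ! i) = ideal_generated (L (bs ! i))"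
    if i: "i < length gs" for i
  proof -
    have i: "i < length bs" using i by (simp add: gs_def)
    have "standard_monomial (bs ! i)" using i bs(1) nth_mem by blast
    from colon_standard[OF this] show ?thesis
      unfolding take[OF i] L_def using i by (simp add: gs_def)
  qed
  have "linear_quotients (scale_via \<iota>) gs"
    unfolding linear_quotients_def
  proof (intro allI impI)
    fix i assume "i < length gs"
    then show "generated_by_linear_forms (colon_ideal (scale_via \<iota>) (set (take i gs)) (gs ! i))"
      unfolding generated_by_linear_forms_def using colon by (intro exI[of _ "L (bs ! i)"]) (auto simp: L_def)
  qed
  moreover have "irredundant (scale_via \<iota>) (\<lambda>i. gs ! i) {..<length gs}"
  proof (rule A.irredundantI)
    fix i s
    assume i: "i < length gs" and s: "s \<in> colon_ideal (scale_via \<iota>) (set (take i gs)) (gs ! i)"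
    have i': "i < length bs" using i by (simp add: gs_def)
    let ?K = "{s. lookup s 0 = 0 \<and> scale_via \<iota> s (gs ! i) \<in> A.\<mm> (set (take i gs))}"
    have "ideal_generated (L (bs ! i)) \<subseteq> ?K"
      unfolding ideal_generated_def
    proof (rule ideal.span_minimal)
      have "gs ! i = g (bs ! i)" using i' by (simp add: gs_def)
      then show "L (bs ! i) \<subseteq> ?K"
        using forms_no_constant[of _ 1] by (auto simp: L_def take[OF i'] scale_via_def)
      show "ideal.subspace ?K"
        using A.\<mm>_subspace[of "set (take i gs)"]
        by (intro ideal.subspaceI)
           (auto simp: A.subspace_0 lookup_add no_constant_mult A.scale_left_distrib
             intro: A.subspace_add A.subspace_scale simp flip: A.scale_scale)
    qed
    with s show "lookup s 0 = 0 \<and> scale_via \<iota> s (gs ! i) \<in> A.\<mm> (set (take i gs))"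
      unfolding colon[OF i] by auto
  qed
  moreover have mem: "\<exists>e. x \<in> G e k" if "x \<in> set gs" for x
    using that bs(1) g_mem by (auto simp: gs_def)
  moreover have "A.span (set gs) = family_sum (\<lambda>i. G i k)"
    unfolding gm.family_sum_eq_span
  proof
    show "A.span (set gs) \<subseteq> A.span (\<Union>e. G e k)" by (rule A.span_mono) (use mem in auto)
    have "(\<Union>e. G e k) \<subseteq> A.span (set gs)"
      using monomials_span[of _ _ k] bs(1) by (auto simp: gs_def)
    then show "A.span (\<Union>e. G e k) \<subseteq> A.span (set gs)" by (simp add: A.span_subset_iff)
  qed
  ultimately show ?thesis unfolding homogeneous_minimal_generators_def by blast
qed

end

theorem theorem1p1:
  fixes \<kappa> :: "'k::field \<Rightarrow> 'a::comm_ring_1"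
    and G :: "int \<Rightarrow> nat \<Rightarrow> 'a set"
    and \<iota> :: "('n::finite, 'k) mpoly \<Rightarrow> 'a"
    and f :: "'m::finite \<Rightarrow> 'a"
    and d :: "'m \<Rightarrow> int"
    and \<phi> :: "('n + 'm, 'k) mpoly \<Rightarrow> 'a"
    and J :: "('n + 'm, 'k) mpoly set"
    and lty :: "'m monomial \<Rightarrow> 'm monomial \<Rightarrow> bool"
    and ltx :: "'n monomial \<Rightarrow> 'n monomial \<Rightarrow> bool"
  assumes bigraded: "bigraded_algebra \<kappa> G"
    and A00: "G 0 0 = range \<kappa>"
    and A0_hom: "is_ring_hom \<iota>" and A0_inj: "inj \<iota>" and A0_const: "\<And>c. \<iota> (const_poly c) = \<kappa> c"
    and A0_graded: "\<And>i. \<iota> ` forms i = G i 0"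
    and standard: "fg_standard_graded G"
    and A1_nonneg: "\<And>i. i < 0 \<Longrightarrow> G i 1 = {0}"
    and f_degree: "\<And>j. f j \<in> G (d j) 1"
    and f_generates: "module.span (scale_via \<iota>) (range f) = component G 1"
    and f_minimal: "irredundant (scale_via \<iota>) f UNIV"
    and phi_hom: "is_ring_hom \<phi>" and phi_const: "\<And>c. \<phi> (const_poly c) = \<kappa> c"
    and phi_x: "\<And>i. \<phi> (var_poly (Inl i)) = \<iota> (var_poly i)"
    and phi_y: "\<And>j. \<phi> (var_poly (Inr j)) = f j"
    and J_def: "J = {p. \<phi> p = 0}"
    and lty: "monomial_order lty" and ltx: "monomial_order ltx"
    and quadratic: "generated_by_quadratic_monomials (initial_ideal (induced_order lty ltx) J)"
  shows "\<forall>k\<ge>1.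
           (\<exists>gs. homogeneous_minimal_generators (scale_via \<iota>) (\<lambda>i. G i k) gs \<and> linear_quotients (scale_via \<iota>) gs) \<and>
           componentwise_linear (scale_via \<iota>) (\<lambda>i. G i k)"
proof (intro allI impI)
  fix k :: nat
  interpret quadratic_initial_ideal \<kappa> G \<iota> f d \<phi> J lty ltx
    using assms by (auto simp: quadratic_initial_ideal_def quadratic_initial_ideal_axioms_def)
  interpret gm: graded_module "scale_via \<iota>" "\<lambda>i. G i k" by (rule graded_component)
  show "(\<exists>gs. homogeneous_minimal_generators (scale_via \<iota>) (\<lambda>i. G i k) gs \<and> linear_quotients (scale_via \<iota>) gs) \<and>
      componentwise_linear (scale_via \<iota>) (\<lambda>i. G i k)"
    using component_linear_quotients[of k] gm.linear_quotients_imp_componentwise_linear by blast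
qed

end
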